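(* Let $\Gamma$ be a connected planar finite acyclic quiver with arrow set $E=\{p_1,\dots,p_{\gamma_1}\}$ and let the ground field $\mathbf{k}$ be of characteristic $0$. Then the Lie algebra $HH^1(\mathbf{k}\Gamma)$ is the semi-direct sum of the Lie ideal $\mathfrak{D}_{AL}$ and the abelian Lie subalgebra $\mathfrak{D}_F$: $$HH^1(\mathbf{k}\Gamma)=\mathfrak{D}_{AL}\rtimes_\varphi\mathfrak{D}_F.$$ Here the action $\varphi$ of $\mathfrak{D}_F$ on $\mathfrak{D}_{AL}$ is as follows: for each face derivation $D_{\mathfrak{c}}=a_1D_{p_1,p_1}+a_2D_{p_2,p_2}+\cdots+a_{\gamma_1}D_{p_{\gamma_1},p_{\gamma_1}}$ and each $D_{r,s}$ with $(r,s)\in\Gamma_{AL}$, $r=p_{i_0}$ and $s=p_{i_1}\cdots p_{i_t}$, the element $D_{r,s}$ is an eigenvector under the adjoint action of $D_{\mathfrak{c}}$ with eigenvalue $-a_{i_0}+a_{i_1}+\cdots+a_{i_t}$.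
   Context: A quiver $\Gamma=(V,E,t,h)$ consists of a set $V$ of vertices, a set $E$ of arrows and maps $t,h:E\to V$ (tail and head). It is acyclic if it has no oriented cycles, and connected if its underlying graph is connected. A path of length $\ell\ge0$ is $p=v_0p_1v_1\cdots p_\ell v_\ell$ with $p_j\in E$, $t(p_j)=v_{j-1}$, $h(p_j)=v_j$; $t(p)=v_0$, $h(p)=v_\ell$; vertices are the paths of length $0$; $\mathcal{P}$ is the set of paths. The path algebra $\mathbf{k}\Gamma$ has basis $\mathcal{P}$, with product of $p,q$ the concatenation $pq$ if $h(p)=t(q)$ and $0$ otherwise. $p\parallel q$ means $t(p)=t(q)$ and $h(p)=h(q)$. $HH^1(\mathbf{k}\Gamma)=\mathrm{Der}(\mathbf{k}\Gamma)/\mathrm{InDer}(\mathbf{k}\Gamma)$ is the Lie algebra of derivations (under commutator) modulo inner derivations $D_a(b)=ab-ba$. For $r\in E$, $s\in\mathcal{P}$, $s\parallel r$, $D_{r,s}$ is the derivation of $\mathbf{k}\Gamma$ with $D_{r,s}(v)=0$ for $v\in V$, $D_{r,s}(r)=s$ and $D_{r,s}(q)=0$ for $q\in E$, $q\ne r$. $\Gamma_{AL}$ is the set of almost oriented cycles: pairs $(p,r)$ with $p\in E$, $r\in\mathcal{P}$, $r\neq p$, $r\parallel p$. $\mathfrak{D}_{AL}$ is the $\mathbf{k}$-span of $\{D_{p,r}\mid(p,r)\in\Gamma_{AL}\}$. A planar quiver comes with a fixed embedding of its underlying graph in the plane (equivalently, in the Riemann sphere). Its faces are the connected components of the complement of $\Gamma$.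 The boundary $\mathfrak{c}=\mathfrak{c}_f$ of a face $f$ is called a primitive cycle. The face derivation $D_{\mathfrak{c}}$ is the derivation of $\mathbf{k}\Gamma$ with $D_{\mathfrak{c}}(v)=0$ for $v\in V$ and, for $p\in E$, $D_{\mathfrak{c}}(p)=p$ if $p$ is clockwise on $\mathfrak{c}$, $-p$ if $p$ is counterclockwise on $\mathfrak{c}$, and $0$ if $p$ is not on $\mathfrak{c}$; clockwise is as viewed from inside $f$ (i.e. $f$ lies on the right of $p$). If both sides of $p$ lie in $f$, then $p$ occurs once in each direction, the contributions cancel, and $D_{\mathfrak{c}}(p)=0$. $\mathfrak{D}_F$ is the $\mathbf{k}$-span of all face derivations. $\mathfrak{D}_{AL}$ and $\mathfrak{D}_F$ are identified with their images in $HH^1(\mathbf{k}\Gamma)$.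
   Formalization: That D_AL is a Lie ideal, hence the semi-direct sum of Lie algebras, is claimed only when no two distinct arrows share tail and head, as it fails otherwise (e.g. Kronecker quiver); the vector space direct sum, abelian D_F and the eigenvalue formula hold in general. *)

theory Defs
  imports
    "HOL-Complex_Analysis.Complex_Analysis"
    "HOL-Algebra.Algebraic_Closure_Type"
    "HOL-Algebra.QuotRing"
    "Graph_Theory.Graph_Theory"
begin

section \<open>Algebras and Lie algebras over a field\<close>

text \<open>
  Associative algebras and Lie algebras over a field \<open>'k\<close> are both represented by the
  \<open>module\<close> record of HOL-Algebra, with base ring \<^const>\<open>ring_of_type_algebra\<close>. The field
  \<open>mult\<close> holds the product, respectively the Lie bracket. For Lie algebras the field \<open>one\<close>
  has no meaning.
\<close>

locale lie_algebra =
  module "ring_of_type_algebra :: 'k ring" L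
  for L :: "('k::field, 'x) module" (structure) +
  assumes bracket_closed:
      "\<lbrakk>x \<in> carrier L; y \<in> carrier L\<rbrakk> \<Longrightarrow> x \<otimes>\<^bsub>L\<^esub> y \<in> carrier L"
    and bracket_add_left:
      "\<lbrakk>x \<in> carrier L; y \<in> carrier L; z \<in> carrier L\<rbrakk>
        \<Longrightarrow> (x \<oplus>\<^bsub>L\<^esub> y) \<otimes>\<^bsub>L\<^esub> z = (x \<otimes>\<^bsub>L\<^esub> z) \<oplus>\<^bsub>L\<^esub> (y \<otimes>\<^bsub>L\<^esub> z)"
    and bracket_add_right:
      "\<lbrakk>x \<in> carrier L; y \<in> carrier L; z \<in> carrier L\<rbrakk>
        \<Longrightarrow> x \<otimes>\<^bsub>L\<^esub> (y \<oplus>\<^bsub>L\<^esub> z) = (x \<otimes>\<^bsub>L\<^esub> y) \<oplus>\<^bsub>L\<^esub> (x \<otimes>\<^bsub>L\<^esub> z)"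
    and bracket_smult_left:
      "\<lbrakk>x \<in> carrier L; y \<in> carrier L\<rbrakk> \<Longrightarrow> (c \<odot>\<^bsub>L\<^esub> x) \<otimes>\<^bsub>L\<^esub> y = c \<odot>\<^bsub>L\<^esub> (x \<otimes>\<^bsub>L\<^esub> y)"
    and bracket_smult_right:
      "\<lbrakk>x \<in> carrier L; y \<in> carrier L\<rbrakk> \<Longrightarrow> x \<otimes>\<^bsub>L\<^esub> (c \<odot>\<^bsub>L\<^esub> y) = c \<odot>\<^bsub>L\<^esub> (x \<otimes>\<^bsub>L\<^esub> y)"
    and bracket_alternating:
      "x \<in> carrier L \<Longrightarrow> x \<otimes>\<^bsub>L\<^esub> x = \<zero>\<^bsub>L\<^esub>"
    and jacobi:
      "\<lbrakk>x \<in> carrier L; y \<in> carrier L; z \<in> carrier L\<rbrakk>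
        \<Longrightarrow> (x \<otimes>\<^bsub>L\<^esub> (y \<otimes>\<^bsub>L\<^esub> z)) \<oplus>\<^bsub>L\<^esub> (y \<otimes>\<^bsub>L\<^esub> (z \<otimes>\<^bsub>L\<^esub> x))
              \<oplus>\<^bsub>L\<^esub> (z \<otimes>\<^bsub>L\<^esub> (x \<otimes>\<^bsub>L\<^esub> y)) = \<zero>\<^bsub>L\<^esub>"

definition linear_subspace :: "('k::field, 'x) module \<Rightarrow> 'x set \<Rightarrow> bool" where
  "linear_subspace L W \<longleftrightarrow> submodule W (ring_of_type_algebra :: 'k ring) L"

definition linear_span :: "('k::field, 'x) module \<Rightarrow> 'x set \<Rightarrow> 'x set" where
  "linear_span L B = \<Inter> {W. linear_subspace L W \<and> B \<subseteq> W}"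

definition lie_subalgebra :: "('k::field, 'x) module \<Rightarrow> 'x set \<Rightarrow> bool" where
  "lie_subalgebra L S \<longleftrightarrow> linear_subspace L S \<and> (\<forall>x\<in>S. \<forall>y\<in>S. x \<otimes>\<^bsub>L\<^esub> y \<in> S)"

definition abelian_lie_subalgebra :: "('k::field, 'x) module \<Rightarrow> 'x set \<Rightarrow> bool" where
  "abelian_lie_subalgebra L S \<longleftrightarrow>
     lie_subalgebra L S \<and> (\<forall>x\<in>S. \<forall>y\<in>S. x \<otimes>\<^bsub>L\<^esub> y = \<zero>\<^bsub>L\<^esub>)"

definition lie_ideal :: "('k::field, 'x) module \<Rightarrow> 'x set \<Rightarrow> bool" where
  "lie_ideal L I \<longleftrightarrow> linear_subspace L I \<and> (\<forall>x\<in>carrier L. \<forall>y\<in>I. x \<otimes>\<^bsub>L\<^esub> y \<in> I)"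

definition direct_sum_decomposition ::
  "('k::field, 'x) module \<Rightarrow> 'x set \<Rightarrow> 'x set \<Rightarrow> bool" where
  "direct_sum_decomposition L U W \<longleftrightarrow>
     linear_subspace L U \<and> linear_subspace L W \<and>
     U \<inter> W = {\<zero>\<^bsub>L\<^esub>} \<and> U <+>\<^bsub>L\<^esub> W = carrier L"

text \<open>
  Internal semi-direct sum: the ideal \<open>I\<close> is complemented by the subalgebra \<open>S\<close>, which acts on
  \<open>I\<close> by the adjoint action.
\<close>

definition lie_semidirect_sum :: "('k::field, 'x) module \<Rightarrow> 'x set \<Rightarrow> 'x set \<Rightarrow> bool" where
  "lie_semidirect_sum L I S \<longleftrightarrow>
     lie_algebra L \<and> lie_ideal L I \<and> lie_subalgebra L S \<and> direct_sum_decomposition L I S"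

definition lie_quotient :: "('k::field, 'x) module \<Rightarrow> 'x set \<Rightarrow> ('k, 'x set) module" where
  "lie_quotient L I =
     \<lparr>carrier = a_rcosets\<^bsub>L\<^esub> I, mult = rcoset_mult L I, one = undefined,
      zero = I, add = set_add L, smult = (\<lambda>c C. \<Union>x\<in>C. I +>\<^bsub>L\<^esub> (c \<odot>\<^bsub>L\<^esub> x))\<rparr>"


section \<open>Derivations and the first Hochschild cohomology\<close>

text \<open>
  Linear maps on an algebra \<open>A\<close> are extensional functions on its carrier, so that equality of
  derivations is equality of functions.
\<close>

definition derivations :: "('k::field, 'x) module \<Rightarrow> ('x \<Rightarrow> 'x) set" where
  "derivations A =
     {D \<in> carrier A \<rightarrow>\<^sub>E carrier A.
        (\<forall>x\<in>carrier A. \<forall>y\<in>carrier A. D (x \<oplus>\<^bsub>A\<^esub> y) = D x \<oplus>\<^bsub>A\<^esub> D y) \<and>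
        (\<forall>c. \<forall>x\<in>carrier A. D (c \<odot>\<^bsub>A\<^esub> x) = c \<odot>\<^bsub>A\<^esub> D x) \<and>
        (\<forall>x\<in>carrier A. \<forall>y\<in>carrier A.
           D (x \<otimes>\<^bsub>A\<^esub> y) = (D x \<otimes>\<^bsub>A\<^esub> y) \<oplus>\<^bsub>A\<^esub> (x \<otimes>\<^bsub>A\<^esub> D y))}"

definition Der :: "('k::field, 'x) module \<Rightarrow> ('k, 'x \<Rightarrow> 'x) module" where
  "Der A =
     \<lparr>carrier = derivations A,
      mult = (\<lambda>D E. \<lambda>x\<in>carrier A. D (E x) \<ominus>\<^bsub>A\<^esub> E (D x)), one = undefined,
      zero = (\<lambda>x\<in>carrier A. \<zero>\<^bsub>A\<^esub>), add = (\<lambda>D E. \<lambda>x\<in>carrier A. D x \<oplus>\<^bsub>A\<^esub> E x),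
      smult = (\<lambda>c D. \<lambda>x\<in>carrier A. c \<odot>\<^bsub>A\<^esub> D x)\<rparr>"

definition inner_derivation :: "('k::field, 'x) module \<Rightarrow> 'x \<Rightarrow> 'x \<Rightarrow> 'x" where
  "inner_derivation A a = (\<lambda>b\<in>carrier A. (a \<otimes>\<^bsub>A\<^esub> b) \<ominus>\<^bsub>A\<^esub> (b \<otimes>\<^bsub>A\<^esub> a))"

definition InDer :: "('k::field, 'x) module \<Rightarrow> ('x \<Rightarrow> 'x) set" where
  "InDer A = inner_derivation A ` carrier A"

definition HH1 :: "('k::field, 'x) module \<Rightarrow> ('k, ('x \<Rightarrow> 'x) set) module" where
  "HH1 A = lie_quotient (Der A) (InDer A)"

definition HH1_class :: "('k::field, 'x) module \<Rightarrow> ('x \<Rightarrow> 'x) \<Rightarrow> ('x \<Rightarrow> 'x) set" where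
  "HH1_class A D = InDer A +>\<^bsub>Der A\<^esub> D"


section \<open>Path algebras\<close>

text \<open>
  A quiver is a \<open>pre_digraph\<close> satisfying \<^locale>\<open>wf_digraph\<close>; multiple arrows and loops are
  allowed. A path is a pair of its initial vertex and its list of arrows, so \<open>(v, [])\<close> is the
  vertex \<open>v\<close>.
\<close>

type_synonym ('v, 'e) qpath = "'v \<times> 'e list"

definition qpaths :: "('v, 'e) pre_digraph \<Rightarrow> ('v, 'e) qpath set" where
  "qpaths G = {(u, es). \<exists>v. pre_digraph.awalk G u es v}"

definition qtail :: "('v, 'e) qpath \<Rightarrow> 'v" where
  "qtail p = fst p"

definition qhead :: "('v, 'e) pre_digraph \<Rightarrow> ('v, 'e) qpath \<Rightarrow> 'v" where
  "qhead G p = pre_digraph.awlast G (fst p) (snd p)"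

definition arrow_path :: "('v, 'e) pre_digraph \<Rightarrow> 'e \<Rightarrow> ('v, 'e) qpath" where
  "arrow_path G e = (tail G e, [e])"

definition parallel :: "('v, 'e) pre_digraph \<Rightarrow> ('v, 'e) qpath \<Rightarrow> ('v, 'e) qpath \<Rightarrow> bool" where
  "parallel G p q \<longleftrightarrow> qtail p = qtail q \<and> qhead G p = qhead G q"

definition acyclic_quiver :: "('v, 'e) pre_digraph \<Rightarrow> bool" where
  "acyclic_quiver G \<longleftrightarrow> \<not> (\<exists>es. pre_digraph.cycle G es)"

text \<open>
  Elements are finitely supported coefficient functions on paths, and
  \<open>(x \<cdot> y)(r) = (\<Sum>pq = r. x(p) y(q))\<close>, a finite sum over the factorizations of \<open>r\<close>. The unit is the sum
  of the vertices (a genuine element only when there are finitely many of them).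
\<close>

definition path_algebra ::
  "('v, 'e) pre_digraph \<Rightarrow> ('k::field, ('v, 'e) qpath \<Rightarrow> 'k) module" where
  "path_algebra G =
     \<lparr>carrier = {x. finite {p. x p \<noteq> 0} \<and> {p. x p \<noteq> 0} \<subseteq> qpaths G},
      mult = (\<lambda>x y r. \<Sum>(p, q) \<in> {(p, q). p \<in> qpaths G \<and> q \<in> qpaths G \<and>
                                  qhead G p = qtail q \<and> (fst p, snd p @ snd q) = r}. x p * y q),
      one = (\<lambda>p. if qtail p \<in> verts G \<and> snd p = [] then 1 else 0),
      zero = (\<lambda>_. 0), add = (\<lambda>x y p. x p + y p), smult = (\<lambda>c x p. c * x p)\<rparr>"

definition path_vec :: "('v, 'e) qpath \<Rightarrow> ('v, 'e) qpath \<Rightarrow> 'k::field" where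
  "path_vec p = (\<lambda>q. if q = p then 1 else 0)"

text \<open>
  The derivation of the path algebra that kills the vertices and sends each arrow \<open>e\<close> to
  \<open>\<phi> e\<close>. It exists and is unique when every \<open>\<phi> e\<close> is a combination of paths parallel to \<open>e\<close>,
  which holds in the uses below.
\<close>

definition arrow_derivation ::
  "('v, 'e) pre_digraph \<Rightarrow> ('e \<Rightarrow> ('v, 'e) qpath \<Rightarrow> 'k::field)
    \<Rightarrow> (('v, 'e) qpath \<Rightarrow> 'k) \<Rightarrow> ('v, 'e) qpath \<Rightarrow> 'k" where
  "arrow_derivation G \<phi> =
     (THE D. D \<in> derivations (path_algebra G) \<and>
             (\<forall>v\<in>verts G. D (path_vec (v, [])) = (\<lambda>_. 0)) \<and>
             (\<forall>e\<in>arcs G. D (path_vec (arrow_path G e)) = \<phi> e))"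

definition D_rs ::
  "('v, 'e) pre_digraph \<Rightarrow> 'e \<Rightarrow> ('v, 'e) qpath
    \<Rightarrow> (('v, 'e) qpath \<Rightarrow> 'k::field) \<Rightarrow> ('v, 'e) qpath \<Rightarrow> 'k" where
  "D_rs G r s = arrow_derivation G (\<lambda>q. if q = r then path_vec s else (\<lambda>_. 0))"

definition almost_oriented_cycles :: "('v, 'e) pre_digraph \<Rightarrow> ('e \<times> ('v, 'e) qpath) set" where
  "almost_oriented_cycles G =
     {(p, r). p \<in> arcs G \<and> r \<in> qpaths G \<and> r \<noteq> arrow_path G p \<and> parallel G r (arrow_path G p)}"

definition D_AL ::
  "('v, 'e) pre_digraph \<Rightarrow> ((('v, 'e) qpath \<Rightarrow> 'k::field) \<Rightarrow> ('v, 'e) qpath \<Rightarrow> 'k) set" where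
  "D_AL G = linear_span (Der (path_algebra G)) {D_rs G p r | p r. (p, r) \<in> almost_oriented_cycles G}"


section \<open>Planar embeddings and face derivations\<close>

text \<open>
  Vertices are placed by \<open>pos\<close>; \<open>curve e\<close> runs from the tail of \<open>e\<close> to its head. Curves are
  only required to be continuous, and meet vertices and each other only at their end points.
\<close>

definition planar_embedding ::
  "('v, 'e) pre_digraph \<Rightarrow> ('v \<Rightarrow> complex) \<Rightarrow> ('e \<Rightarrow> real \<Rightarrow> complex) \<Rightarrow> bool" where
  "planar_embedding G pos curve \<longleftrightarrow>
     inj_on pos (verts G) \<and>
     (\<forall>e\<in>arcs G. simple_path (curve e) \<and>
        pathstart (curve e) = pos (tail G e) \<and> pathfinish (curve e) = pos (head G e) \<and>
        path_image (curve e) \<inter> pos ` verts G = {pos (tail G e), pos (head G e)}) \<and>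
     (\<forall>e\<in>arcs G. \<forall>e'\<in>arcs G. e \<noteq> e' \<longrightarrow>
        path_image (curve e) \<inter> path_image (curve e') \<subseteq> pos ` verts G)"

definition drawing ::
  "('v, 'e) pre_digraph \<Rightarrow> ('v \<Rightarrow> complex) \<Rightarrow> ('e \<Rightarrow> real \<Rightarrow> complex) \<Rightarrow> complex set" where
  "drawing G pos curve = pos ` verts G \<union> (\<Union>e\<in>arcs G. path_image (curve e))"

definition faces ::
  "('v, 'e) pre_digraph \<Rightarrow> ('v \<Rightarrow> complex) \<Rightarrow> ('e \<Rightarrow> real \<Rightarrow> complex) \<Rightarrow> complex set set" where
  "faces G pos curve = components (- drawing G pos curve)"

text \<open>
  Sides of a (merely continuous) path \<open>g\<close>. Crossing \<open>g\<close> from its right to its left raises the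
  winding number of \<open>g\<close> by 1; for instance, a counterclockwise circle has winding number 1
  around the points inside, which lie on its left, and 0 around those outside. For a path that is
  not closed the winding number \<^const>\<open>winding_number\<close> is complex and varies continuously off the
  path, but the jump across an interior point \<open>g t\<close> is still 1 in the limit. So \<open>f\<close> lies on the
  right of \<open>g\<close> if, arbitrarily close to some interior point \<open>g t\<close>, there are points \<open>z\<close> in \<open>f\<close>
  and \<open>w\<close> such that passing from \<open>z\<close> to \<open>w\<close> raises the winding number by 1 up to an arbitrarily
  small error.
\<close>

definition lies_right_of :: "complex set \<Rightarrow> (real \<Rightarrow> complex) \<Rightarrow> bool" where
  "lies_right_of f g \<longleftrightarrow>
     (\<exists>t\<in>{0<..<1}. \<forall>\<epsilon>>0. \<exists>z\<in>f - path_image g. \<exists>w\<in>- path_image g.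
        dist z (g t) < \<epsilon> \<and> dist w (g t) < \<epsilon> \<and>
        cmod (winding_number g w - winding_number g z - 1) < \<epsilon>)"

definition lies_left_of :: "complex set \<Rightarrow> (real \<Rightarrow> complex) \<Rightarrow> bool" where
  "lies_left_of f g \<longleftrightarrow> lies_right_of f (reversepath g)"

text \<open>
  An arrow with \<open>f\<close> on its right is clockwise on the boundary of \<open>f\<close>, one with \<open>f\<close> on its left
  is counterclockwise. If both sides lie in \<open>f\<close> the contributions cancel.
\<close>

definition face_coeff :: "('e \<Rightarrow> real \<Rightarrow> complex) \<Rightarrow> complex set \<Rightarrow> 'e \<Rightarrow> 'k::field" where
  "face_coeff curve f p = of_bool (lies_right_of f (curve p)) - of_bool (lies_left_of f (curve p))"

text \<open>
  Face derivations are indexed by the face rather than by its boundary as a point set: the two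
  faces of a polygon share the latter but induce opposite orientations of it.
\<close>

definition face_derivation ::
  "('v, 'e) pre_digraph \<Rightarrow> ('e \<Rightarrow> real \<Rightarrow> complex) \<Rightarrow> complex set
    \<Rightarrow> (('v, 'e) qpath \<Rightarrow> 'k::field) \<Rightarrow> ('v, 'e) qpath \<Rightarrow> 'k" where
  "face_derivation G curve f =
     arrow_derivation G (\<lambda>p q. face_coeff curve f p * path_vec (arrow_path G p) q)"

definition D_F ::
  "('v, 'e) pre_digraph \<Rightarrow> ('v \<Rightarrow> complex) \<Rightarrow> ('e \<Rightarrow> real \<Rightarrow> complex)
    \<Rightarrow> ((('v, 'e) qpath \<Rightarrow> 'k::field) \<Rightarrow> ('v, 'e) qpath \<Rightarrow> 'k) set" where
  "D_F G pos curve =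
     linear_span (Der (path_algebra G)) (face_derivation G curve ` faces G pos curve)"

end

theory Submission
  imports Defs "HOL-Library.Function_Algebras"
begin

text \<open>
  Every derivation of the path algebra is, up to an inner one, determined by its values on the arrows, where
  it sends an arrow \<open>e\<close> to a combination of paths parallel to \<open>e\<close>. The part without the term \<open>e\<close> itself lies
  in \<open>D_AL\<close>, which leaves diagonal derivations, that is, vectors in \<open>k\<^sup>E\<close>. By acyclicity the inner ones
  among these are exactly the cuts (coboundaries of functions on the vertices), so one has to show that the span
  of the face vectors is a complement of the cut space in \<open>k\<^sup>E\<close>.

  For an integral cycle \<open>z\<close> the function \<open>x \<mapsto> \<Sum>e. z e * winding_number (curve e) x\<close> is integral and constant
  on the faces, and it jumps by \<open>z e\<close> across \<open>e\<close>; hence \<open>z\<close> is a combination of face vectors. Conversely, face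
  vectors are cycles. This follows by induction on the arrows: an arrow with different faces on its two sides
  lies on a cycle by Janiszewski's theorem, and subtracting a multiple of that cycle makes the values on the
  two sides agree, so that the arrow can be deleted. Finally cuts and cycles are orthogonal complements over
  the rationals.
\<close>

section \<open>Quotients of Lie algebras\<close>

text \<open>The field \<open>'k\<close> has characteristic 0 but need not be ordered, so a nonzero
  vector may be orthogonal to itself and cuts and cycles over \<open>'k\<close> cannot be separated
  by positivity. Hence the detour in the coefficients: unit vectors are projected to the cuts over
  \<open>rat\<close>, the remainder is scaled to an \<open>int\<close> cycle, because integrality is
  what makes the values of the winding function discrete, and the result is carried to
  \<open>'k\<close> by \<open>of_rat\<close>. Uniqueness over \<open>'k\<close> then rests on the
  nondegenerate standard pairing.

  The geometric obstacle is that the curves are merely continuous: an arrow has no normal vector,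
  and its sides are visible only through the jump of a complex-valued winding number.
  \<open>side_chart\<close> records this local picture at one interior point of a curve, and the
  faces found there must be shown to be the same for all points.

  Both subspaces are first described without spans, as \<open>AL_der\<close> and
  \<open>F_der\<close>, among the derivations that kill the vertices; the computations take place
  there, and only then are classes formed.\<close>

lemma ring_of_type_algebra_simps [simp]:
  "carrier (ring_of_type_algebra :: 'k::field ring) = UNIV"
  "x \<oplus>\<^bsub>(ring_of_type_algebra :: 'k ring)\<^esub> y = x + y"
  "x \<otimes>\<^bsub>(ring_of_type_algebra :: 'k ring)\<^esub> y = x * y"
  "\<one>\<^bsub>(ring_of_type_algebra :: 'k ring)\<^esub> = 1"
  "\<zero>\<^bsub>(ring_of_type_algebra :: 'k ring)\<^esub> = 0"
  by (simp_all add: ring_of_type_algebra_def)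

lemma ring_of_type_algebra_minus [simp]:
  "\<ominus>\<^bsub>(ring_of_type_algebra :: 'k::field ring)\<^esub> x = - x"
proof -
  interpret cring "ring_of_type_algebra :: 'k ring" by (rule cring_from_type_algebra)
  show ?thesis by (rule minus_equality) simp_all
qed

text \<open>The closure under negation that \<open>submodule\<close> demands is closure under the
  scalar \<open>- 1\<close>.\<close>

lemma linear_subspaceI:
  fixes L :: "('k::field, 'x) module"
  assumes "module (ring_of_type_algebra :: 'k ring) L"
    and "W \<subseteq> carrier L" "\<zero>\<^bsub>L\<^esub> \<in> W"
    and add: "\<And>x y. x \<in> W \<Longrightarrow> y \<in> W \<Longrightarrow> x \<oplus>\<^bsub>L\<^esub> y \<in> W"
    and smult: "\<And>(c::'k) x. x \<in> W \<Longrightarrow> c \<odot>\<^bsub>L\<^esub> x \<in> W"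
  shows "linear_subspace L W"
proof -
  interpret module "ring_of_type_algebra :: 'k ring" L by fact
  show ?thesis unfolding linear_subspace_def
  proof (rule submoduleI)
    fix x assume x: "x \<in> W"
    then have "(- 1) \<odot>\<^bsub>L\<^esub> x = \<ominus>\<^bsub>L\<^esub> x"
      using smult_l_minus[of 1 x] smult_one[of x] assms(2) by auto
    then show "\<ominus>\<^bsub>L\<^esub> x \<in> W" using smult[OF x, of "- 1"] by simp
  qed (use assms in auto)
qed

lemma linear_subspaceD:
  fixes L :: "('k::field, 'x) module"
  assumes "linear_subspace L W"
  shows linear_subspace_subset: "W \<subseteq> carrier L"
    and linear_subspace_zero: "\<zero>\<^bsub>L\<^esub> \<in> W"
    and linear_subspace_add: "x \<in> W \<Longrightarrow> y \<in> W \<Longrightarrow> x \<oplus>\<^bsub>L\<^esub> y \<in> W"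
    and linear_subspace_smult: "x \<in> W \<Longrightarrow> (c::'k) \<odot>\<^bsub>L\<^esub> x \<in> W"
proof -
  interpret submodule W "ring_of_type_algebra :: 'k ring" L
    using assms by (simp add: linear_subspace_def)
  show "W \<subseteq> carrier L" "\<zero>\<^bsub>L\<^esub> \<in> W" using subset one_closed by auto
  show "x \<in> W \<Longrightarrow> y \<in> W \<Longrightarrow> x \<oplus>\<^bsub>L\<^esub> y \<in> W" using m_closed by auto
  show "x \<in> W \<Longrightarrow> (c::'k) \<odot>\<^bsub>L\<^esub> x \<in> W" using smult_closed by auto
qed

lemma linear_span_minimal: "linear_subspace L W \<Longrightarrow> B \<subseteq> W \<Longrightarrow> linear_span L B \<subseteq> W"
  by (auto simp: linear_span_def)

locale lie_ideal_quotient = lie_algebra L for L :: "('k::field, 'x) module" (structure) +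
  fixes I
  assumes ideal: "lie_ideal L I"
begin

abbreviation "Q \<equiv> lie_quotient L I"
abbreviation "cls x \<equiv> I +>\<^bsub>L\<^esub> x"

lemma subspace: "linear_subspace L I"
  using ideal by (simp add: lie_ideal_def)

lemma abelian_subgroup: "abelian_subgroup I L"
  using subspace
  by (intro abelian_subgroupI3)
    (auto simp: linear_subspace_def submodule_def additive_subgroup_def intro: abelian_group_axioms)

lemma cls_eq_iff:
  assumes "x \<in> carrier L" "y \<in> carrier L"
  shows "cls x = cls y \<longleftrightarrow> x \<ominus>\<^bsub>L\<^esub> y \<in> I"
proof -
  interpret S: abelian_subgroup I L by (rule abelian_subgroup)
  show ?thesis
    using assms S.a_rcos_module[of y x] S.a_rcos_self[of x] S.a_repr_independence'[of x y]
    by (auto simp: a_minus_def)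
qed

lemma cls_I: "x \<in> I \<Longrightarrow> cls x = I"
proof -
  interpret S: abelian_subgroup I L by (rule abelian_subgroup)
  show "x \<in> I \<Longrightarrow> cls x = I" using S.a_rcos_const by simp
qed

lemma mem_cls:
  assumes "x \<in> carrier L" "a \<in> cls x"
  shows "a \<in> carrier L" "cls a = cls x"
proof -
  interpret S: abelian_subgroup I L by (rule abelian_subgroup)
  show "a \<in> carrier L" using assms M.a_r_coset_subset_G[of I x] S.a_subset by auto
  show "cls a = cls x" using S.a_repr_independence'[of a x] assms by simp
qed

lemma cls_self: "x \<in> carrier L \<Longrightarrow> x \<in> cls x"
  by (rule abelian_subgroup.a_rcos_self[OF abelian_subgroup])

lemma ideal_left: "x \<in> carrier L \<Longrightarrow> y \<in> I \<Longrightarrow> x \<otimes>\<^bsub>L\<^esub> y \<in> I"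
  using ideal by (simp add: lie_ideal_def)

text \<open>Polarization: expand the bracket of \<open>x \<oplus> y\<close> with itself. The sign is
  written as a scalar so that closure of a linear subspace applies directly.\<close>

lemma bracket_anticommute:
  assumes "x \<in> carrier L" "y \<in> carrier L"
  shows "y \<otimes>\<^bsub>L\<^esub> x = (- 1) \<odot>\<^bsub>L\<^esub> (x \<otimes>\<^bsub>L\<^esub> y)"
proof -
  have cl: "x \<otimes>\<^bsub>L\<^esub> y \<in> carrier L" "y \<otimes>\<^bsub>L\<^esub> x \<in> carrier L" "x \<otimes>\<^bsub>L\<^esub> x \<in> carrier L" "y \<otimes>\<^bsub>L\<^esub> y \<in> carrier L"
    using assms by (auto intro: bracket_closed)
  have "\<zero>\<^bsub>L\<^esub> = (x \<oplus>\<^bsub>L\<^esub> y) \<otimes>\<^bsub>L\<^esub> (x \<oplus>\<^bsub>L\<^esub> y)" using assms by (simp add: bracket_alternating)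
  also have "\<dots> = (x \<otimes>\<^bsub>L\<^esub> x \<oplus>\<^bsub>L\<^esub> y \<otimes>\<^bsub>L\<^esub> x) \<oplus>\<^bsub>L\<^esub> (x \<otimes>\<^bsub>L\<^esub> y \<oplus>\<^bsub>L\<^esub> y \<otimes>\<^bsub>L\<^esub> y)"
    using assms by (simp add: bracket_add_left bracket_add_right)
  also have "\<dots> = y \<otimes>\<^bsub>L\<^esub> x \<oplus>\<^bsub>L\<^esub> x \<otimes>\<^bsub>L\<^esub> y"
    using assms cl by (simp add: bracket_alternating)
  finally have "y \<otimes>\<^bsub>L\<^esub> x = \<ominus>\<^bsub>L\<^esub> (x \<otimes>\<^bsub>L\<^esub> y)" using cl by (metis M.minus_equality)
  then show ?thesis using smult_l_minus[of 1 "x \<otimes>\<^bsub>L\<^esub> y"] smult_one[of "x \<otimes>\<^bsub>L\<^esub> y"] cl by simp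
qed

lemma ideal_right:
  assumes "x \<in> I" "y \<in> carrier L"
  shows "x \<otimes>\<^bsub>L\<^esub> y \<in> I"
  using bracket_anticommute[of y x] ideal_left[of y x] assms subspace
  by (metis linear_subspace_smult linear_subspace_subset subsetD)

lemma cls_add_I:
  assumes "x \<in> carrier L" "i \<in> I"
  shows "cls (i \<oplus>\<^bsub>L\<^esub> x) = cls x"
proof -
  interpret S: abelian_subgroup I L by (rule abelian_subgroup)
  have "i \<oplus>\<^bsub>L\<^esub> x \<in> cls x" using assms(2) by (auto simp: a_r_coset_def')
  then show ?thesis by (rule mem_cls(2)[OF assms(1)])
qed

lemma cls_E:
  assumes "a \<in> cls x" obtains i where "i \<in> I" "a = i \<oplus>\<^bsub>L\<^esub> x"
  using assms by (auto simp: a_r_coset_def')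

lemma I_carrier: "i \<in> I \<Longrightarrow> i \<in> carrier L"
  using linear_subspace_subset[OF subspace] by auto

lemma carrier_Q: "carrier Q = cls ` carrier L"
  by (auto simp: lie_quotient_def A_RCOSETS_def')

lemma zero_Q: "\<zero>\<^bsub>Q\<^esub> = cls \<zero>\<^bsub>L\<^esub>"
  using cls_I[OF linear_subspace_zero[OF subspace]] by (simp add: lie_quotient_def)

lemma add_Q: "x \<in> carrier L \<Longrightarrow> y \<in> carrier L \<Longrightarrow> cls x \<oplus>\<^bsub>Q\<^esub> cls y = cls (x \<oplus>\<^bsub>L\<^esub> y)"
  using abelian_subgroup.a_rcos_sum[OF abelian_subgroup] by (simp add: lie_quotient_def)

text \<open>\<open>lie_quotient\<close> forms the union over all representatives. Representatives
  differ by elements of \<open>I\<close>, so all cosets in the union coincide and the union is a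
  single coset.\<close>

lemma smult_Q:
  assumes x: "x \<in> carrier L"
  shows "c \<odot>\<^bsub>Q\<^esub> cls x = cls (c \<odot>\<^bsub>L\<^esub> x)"
proof -
  have const: "cls (c \<odot>\<^bsub>L\<^esub> a) = cls (c \<odot>\<^bsub>L\<^esub> x)" if "a \<in> cls x" for a
  proof -
    obtain i where i: "i \<in> I" "a = i \<oplus>\<^bsub>L\<^esub> x" using \<open>a \<in> cls x\<close> by (rule cls_E)
    have "c \<odot>\<^bsub>L\<^esub> a = (c \<odot>\<^bsub>L\<^esub> i) \<oplus>\<^bsub>L\<^esub> (c \<odot>\<^bsub>L\<^esub> x)"
      unfolding i(2) using x I_carrier[OF i(1)] by (simp add: smult_r_distr)
    moreover have "c \<odot>\<^bsub>L\<^esub> i \<in> I" by (rule linear_subspace_smult[OF subspace i(1)])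
    moreover have "c \<odot>\<^bsub>L\<^esub> x \<in> carrier L" using x by simp
    ultimately show ?thesis by (simp only: cls_add_I)
  qed
  have "c \<odot>\<^bsub>Q\<^esub> cls x = (\<Union>a\<in>cls x. cls (c \<odot>\<^bsub>L\<^esub> a))" by (simp add: lie_quotient_def)
  also have "\<dots> = cls (c \<odot>\<^bsub>L\<^esub> x)" by (rule UN_constant_eq[OF cls_self[OF x]]) (intro ballI const)
  finally show ?thesis .
qed

text \<open>As for scalars, all cosets in the union defining \<open>rcoset_mult\<close> coincide.
  Changing the left representative needs \<open>ideal_right\<close>, changing the right one
  \<open>ideal_left\<close>.\<close>

lemma bracket_Q:
  assumes x: "x \<in> carrier L" and y: "y \<in> carrier L"
  shows "cls x \<otimes>\<^bsub>Q\<^esub> cls y = cls (x \<otimes>\<^bsub>L\<^esub> y)"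
proof -
  have const: "cls (a \<otimes>\<^bsub>L\<^esub> b) = cls (x \<otimes>\<^bsub>L\<^esub> y)" if "a \<in> cls x" "b \<in> cls y" for a b
  proof -
    obtain i where i: "i \<in> I" "a = i \<oplus>\<^bsub>L\<^esub> x" using \<open>a \<in> cls x\<close> by (rule cls_E)
    obtain j where j: "j \<in> I" "b = j \<oplus>\<^bsub>L\<^esub> y" using \<open>b \<in> cls y\<close> by (rule cls_E)
    have c: "i \<in> carrier L" "j \<in> carrier L" "b \<in> carrier L"
      using i j y I_carrier by auto
    have "a \<otimes>\<^bsub>L\<^esub> b = (i \<otimes>\<^bsub>L\<^esub> b) \<oplus>\<^bsub>L\<^esub> ((x \<otimes>\<^bsub>L\<^esub> j) \<oplus>\<^bsub>L\<^esub> (x \<otimes>\<^bsub>L\<^esub> y))"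
      unfolding i(2) using c x y by (simp add: bracket_add_left) (simp add: j(2) bracket_add_right)
    moreover have "i \<otimes>\<^bsub>L\<^esub> b \<in> I" "x \<otimes>\<^bsub>L\<^esub> j \<in> I"
      using i j c x by (auto intro: ideal_left ideal_right)
    moreover have "x \<otimes>\<^bsub>L\<^esub> y \<in> carrier L" "x \<otimes>\<^bsub>L\<^esub> j \<oplus>\<^bsub>L\<^esub> x \<otimes>\<^bsub>L\<^esub> y \<in> carrier L"
      using x y c by (simp_all add: bracket_closed)
    ultimately show ?thesis by (simp only: cls_add_I)
  qed
  have "cls x \<otimes>\<^bsub>Q\<^esub> cls y = (\<Union>a\<in>cls x. \<Union>b\<in>cls y. cls (a \<otimes>\<^bsub>L\<^esub> b))"
    by (simp add: lie_quotient_def rcoset_mult_def)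
  also have "\<dots> = cls (x \<otimes>\<^bsub>L\<^esub> y)"
    by (intro UN_constant_eq[OF cls_self[OF x]] UN_constant_eq[OF cls_self[OF y]] ballI const)
  finally show ?thesis .
qed

lemma lie_algebra_Q: "lie_algebra Q"
proof -
  have ag: "abelian_group Q"
  proof (rule abelian_groupI)
    fix S assume "S \<in> carrier Q"
    then obtain x where x: "x \<in> carrier L" "S = cls x" by (auto simp: carrier_Q)
    then show "\<exists>T\<in>carrier Q. T \<oplus>\<^bsub>Q\<^esub> S = \<zero>\<^bsub>Q\<^esub>"
      by (intro bexI[of _ "cls (\<ominus>\<^bsub>L\<^esub> x)"]) (auto simp: add_Q zero_Q M.l_neg carrier_Q)
  qed (auto simp: carrier_Q add_Q zero_Q M.a_ac)
  show ?thesis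
  proof (intro lie_algebra.intro module.intro ag lie_algebra_axioms.intro module_axioms.intro)
    show "cring (ring_of_type_algebra :: 'k ring)" by (rule cring_from_type_algebra)
  qed (auto simp: carrier_Q add_Q zero_Q smult_Q bracket_Q bracket_closed bracket_add_left bracket_add_right
        bracket_smult_left bracket_smult_right bracket_alternating jacobi smult_r_distr
        smult_l_distr[simplified] smult_assoc1[simplified] smult_one[simplified])
qed

lemma module_Q: "module (ring_of_type_algebra :: 'k ring) Q"
  by (rule lie_algebra.axioms(1)[OF lie_algebra_Q])

lemma linear_subspace_image:
  assumes W: "linear_subspace L W"
  shows "linear_subspace Q (cls ` W)"
proof (rule linear_subspaceI[OF module_Q])
  note sub = linear_subspace_subset[OF W]
  show "cls ` W \<subseteq> carrier Q" using sub by (auto simp: carrier_Q)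
  show "\<zero>\<^bsub>Q\<^esub> \<in> cls ` W" using linear_subspace_zero[OF W] by (auto simp: zero_Q)
  show "S \<oplus>\<^bsub>Q\<^esub> T \<in> cls ` W" if "S \<in> cls ` W" "T \<in> cls ` W" for S T
    using that sub linear_subspace_add[OF W] by (auto simp: add_Q subset_iff)
  show "c \<odot>\<^bsub>Q\<^esub> S \<in> cls ` W" if "S \<in> cls ` W" for c S
    using that sub linear_subspace_smult[OF W] by (auto simp: smult_Q subset_iff)
qed

end

section \<open>Derivations of associative algebras\<close>

text \<open>Addition and zero of the record are those of a type class. Identities between
  derivations thus become identities in an abelian group type, which the simplifier handles without
  carrier side conditions for the additive laws.\<close>

locale additive_algebra =
  fixes A :: "('k::field, 'x::ab_group_add) module"
  assumes add_eq: "add A = (+)" and zero_eq: "zero A = 0"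
    and zero_closed: "0 \<in> carrier A"
    and add_closed: "x \<in> carrier A \<Longrightarrow> y \<in> carrier A \<Longrightarrow> x + y \<in> carrier A"
    and smult_closed: "x \<in> carrier A \<Longrightarrow> c \<odot>\<^bsub>A\<^esub> x \<in> carrier A"
    and mult_closed: "x \<in> carrier A \<Longrightarrow> y \<in> carrier A \<Longrightarrow> x \<otimes>\<^bsub>A\<^esub> y \<in> carrier A"
    and smult_add_right: "x \<in> carrier A \<Longrightarrow> y \<in> carrier A \<Longrightarrow> c \<odot>\<^bsub>A\<^esub> (x + y) = c \<odot>\<^bsub>A\<^esub> x + c \<odot>\<^bsub>A\<^esub> y"
    and smult_add_left: "x \<in> carrier A \<Longrightarrow> (c + d) \<odot>\<^bsub>A\<^esub> x = c \<odot>\<^bsub>A\<^esub> x + d \<odot>\<^bsub>A\<^esub> x"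
    and smult_assoc: "x \<in> carrier A \<Longrightarrow> (c * d) \<odot>\<^bsub>A\<^esub> x = c \<odot>\<^bsub>A\<^esub> (d \<odot>\<^bsub>A\<^esub> x)"
    and smult_one: "x \<in> carrier A \<Longrightarrow> 1 \<odot>\<^bsub>A\<^esub> x = x"
    and mult_add_left: "x \<in> carrier A \<Longrightarrow> y \<in> carrier A \<Longrightarrow> z \<in> carrier A \<Longrightarrow>
      (x + y) \<otimes>\<^bsub>A\<^esub> z = x \<otimes>\<^bsub>A\<^esub> z + y \<otimes>\<^bsub>A\<^esub> z"
    and mult_add_right: "x \<in> carrier A \<Longrightarrow> y \<in> carrier A \<Longrightarrow> z \<in> carrier A \<Longrightarrow>
      x \<otimes>\<^bsub>A\<^esub> (y + z) = x \<otimes>\<^bsub>A\<^esub> y + x \<otimes>\<^bsub>A\<^esub> z"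
    and mult_smult_left: "x \<in> carrier A \<Longrightarrow> y \<in> carrier A \<Longrightarrow> (c \<odot>\<^bsub>A\<^esub> x) \<otimes>\<^bsub>A\<^esub> y = c \<odot>\<^bsub>A\<^esub> (x \<otimes>\<^bsub>A\<^esub> y)"
    and mult_smult_right: "x \<in> carrier A \<Longrightarrow> y \<in> carrier A \<Longrightarrow> x \<otimes>\<^bsub>A\<^esub> (c \<odot>\<^bsub>A\<^esub> y) = c \<odot>\<^bsub>A\<^esub> (x \<otimes>\<^bsub>A\<^esub> y)"
    and mult_assoc: "x \<in> carrier A \<Longrightarrow> y \<in> carrier A \<Longrightarrow> z \<in> carrier A \<Longrightarrow>
      (x \<otimes>\<^bsub>A\<^esub> y) \<otimes>\<^bsub>A\<^esub> z = x \<otimes>\<^bsub>A\<^esub> (y \<otimes>\<^bsub>A\<^esub> z)"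
begin

abbreviation mult_A (infixl "\<star>" 70) where "x \<star> y \<equiv> x \<otimes>\<^bsub>A\<^esub> y"
abbreviation smult_A (infixr "\<cdot>" 75) where "c \<cdot> x \<equiv> c \<odot>\<^bsub>A\<^esub> x"

lemma smult_zero_left: "x \<in> carrier A \<Longrightarrow> 0 \<cdot> x = 0"
  using smult_add_left[of x 0 0] by simp

lemma smult_minus_one: "x \<in> carrier A \<Longrightarrow> (- 1) \<cdot> x = - x"
  using smult_add_left[of x "- 1" 1] smult_zero_left[of x] smult_one[of x]
  by (simp add: add_eq_0_iff2)

lemma uminus_closed: "x \<in> carrier A \<Longrightarrow> - x \<in> carrier A"
  using smult_closed[of x "- 1"] smult_minus_one[of x] by simp

lemma diff_closed: "x \<in> carrier A \<Longrightarrow> y \<in> carrier A \<Longrightarrow> x - y \<in> carrier A"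
  using add_closed[of x "- y"] uminus_closed[of y] by simp

lemmas closed = zero_closed add_closed smult_closed mult_closed uminus_closed diff_closed

lemma a_minus_eq:
  assumes "x \<in> carrier A" "y \<in> carrier A"
  shows "x \<ominus>\<^bsub>A\<^esub> y = x - y"
proof -
  have "abelian_group A"
    by (rule abelian_groupI)
      (auto simp: add_eq zero_eq add_ac intro: closed bexI[of _ "- _"])
  then interpret abelian_group A .
  have "\<ominus>\<^bsub>A\<^esub> y = - y" using assms uminus_closed
    by (intro minus_equality) (auto simp: add_eq zero_eq)
  then show ?thesis by (simp add: a_minus_def add_eq)
qed

lemma smult_zero_right: "c \<cdot> 0 = 0"
  using smult_add_right[of 0 0 c] zero_closed by simp

lemma smult_minus:
  assumes "x \<in> carrier A"
  shows "c \<cdot> (- x) = - (c \<cdot> x)"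
proof -
  have "c \<cdot> x + c \<cdot> (- x) = 0"
    using smult_add_right[of x "- x" c] assms uminus_closed[of x] by (simp add: smult_zero_right)
  then show ?thesis by (rule minus_unique[symmetric])
qed

lemma smult_diff: "x \<in> carrier A \<Longrightarrow> y \<in> carrier A \<Longrightarrow> c \<cdot> (x - y) = c \<cdot> x - c \<cdot> y"
  using smult_add_right[of x "- y" c] smult_minus[of y c] uminus_closed[of y] by simp

lemma mult_diff_left: "x \<in> carrier A \<Longrightarrow> y \<in> carrier A \<Longrightarrow> z \<in> carrier A \<Longrightarrow> (x - y) \<star> z = x \<star> z - y \<star> z"
  using mult_add_left[of "x - y" y z] by (simp add: closed eq_diff_eq)

lemma mult_diff_right: "x \<in> carrier A \<Longrightarrow> y \<in> carrier A \<Longrightarrow> z \<in> carrier A \<Longrightarrow> x \<star> (y - z) = x \<star> y - x \<star> z"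
  using mult_add_right[of x "y - z" z] by (simp add: closed eq_diff_eq)

lemma mult_zero_left: "x \<in> carrier A \<Longrightarrow> 0 \<star> x = 0"
  using mult_add_left[of 0 0 x] zero_closed by simp

lemma mult_zero_right: "x \<in> carrier A \<Longrightarrow> x \<star> 0 = 0"
  using mult_add_right[of x 0 0] zero_closed by simp

lemma Der_simps:
  "carrier (Der A) = derivations A"
  "D \<oplus>\<^bsub>Der A\<^esub> E = (\<lambda>x\<in>carrier A. D x + E x)"
  "\<zero>\<^bsub>Der A\<^esub> = (\<lambda>x\<in>carrier A. 0)"
  "c \<odot>\<^bsub>Der A\<^esub> D = (\<lambda>x\<in>carrier A. c \<cdot> D x)"
  by (simp_all add: Der_def add_eq zero_eq)

lemma derivationI:
  assumes "D \<in> extensional (carrier A)"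
    and "\<And>x. x \<in> carrier A \<Longrightarrow> D x \<in> carrier A"
    and "\<And>x y. x \<in> carrier A \<Longrightarrow> y \<in> carrier A \<Longrightarrow> D (x + y) = D x + D y"
    and "\<And>c x. x \<in> carrier A \<Longrightarrow> D (c \<cdot> x) = c \<cdot> D x"
    and "\<And>x y. x \<in> carrier A \<Longrightarrow> y \<in> carrier A \<Longrightarrow> D (x \<star> y) = D x \<star> y + x \<star> D y"
  shows "D \<in> derivations A"
  using assms by (auto simp: derivations_def add_eq PiE_def)

lemma derivationD:
  assumes "D \<in> derivations A"
  shows der_closed: "x \<in> carrier A \<Longrightarrow> D x \<in> carrier A"
    and der_add: "x \<in> carrier A \<Longrightarrow> y \<in> carrier A \<Longrightarrow> D (x + y) = D x + D y"
    and der_smult: "x \<in> carrier A \<Longrightarrow> D (c \<cdot> x) = c \<cdot> D x"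
    and der_mult: "x \<in> carrier A \<Longrightarrow> y \<in> carrier A \<Longrightarrow> D (x \<star> y) = D x \<star> y + x \<star> D y"
    and der_ext: "x \<notin> carrier A \<Longrightarrow> D x = undefined"
  using assms by (auto simp: derivations_def add_eq PiE_def extensional_def)

lemma der_zero: "D \<in> derivations A \<Longrightarrow> D 0 = 0"
  using der_add[of D 0 0] zero_closed by simp

lemma der_diff: "D \<in> derivations A \<Longrightarrow> x \<in> carrier A \<Longrightarrow> y \<in> carrier A \<Longrightarrow> D (x - y) = D x - D y"
  using der_add[of D "x - y" y] by (simp add: closed eq_diff_eq)

lemma derivation_eqI:
  assumes "D \<in> derivations A" "E \<in> derivations A" "\<And>x. x \<in> carrier A \<Longrightarrow> D x = E x"
  shows "D = E"
  using assms der_ext by (intro ext) metis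

lemma Der_bracket:
  assumes "D \<in> derivations A" "E \<in> derivations A"
  shows "D \<otimes>\<^bsub>Der A\<^esub> E = (\<lambda>x\<in>carrier A. D (E x) - E (D x))"
  using assms by (auto simp: Der_def a_minus_eq der_closed intro!: restrict_ext)

lemma Der_closed:
  shows Der_zero_closed: "(\<lambda>x\<in>carrier A. 0) \<in> derivations A"
    and Der_add_closed: "D \<in> derivations A \<Longrightarrow> E \<in> derivations A \<Longrightarrow> (\<lambda>x\<in>carrier A. D x + E x) \<in> derivations A"
    and Der_smult_closed: "D \<in> derivations A \<Longrightarrow> (\<lambda>x\<in>carrier A. c \<cdot> D x) \<in> derivations A"
    and Der_bracket_closed: "D \<in> derivations A \<Longrightarrow> E \<in> derivations A \<Longrightarrow>
      (\<lambda>x\<in>carrier A. D (E x) - E (D x)) \<in> derivations A"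
proof -
  have comm: "c \<cdot> (d \<cdot> x) = d \<cdot> (c \<cdot> x)" if "x \<in> carrier A" for c d x
    using that by (simp add: smult_assoc[symmetric] mult.commute)
  show "(\<lambda>x\<in>carrier A. 0) \<in> derivations A"
    by (intro derivationI) (simp_all add: closed mult_zero_left mult_zero_right smult_zero_right)
  show "D \<in> derivations A \<Longrightarrow> E \<in> derivations A \<Longrightarrow> (\<lambda>x\<in>carrier A. D x + E x) \<in> derivations A"
    by (intro derivationI) (simp_all add: closed der_closed der_add der_smult der_mult smult_add_right
        mult_add_left mult_add_right add_ac)
  show "D \<in> derivations A \<Longrightarrow> (\<lambda>x\<in>carrier A. c \<cdot> D x) \<in> derivations A"
    by (intro derivationI) (simp_all add: closed der_closed der_add der_smult der_mult smult_add_right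
        mult_smult_left mult_smult_right comm)
  show "D \<in> derivations A \<Longrightarrow> E \<in> derivations A \<Longrightarrow> (\<lambda>x\<in>carrier A. D (E x) - E (D x)) \<in> derivations A"
    by (intro derivationI) (simp_all add: closed der_closed der_add der_smult der_mult smult_diff
        mult_diff_left mult_diff_right)
qed

lemma abelian_group_Der: "abelian_group (Der A)"
proof (rule abelian_groupI)
  fix D assume D: "D \<in> carrier (Der A)"
  then have "(\<lambda>x\<in>carrier A. (- 1) \<cdot> D x) \<in> carrier (Der A)" by (simp add: Der_simps Der_smult_closed)
  moreover have "(\<lambda>x\<in>carrier A. (- 1) \<cdot> D x) \<oplus>\<^bsub>Der A\<^esub> D = \<zero>\<^bsub>Der A\<^esub>"
    using D by (auto simp: Der_simps smult_minus_one der_closed intro!: restrict_ext)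
  ultimately show "\<exists>E\<in>carrier (Der A). E \<oplus>\<^bsub>Der A\<^esub> D = \<zero>\<^bsub>Der A\<^esub>" by blast
  show "\<zero>\<^bsub>Der A\<^esub> \<oplus>\<^bsub>Der A\<^esub> D = D"
    using D by (intro ext) (auto simp: Der_simps der_ext)
qed (auto simp: Der_simps Der_closed add_ac intro!: restrict_ext)

lemma lie_algebra_Der: "lie_algebra (Der A)"
proof (intro lie_algebra.intro module.intro abelian_group_Der lie_algebra_axioms.intro module_axioms.intro)
  show "cring (ring_of_type_algebra :: 'k ring)" by (rule cring_from_type_algebra)
  fix D E F assume "D \<in> carrier (Der A)" "E \<in> carrier (Der A)" "F \<in> carrier (Der A)"
  then have *: "D \<in> derivations A" "E \<in> derivations A" "F \<in> derivations A" by (simp_all add: Der_simps)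
  note cl = Der_bracket_closed[OF *(1,2)] Der_bracket_closed[OF *(1,3)] Der_bracket_closed[OF *(2,3)]
    Der_bracket_closed[OF *(2,1)] Der_bracket_closed[OF *(3,1)] Der_bracket_closed[OF *(3,2)]
    Der_add_closed[OF *(1,2)] Der_add_closed[OF *(2,3)]
  show "(D \<oplus>\<^bsub>Der A\<^esub> E) \<otimes>\<^bsub>Der A\<^esub> F = (D \<otimes>\<^bsub>Der A\<^esub> F) \<oplus>\<^bsub>Der A\<^esub> (E \<otimes>\<^bsub>Der A\<^esub> F)"
    by (auto simp: Der_simps(2) Der_bracket * cl der_closed der_add intro!: restrict_ext)
  show "D \<otimes>\<^bsub>Der A\<^esub> (E \<oplus>\<^bsub>Der A\<^esub> F) = (D \<otimes>\<^bsub>Der A\<^esub> E) \<oplus>\<^bsub>Der A\<^esub> (D \<otimes>\<^bsub>Der A\<^esub> F)"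
    by (auto simp: Der_simps(2) Der_bracket * cl der_closed der_add intro!: restrict_ext)
  show "(D \<otimes>\<^bsub>Der A\<^esub> (E \<otimes>\<^bsub>Der A\<^esub> F)) \<oplus>\<^bsub>Der A\<^esub> (E \<otimes>\<^bsub>Der A\<^esub> (F \<otimes>\<^bsub>Der A\<^esub> D))
      \<oplus>\<^bsub>Der A\<^esub> (F \<otimes>\<^bsub>Der A\<^esub> (D \<otimes>\<^bsub>Der A\<^esub> E)) = \<zero>\<^bsub>Der A\<^esub>"
    by (auto simp: Der_simps(2,3) Der_bracket * cl der_closed der_diff intro!: restrict_ext)
next
  fix c D E assume "D \<in> carrier (Der A)" "E \<in> carrier (Der A)"
  then have *: "D \<in> derivations A" "E \<in> derivations A" by (simp_all add: Der_simps)
  show "D \<otimes>\<^bsub>Der A\<^esub> E \<in> carrier (Der A)"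
    by (simp add: Der_simps Der_bracket * Der_closed)
  show "(c \<odot>\<^bsub>Der A\<^esub> D) \<otimes>\<^bsub>Der A\<^esub> E = c \<odot>\<^bsub>Der A\<^esub> (D \<otimes>\<^bsub>Der A\<^esub> E)"
    by (auto simp: Der_simps(4) Der_bracket * Der_smult_closed der_closed der_smult smult_diff intro!: restrict_ext)
  show "D \<otimes>\<^bsub>Der A\<^esub> (c \<odot>\<^bsub>Der A\<^esub> E) = c \<odot>\<^bsub>Der A\<^esub> (D \<otimes>\<^bsub>Der A\<^esub> E)"
    by (auto simp: Der_simps(4) Der_bracket * Der_smult_closed der_closed der_smult smult_diff intro!: restrict_ext)
  show "D \<otimes>\<^bsub>Der A\<^esub> D = \<zero>\<^bsub>Der A\<^esub>"
    by (simp add: Der_simps(3) Der_bracket *)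
qed (auto simp: Der_simps Der_closed der_closed smult_add_right smult_add_left smult_assoc smult_one
    der_ext closed intro!: restrict_ext ext)

lemma inner_derivation_eq:
  "a \<in> carrier A \<Longrightarrow> inner_derivation A a = (\<lambda>b\<in>carrier A. a \<star> b - b \<star> a)"
  by (auto simp: inner_derivation_def a_minus_eq closed intro!: restrict_ext)

lemma inner_derivation_derivation: "a \<in> carrier A \<Longrightarrow> inner_derivation A a \<in> derivations A"
  unfolding inner_derivation_eq
  by (intro derivationI) (simp_all add: closed mult_add_left mult_add_right mult_smult_left mult_smult_right
      smult_diff mult_diff_left mult_diff_right mult_assoc)

text \<open>By the Leibniz rule the bracket of \<open>D\<close> with the inner derivation of
  \<open>a\<close> is the inner derivation of \<open>D a\<close>.\<close>

lemma InDer_ideal: "lie_ideal (Der A) (InDer A)"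
  unfolding lie_ideal_def
proof
  show "linear_subspace (Der A) (InDer A)"
  proof (rule linear_subspaceI)
    show "module (ring_of_type_algebra :: 'k ring) (Der A)"
      by (rule lie_algebra.axioms(1)[OF lie_algebra_Der])
    show "InDer A \<subseteq> carrier (Der A)" by (auto simp: InDer_def Der_simps inner_derivation_derivation)
    have "inner_derivation A 0 = \<zero>\<^bsub>Der A\<^esub>"
      by (auto simp: inner_derivation_eq zero_closed Der_simps mult_zero_left mult_zero_right intro!: restrict_ext)
    then show "\<zero>\<^bsub>Der A\<^esub> \<in> InDer A" using zero_closed unfolding InDer_def by (metis imageI)
  next
    fix D E assume "D \<in> InDer A" "E \<in> InDer A"
    then obtain a b where ab: "a \<in> carrier A" "b \<in> carrier A" "D = inner_derivation A a" "E = inner_derivation A b"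
      by (auto simp: InDer_def)
    then have "D \<oplus>\<^bsub>Der A\<^esub> E = inner_derivation A (a + b)"
      by (auto simp: inner_derivation_eq closed Der_simps mult_add_left mult_add_right intro!: restrict_ext)
    then show "D \<oplus>\<^bsub>Der A\<^esub> E \<in> InDer A" using ab by (simp add: InDer_def closed)
  next
    fix c D assume "D \<in> InDer A"
    then obtain a where a: "a \<in> carrier A" "D = inner_derivation A a" by (auto simp: InDer_def)
    then have "c \<odot>\<^bsub>Der A\<^esub> D = inner_derivation A (c \<cdot> a)"
      by (auto simp: inner_derivation_eq closed Der_simps mult_smult_left mult_smult_right smult_diff intro!: restrict_ext)
    then show "c \<odot>\<^bsub>Der A\<^esub> D \<in> InDer A" using a by (simp add: InDer_def closed)
  qed
  show "\<forall>D\<in>carrier (Der A). \<forall>E\<in>InDer A. D \<otimes>\<^bsub>Der A\<^esub> E \<in> InDer A"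
  proof (intro ballI)
    fix D E assume "D \<in> carrier (Der A)" "E \<in> InDer A"
    then obtain a where D: "D \<in> derivations A" and a: "a \<in> carrier A" "E = inner_derivation A a"
      by (auto simp: InDer_def Der_simps)
    have "D \<otimes>\<^bsub>Der A\<^esub> E = inner_derivation A (D a)"
      unfolding a(2) Der_bracket[OF D inner_derivation_derivation[OF a(1)]]
      by (auto simp: inner_derivation_eq closed der_closed der_diff der_mult D a intro!: restrict_ext)
    then show "D \<otimes>\<^bsub>Der A\<^esub> E \<in> InDer A" using D a by (simp add: InDer_def der_closed)
  qed
qed

lemma HH1_quotient: "lie_ideal_quotient (Der A) (InDer A)"
  by (intro lie_ideal_quotient.intro lie_algebra_Der lie_ideal_quotient_axioms.intro InDer_ideal)

lemma Der_minus:
  assumes "D \<in> derivations A" "E \<in> derivations A"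
  shows "D \<ominus>\<^bsub>Der A\<^esub> E = (\<lambda>x\<in>carrier A. D x - E x)"
proof -
  interpret abelian_group "Der A" by (rule abelian_group_Der)
  have E': "(\<lambda>x\<in>carrier A. (- 1) \<cdot> E x) \<in> derivations A" by (rule Der_smult_closed[OF assms(2)])
  have "(\<lambda>x\<in>carrier A. (- 1) \<cdot> E x) \<oplus>\<^bsub>Der A\<^esub> E = \<zero>\<^bsub>Der A\<^esub>"
    using assms by (auto simp: Der_simps smult_minus_one der_closed intro!: restrict_ext)
  then have "\<ominus>\<^bsub>Der A\<^esub> E = (\<lambda>x\<in>carrier A. (- 1) \<cdot> E x)"
    using assms E' by (intro minus_equality) (simp_all add: Der_simps(1))
  then show ?thesis
    using assms by (auto simp: a_minus_def Der_simps smult_minus_one der_closed intro!: restrict_ext)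
qed

lemma module_Der: "module (ring_of_type_algebra :: 'k ring) (Der A)"
  by (rule lie_algebra.axioms(1)[OF lie_algebra_Der])

abbreviation "cls \<equiv> HH1_class A"

context begin

interpretation H: lie_ideal_quotient "Der A" "InDer A" by (rule HH1_quotient)

lemma cls_eq_iff:
  assumes "D \<in> derivations A" "E \<in> derivations A"
  shows "cls D = cls E \<longleftrightarrow> (\<lambda>x\<in>carrier A. D x - E x) \<in> InDer A"
  using H.cls_eq_iff[of D E] assms by (simp add: HH1_class_def Der_simps(1) Der_minus)

lemma HH1_simps:
  shows carrier_HH1: "carrier (HH1 A) = cls ` derivations A"
    and zero_HH1: "\<zero>\<^bsub>HH1 A\<^esub> = cls \<zero>\<^bsub>Der A\<^esub>"
    and add_HH1: "D \<in> derivations A \<Longrightarrow> E \<in> derivations A \<Longrightarrow> cls D \<oplus>\<^bsub>HH1 A\<^esub> cls E = cls (D \<oplus>\<^bsub>Der A\<^esub> E)"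
    and smult_HH1: "D \<in> derivations A \<Longrightarrow> c \<odot>\<^bsub>HH1 A\<^esub> cls D = cls (c \<odot>\<^bsub>Der A\<^esub> D)"
    and bracket_HH1: "D \<in> derivations A \<Longrightarrow> E \<in> derivations A \<Longrightarrow>
      cls D \<otimes>\<^bsub>HH1 A\<^esub> cls E = cls (D \<otimes>\<^bsub>Der A\<^esub> E)"
    and lie_algebra_HH1: "lie_algebra (HH1 A)"
    and subspace_HH1: "linear_subspace (Der A) W \<Longrightarrow> linear_subspace (HH1 A) (cls ` W)"
proof -
  have eq: "cls = H.cls" by (simp add: fun_eq_iff HH1_class_def)
  show "carrier (HH1 A) = cls ` derivations A" "\<zero>\<^bsub>HH1 A\<^esub> = cls \<zero>\<^bsub>Der A\<^esub>"
    using H.carrier_Q H.zero_Q by (simp_all add: eq HH1_def Der_simps(1))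
  show "D \<in> derivations A \<Longrightarrow> E \<in> derivations A \<Longrightarrow> cls D \<oplus>\<^bsub>HH1 A\<^esub> cls E = cls (D \<oplus>\<^bsub>Der A\<^esub> E)"
    unfolding eq HH1_def by (rule H.add_Q) (simp_all add: Der_simps(1))
  show "D \<in> derivations A \<Longrightarrow> c \<odot>\<^bsub>HH1 A\<^esub> cls D = cls (c \<odot>\<^bsub>Der A\<^esub> D)"
    unfolding eq HH1_def by (rule H.smult_Q) (simp_all add: Der_simps(1))
  show "D \<in> derivations A \<Longrightarrow> E \<in> derivations A \<Longrightarrow> cls D \<otimes>\<^bsub>HH1 A\<^esub> cls E = cls (D \<otimes>\<^bsub>Der A\<^esub> E)"
    unfolding eq HH1_def by (rule H.bracket_Q) (simp_all add: Der_simps(1))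
  show "lie_algebra (HH1 A)" unfolding HH1_def by (rule H.lie_algebra_Q)
  show "linear_subspace (Der A) W \<Longrightarrow> linear_subspace (HH1 A) (cls ` W)"
    unfolding eq HH1_def by (rule H.linear_subspace_image)
qed

end

end

section \<open>Path algebras\<close>

text \<open>The parameter \<open>field_type\<close> only carries the coefficient type, which
  \<open>G\<close> does not determine.\<close>

locale quiver_algebra = wf_digraph G for G :: "('v, 'e) pre_digraph" +
  fixes field_type :: "'k::field itself"
begin

abbreviation A :: "('k, ('v, 'e) qpath \<Rightarrow> 'k) module" where
  "A \<equiv> path_algebra G"

abbreviation vec :: "('v, 'e) qpath \<Rightarrow> ('v, 'e) qpath \<Rightarrow> 'k" where
  "vec \<equiv> path_vec"

lemma awalk_awlast: "awalk u p v \<Longrightarrow> awlast u p = v"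
  by (auto simp: awalk_def awlast_if_cas)

lemma qpathsD: "(u, es) \<in> qpaths G \<Longrightarrow> awalk u es (qhead G (u, es))"
  by (auto simp: qpaths_def qhead_def awalk_awlast)

lemma awalk_qpaths: "awalk u es v \<Longrightarrow> (u, es) \<in> qpaths G \<and> qhead G (u, es) = v"
  by (auto simp: qpaths_def qhead_def awalk_awlast)

definition concat_path :: "('v, 'e) qpath \<Rightarrow> ('v, 'e) qpath \<Rightarrow> ('v, 'e) qpath" where
  "concat_path p q = (fst p, snd p @ snd q)"

lemma concat_path:
  assumes "p \<in> qpaths G" "q \<in> qpaths G" "qhead G p = qtail q"
  shows "concat_path p q \<in> qpaths G" "qtail (concat_path p q) = qtail p"
    "qhead G (concat_path p q) = qhead G q"
proof -
  have "awalk (fst p) (snd p) (qhead G p)" "awalk (fst q) (snd q) (qhead G q)"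
    using assms qpathsD[of "fst p" "snd p"] qpathsD[of "fst q" "snd q"] by auto
  then have "awalk (fst p) (snd p @ snd q) (qhead G q)"
    using assms(3) by (intro awalk_appendI) (auto simp: qtail_def)
  then show "concat_path p q \<in> qpaths G" "qtail (concat_path p q) = qtail p"
    "qhead G (concat_path p q) = qhead G q"
    using awalk_qpaths by (auto simp: concat_path_def qtail_def)
qed

lemma trivial_path: "v \<in> verts G \<Longrightarrow> (v, []) \<in> qpaths G" "qhead G (v, []) = v" "qtail (v, es) = v"
  by (auto simp: qpaths_def qhead_def qtail_def awalk_Nil_iff)

lemma qpath_ends: "p \<in> qpaths G \<Longrightarrow> qtail p \<in> verts G \<and> qhead G p \<in> verts G"
  using qpathsD[of "fst p" "snd p"] awalk_hd_in_verts[of "fst p" "snd p" "qhead G p"]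
    awalk_last_in_verts[of "fst p" "snd p" "qhead G p"] by (simp add: qtail_def)

lemma arrow_path:
  assumes "e \<in> arcs G"
  shows "arrow_path G e \<in> qpaths G" "qtail (arrow_path G e) = tail G e" "qhead G (arrow_path G e) = head G e"
proof -
  have "awalk (tail G e) [e] (head G e)" using assms by (simp add: arc_implies_awalk)
  then show "arrow_path G e \<in> qpaths G" "qtail (arrow_path G e) = tail G e" "qhead G (arrow_path G e) = head G e"
    using awalk_qpaths by (auto simp: arrow_path_def qtail_def)
qed

definition factorizations :: "('v, 'e) qpath \<Rightarrow> (('v, 'e) qpath \<times> ('v, 'e) qpath) set" where
  "factorizations r = {(p, q). p \<in> qpaths G \<and> q \<in> qpaths G \<and> qhead G p = qtail q \<and> concat_path p q = r}"

text \<open>A factorization is determined by the position at which the arrow list is cut; the second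
  factor has to start where the first one ends.\<close>

lemma finite_factorizations: "finite (factorizations r)"
proof (rule finite_subset)
  show "factorizations r \<subseteq> (\<lambda>i. ((fst r, take i (snd r)), (qhead G (fst r, take i (snd r)), drop i (snd r))))
      ` {..length (snd r)}"
  proof
    fix pq assume "pq \<in> factorizations r"
    then obtain u es v fs where pq: "pq = ((u, es), (v, fs))" and c: "qhead G (u, es) = v" "r = (u, es @ fs)"
      by (auto simp: factorizations_def concat_path_def qtail_def)
    then show "pq \<in> (\<lambda>i. ((fst r, take i (snd r)), (qhead G (fst r, take i (snd r)), drop i (snd r))))
      ` {..length (snd r)}"
      by (intro image_eqI[of _ _ "length es"]) auto
  qed
qed simp

lemma carrier_iff: "x \<in> carrier A \<longleftrightarrow> finite {p. x p \<noteq> 0} \<and> (\<forall>p. x p \<noteq> 0 \<longrightarrow> p \<in> qpaths G)"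
  by (auto simp: path_algebra_def)

lemma carrierD: "x \<in> carrier A \<Longrightarrow> x p \<noteq> 0 \<Longrightarrow> p \<in> qpaths G"
  unfolding carrier_iff by blast

lemma smult_apply: "(c \<odot>\<^bsub>A\<^esub> x) p = c * x p"
  by (simp add: path_algebra_def)

lemma mult_apply: "(x \<otimes>\<^bsub>A\<^esub> y) r = (\<Sum>pq\<in>factorizations r. x (fst pq) * y (snd pq))"
  by (simp add: path_algebra_def factorizations_def concat_path_def case_prod_unfold)

lemma mult_nonzero:
  assumes "(x \<otimes>\<^bsub>A\<^esub> y) r \<noteq> 0"
  obtains p q where "p \<in> qpaths G" "q \<in> qpaths G" "qhead G p = qtail q" "r = concat_path p q" "x p \<noteq> 0" "y q \<noteq> 0"
proof -
  obtain pq where "pq \<in> factorizations r" "x (fst pq) * y (snd pq) \<noteq> 0"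
    using assms unfolding mult_apply by (rule sum.not_neutral_contains_not_neutral)
  then show thesis by (intro that[of "fst pq" "snd pq"]) (auto simp: factorizations_def)
qed

lemma mult_vanishes:
  assumes "\<And>p q. x p \<noteq> 0 \<Longrightarrow> y q \<noteq> 0 \<Longrightarrow> qhead G p \<noteq> qtail q"
  shows "x \<otimes>\<^bsub>A\<^esub> y = 0"
proof
  fix r show "(x \<otimes>\<^bsub>A\<^esub> y) r = 0 r" using assms mult_nonzero[of x y r] by (force simp: zero_fun_def)
qed

lemma vec_closed: "p \<in> qpaths G \<Longrightarrow> vec p \<in> carrier A"
  by (auto simp: carrier_iff path_vec_def)

lemma vec_mult:
  assumes "p \<in> qpaths G" "q \<in> qpaths G"
  shows "vec p \<otimes>\<^bsub>A\<^esub> vec q = (if qhead G p = qtail q then vec (concat_path p q) else 0)"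
proof
  fix r
  have "(vec p \<otimes>\<^bsub>A\<^esub> vec q) r = (\<Sum>pq\<in>factorizations r. if pq = (p, q) then 1 else 0)"
    unfolding mult_apply by (intro sum.cong) (auto simp: path_vec_def)
  also have "\<dots> = (if (p, q) \<in> factorizations r then 1 else 0)"
    using finite_factorizations by simp
  finally show "(vec p \<otimes>\<^bsub>A\<^esub> vec q) r = (if qhead G p = qtail q then vec (concat_path p q) else 0) r"
    using assms by (auto simp: factorizations_def path_vec_def zero_fun_def)
qed

lemma carrier_zero: "0 \<in> carrier A"
  by (simp add: carrier_iff zero_fun_def)

lemma carrier_add: "x \<in> carrier A \<Longrightarrow> y \<in> carrier A \<Longrightarrow> x + y \<in> carrier A"
proof -
  assume x: "x \<in> carrier A" "y \<in> carrier A"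
  then have "finite ({p. x p \<noteq> 0} \<union> {p. y p \<noteq> 0})" by (auto simp: carrier_iff)
  moreover have "{p. (x + y) p \<noteq> 0} \<subseteq> {p. x p \<noteq> 0} \<union> {p. y p \<noteq> 0}" by auto
  ultimately have "finite {p. (x + y) p \<noteq> 0}" by (rule rev_finite_subset)
  then show ?thesis using x by (auto simp: carrier_iff) (metis add_0)
qed

lemma carrier_smult: "x \<in> carrier A \<Longrightarrow> c \<odot>\<^bsub>A\<^esub> x \<in> carrier A"
  by (auto simp: carrier_iff smult_apply elim: rev_finite_subset)

lemma carrier_mult:
  assumes "x \<in> carrier A" "y \<in> carrier A"
  shows "x \<otimes>\<^bsub>A\<^esub> y \<in> carrier A"
proof -
  have "{r. (x \<otimes>\<^bsub>A\<^esub> y) r \<noteq> 0} \<subseteq> (\<lambda>(p, q). concat_path p q) ` ({p. x p \<noteq> 0} \<times> {q. y q \<noteq> 0})"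
    by (auto elim!: mult_nonzero)
  then have "finite {r. (x \<otimes>\<^bsub>A\<^esub> y) r \<noteq> 0}"
    using assms by (elim finite_subset) (auto simp: carrier_iff)
  moreover have "r \<in> qpaths G" if "(x \<otimes>\<^bsub>A\<^esub> y) r \<noteq> 0" for r
    using that by (rule mult_nonzero) (auto intro: concat_path)
  ultimately show ?thesis by (simp add: carrier_iff)
qed

text \<open>Induction on the size of the support. The condition \<open>x p = 0\<close> says that the
  new path is not in the support of \<open>x\<close>, so no coefficients cancel;
  \<open>Der0_min_length\<close> depends on this.\<close>

lemma path_algebra_induct :
  assumes "x \<in> carrier A" and "P 0"
    and step: "\<And>c p x. p \<in> qpaths G \<Longrightarrow> x \<in> carrier A \<Longrightarrow> x p = 0 \<Longrightarrow> c \<noteq> 0 \<Longrightarrow> P x \<Longrightarrow>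
      P (c \<odot>\<^bsub>A\<^esub> vec p + x)"
  shows "P x"
proof -
  have "finite {p. x p \<noteq> 0}" using assms(1) by (simp add: carrier_iff)
  then show ?thesis using assms(1)
  proof (induction "{p. x p \<noteq> 0}" arbitrary: x rule: finite_induct)
    case empty
    then have "x = 0" by (auto simp: fun_eq_iff)
    with assms(2) show ?case by (rule back_subst[of P, OF _ sym])
  next
    case (insert p S)
    then have p: "x p \<noteq> 0" by auto
    define y where "y = x(p := 0)"
    have S: "S = {q. y q \<noteq> 0}" using insert.hyps by (auto simp: y_def)
    have "{q. y q \<noteq> 0} \<subseteq> {q. x q \<noteq> 0}" by (auto simp: y_def)
    then have y: "y \<in> carrier A"
      using insert.prems finite_subset unfolding carrier_iff by blast
    have Py: "P y" by (rule insert.hyps(3)[OF S y])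
    have "P (x p \<odot>\<^bsub>A\<^esub> vec p + y)"
      by (rule step[OF carrierD[OF insert.prems p] y _ p Py]) (simp add: y_def)
    moreover have "x p \<odot>\<^bsub>A\<^esub> vec p + y = x"
      by (auto simp: fun_eq_iff smult_apply path_vec_def y_def)
    ultimately show ?case by (rule back_subst[of P])
  qed
qed

text \<open>The sum in \<open>mult_apply\<close> runs over the factorizations of the index,
  independently of the supports. So bilinearity holds for arbitrary functions, also outside the
  carrier.\<close>

lemma mult_add_l: "(x + y) \<otimes>\<^bsub>A\<^esub> z = x \<otimes>\<^bsub>A\<^esub> z + y \<otimes>\<^bsub>A\<^esub> z"
  by (simp add: fun_eq_iff mult_apply distrib_right sum.distrib)

lemma mult_add_r: "x \<otimes>\<^bsub>A\<^esub> (y + z) = x \<otimes>\<^bsub>A\<^esub> y + x \<otimes>\<^bsub>A\<^esub> z"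
  by (simp add: fun_eq_iff mult_apply distrib_left sum.distrib)

lemma mult_smult_l: "(c \<odot>\<^bsub>A\<^esub> x) \<otimes>\<^bsub>A\<^esub> y = c \<odot>\<^bsub>A\<^esub> (x \<otimes>\<^bsub>A\<^esub> y)"
  by (simp add: fun_eq_iff mult_apply smult_apply sum_distrib_left mult.assoc)

lemma mult_smult_r: "x \<otimes>\<^bsub>A\<^esub> (c \<odot>\<^bsub>A\<^esub> y) = c \<odot>\<^bsub>A\<^esub> (x \<otimes>\<^bsub>A\<^esub> y)"
  by (simp add: fun_eq_iff mult_apply smult_apply sum_distrib_left mult.left_commute)

lemma mult_zero_l: "0 \<otimes>\<^bsub>A\<^esub> x = 0" and mult_zero_r: "x \<otimes>\<^bsub>A\<^esub> 0 = 0"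
  by (simp_all add: fun_eq_iff mult_apply)

lemma vec_mult_assoc:
  assumes "p \<in> qpaths G" "q \<in> qpaths G" "r \<in> qpaths G"
  shows "(vec p \<otimes>\<^bsub>A\<^esub> vec q) \<otimes>\<^bsub>A\<^esub> vec r = vec p \<otimes>\<^bsub>A\<^esub> (vec q \<otimes>\<^bsub>A\<^esub> vec r)"
  using assms concat_path[of p q] concat_path[of q r]
  by (simp add: vec_mult mult_zero_l mult_zero_r) (simp add: concat_path_def)

text \<open>Both sides are trilinear, so the identity extends from paths to the carrier one argument
  at a time, starting with the last.\<close>

lemma mult_associative:
  assumes "x \<in> carrier A" "y \<in> carrier A" "z \<in> carrier A"
  shows "(x \<otimes>\<^bsub>A\<^esub> y) \<otimes>\<^bsub>A\<^esub> z = x \<otimes>\<^bsub>A\<^esub> (y \<otimes>\<^bsub>A\<^esub> z)"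
proof -
  note lin = mult_add_l mult_add_r mult_smult_l mult_smult_r mult_zero_l mult_zero_r
  have 1: "(vec p \<otimes>\<^bsub>A\<^esub> vec q) \<otimes>\<^bsub>A\<^esub> z = vec p \<otimes>\<^bsub>A\<^esub> (vec q \<otimes>\<^bsub>A\<^esub> z)" if "p \<in> qpaths G" "q \<in> qpaths G" for p q
    by (rule path_algebra_induct[OF assms(3), of "\<lambda>z. (vec p \<otimes>\<^bsub>A\<^esub> vec q) \<otimes>\<^bsub>A\<^esub> z = vec p \<otimes>\<^bsub>A\<^esub> (vec q \<otimes>\<^bsub>A\<^esub> z)"])
      (simp_all only: lin vec_mult_assoc that)
  have 2: "(vec p \<otimes>\<^bsub>A\<^esub> y) \<otimes>\<^bsub>A\<^esub> z = vec p \<otimes>\<^bsub>A\<^esub> (y \<otimes>\<^bsub>A\<^esub> z)" if "p \<in> qpaths G" for p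
    by (rule path_algebra_induct[OF assms(2), of "\<lambda>y. (vec p \<otimes>\<^bsub>A\<^esub> y) \<otimes>\<^bsub>A\<^esub> z = vec p \<otimes>\<^bsub>A\<^esub> (y \<otimes>\<^bsub>A\<^esub> z)"])
      (simp_all only: lin 1 that)
  show ?thesis
    by (rule path_algebra_induct[OF assms(1), of "\<lambda>x. (x \<otimes>\<^bsub>A\<^esub> y) \<otimes>\<^bsub>A\<^esub> z = x \<otimes>\<^bsub>A\<^esub> (y \<otimes>\<^bsub>A\<^esub> z)"])
      (simp_all only: lin 2)
qed

sublocale additive_algebra A
proof
  show "add A = (+)" "zero A = 0" by (auto simp: path_algebra_def fun_eq_iff)
qed (auto simp: carrier_zero carrier_add carrier_smult carrier_mult mult_add_l mult_add_r mult_smult_l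
    mult_smult_r mult_associative fun_eq_iff smult_apply algebra_simps)

notation mult_A (infixl "\<star>" 70) and smult_A (infixr "\<cdot>" 75)

text \<open>A combination of vertices acts diagonally on paths: only the factorization of
  \<open>r\<close> with trivial first factor contributes.\<close>

lemma vertex_mult_left:
  assumes a: "\<And>p. a p \<noteq> 0 \<Longrightarrow> snd p = []" "a \<in> carrier A" and x: "x \<in> carrier A"
  shows "(a \<star> x) r = a (qtail r, []) * x r"
proof (cases "r \<in> qpaths G")
  case False
  then have "x r = 0" using carrierD[OF x] by blast
  moreover have "(a \<star> x) r = 0" using carrierD[OF carrier_mult[OF a(2) x]] False by blast
  ultimately show ?thesis by simp
next
  case True
  have "(a \<star> x) r = (\<Sum>pq\<in>{((qtail r, []), r)}. a (fst pq) * x (snd pq))"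
    unfolding mult_apply
  proof (rule sum.mono_neutral_right[OF finite_factorizations])
    show "{((qtail r, []), r)} \<subseteq> factorizations r"
      using True qpath_ends[OF True] trivial_path by (auto simp: factorizations_def concat_path_def qtail_def)
    show "\<forall>pq\<in>factorizations r - {((qtail r, []), r)}. a (fst pq) * x (snd pq) = 0"
    proof
      fix pq assume pq: "pq \<in> factorizations r - {((qtail r, []), r)}"
      have "snd (fst pq) \<noteq> []"
      proof
        assume nil: "snd (fst pq) = []"
        obtain u es q where "pq = ((u, es), q)" by (metis prod.collapse)
        then show False using nil pq by (auto simp: factorizations_def concat_path_def qtail_def trivial_path)
      qed
      then have "a (fst pq) = 0" using a(1)[of "fst pq"] by blast
      then show "a (fst pq) * x (snd pq) = 0" by simp
    qed
  qed
  then show ?thesis by simp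
qed

lemma vertex_mult_right:
  assumes a: "\<And>p. a p \<noteq> 0 \<Longrightarrow> snd p = []" "a \<in> carrier A" and x: "x \<in> carrier A"
  shows "(x \<star> a) r = x r * a (qhead G r, [])"
proof (cases "r \<in> qpaths G")
  case False
  then have "x r = 0" using carrierD[OF x] by blast
  moreover have "(x \<star> a) r = 0" using carrierD[OF carrier_mult[OF x a(2)]] False by blast
  ultimately show ?thesis by simp
next
  case True
  have "(x \<star> a) r = (\<Sum>pq\<in>{(r, (qhead G r, []))}. x (fst pq) * a (snd pq))"
    unfolding mult_apply
  proof (rule sum.mono_neutral_right[OF finite_factorizations])
    show "{(r, (qhead G r, []))} \<subseteq> factorizations r"
      using True qpath_ends[OF True] trivial_path by (auto simp: factorizations_def concat_path_def qtail_def)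
    show "\<forall>pq\<in>factorizations r - {(r, (qhead G r, []))}. x (fst pq) * a (snd pq) = 0"
    proof
      fix pq assume pq: "pq \<in> factorizations r - {(r, (qhead G r, []))}"
      have "snd (snd pq) \<noteq> []"
      proof
        assume nil: "snd (snd pq) = []"
        obtain p v es where "pq = (p, (v, es))" by (metis prod.collapse)
        then show False using nil pq by (auto simp: factorizations_def concat_path_def qtail_def)
      qed
      then have "a (snd pq) = 0" using a(1)[of "snd pq"] by blast
      then show "x (fst pq) * a (snd pq) = 0" by simp
    qed
  qed
  then show ?thesis by simp
qed

abbreviation vertex :: "'v \<Rightarrow> ('v, 'e) qpath \<Rightarrow> 'k" where
  "vertex v \<equiv> vec (v, [])"

lemma vertex_closed: "v \<in> verts G \<Longrightarrow> vertex v \<in> carrier A"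
  by (simp add: vec_closed trivial_path)

lemma vertex_mult:
  assumes "v \<in> verts G" "x \<in> carrier A"
  shows "(vertex v \<star> x) r = (if qtail r = v then x r else 0)"
    "(x \<star> vertex v) r = (if qhead G r = v then x r else 0)"
proof -
  have "snd p = []" if "vertex v p \<noteq> 0" for p using that by (auto simp: path_vec_def split: if_splits)
  note vertex_mult_left[OF this vertex_closed[OF assms(1)] assms(2), of r]
    vertex_mult_right[OF this vertex_closed[OF assms(1)] assms(2), of r]
  then show "(vertex v \<star> x) r = (if qtail r = v then x r else 0)"
    "(x \<star> vertex v) r = (if qhead G r = v then x r else 0)"
    by (simp_all add: path_vec_def)
qed

lemma vertex_mult_self:
  assumes "v \<in> verts G" "x \<in> carrier A"
  shows "(\<And>p. x p \<noteq> 0 \<Longrightarrow> qtail p = v) \<Longrightarrow> vertex v \<star> x = x"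
    "(\<And>p. x p \<noteq> 0 \<Longrightarrow> qhead G p = v) \<Longrightarrow> x \<star> vertex v = x"
  using vertex_mult[OF assms] by (auto simp: fun_eq_iff)

abbreviation arrow :: "'e \<Rightarrow> ('v, 'e) qpath \<Rightarrow> 'k" where
  "arrow e \<equiv> vec (arrow_path G e)"

lemma arrow_closed: "e \<in> arcs G \<Longrightarrow> arrow e \<in> carrier A"
  by (simp add: vec_closed arrow_path)

lemma vec_Cons:
  assumes "awalk u (e # es) v"
  shows "vec (u, e # es) = arrow e \<star> vec (head G e, es)" "e \<in> arcs G" "u = tail G e"
    "awalk (head G e) es v" "(head G e, es) \<in> qpaths G"
proof -
  show *: "e \<in> arcs G" "u = tail G e" "awalk (head G e) es v"
    using assms by (auto simp: awalk_Cons_iff)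
  then show "(head G e, es) \<in> qpaths G" using awalk_qpaths by blast
  then show "vec (u, e # es) = arrow e \<star> vec (head G e, es)"
    using * by (simp add: vec_mult arrow_path concat_path_def trivial_path) (simp add: arrow_path_def)
qed

lemma linear_eqI:
  assumes "\<And>x y. x \<in> carrier A \<Longrightarrow> y \<in> carrier A \<Longrightarrow> D (x + y) = D x + D y"
    and "\<And>c x. x \<in> carrier A \<Longrightarrow> D (c \<cdot> x) = c \<cdot> D x"
    and "\<And>x y. x \<in> carrier A \<Longrightarrow> y \<in> carrier A \<Longrightarrow> E (x + y) = E x + E y"
    and "\<And>c x. x \<in> carrier A \<Longrightarrow> E (c \<cdot> x) = c \<cdot> E x"
    and eq: "\<And>p. p \<in> qpaths G \<Longrightarrow> D (vec p) = E (vec p)" and "x \<in> carrier A"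
  shows "D x = (E x :: ('v, 'e) qpath \<Rightarrow> 'k)"
proof (rule path_algebra_induct[OF assms(6), of "\<lambda>x. D x = E x"])
  have "D (0 + 0) = D 0 + D 0" "E (0 + 0) = E 0 + E 0" using assms(1,3) zero_closed by blast+
  then show "D 0 = E 0" by (simp del: zero_fun_apply plus_fun_apply)
next
  fix c p x
  assume "p \<in> qpaths G" "x \<in> carrier A" "D x = E x"
  then show "D (c \<cdot> vec p + x) = E (c \<cdot> vec p + x)"
    by (simp only: assms(1-4) eq closed vec_closed)
qed

section \<open>Derivations that kill the vertices, and their values on arrows\<close>

definition admissible :: "('e \<Rightarrow> ('v, 'e) qpath \<Rightarrow> 'k) \<Rightarrow> bool" where
  "admissible \<phi> \<longleftrightarrow> (\<forall>e\<in>arcs G. \<phi> e \<in> carrier A \<and> (\<forall>p. \<phi> e p \<noteq> 0 \<longrightarrow> parallel G p (arrow_path G e)))"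

lemma admissibleD:
  assumes "admissible \<phi>" "e \<in> arcs G"
  shows "\<phi> e \<in> carrier A" "\<phi> e p \<noteq> 0 \<Longrightarrow> qtail p = tail G e" "\<phi> e p \<noteq> 0 \<Longrightarrow> qhead G p = head G e"
proof -
  show "\<phi> e \<in> carrier A" using assms unfolding admissible_def by blast
  have "parallel G p (arrow_path G e)" if "\<phi> e p \<noteq> 0" using assms that unfolding admissible_def by blast
  then show "\<phi> e p \<noteq> 0 \<Longrightarrow> qtail p = tail G e" "\<phi> e p \<noteq> 0 \<Longrightarrow> qhead G p = head G e"
    using assms(2) by (simp_all add: parallel_def arrow_path)
qed

text \<open>The Leibniz rule unfolded from the first arrow on. The value 0 on the empty list is
  forced, because vertices are to be killed.\<close>

primrec path_der :: "('e \<Rightarrow> ('v, 'e) qpath \<Rightarrow> 'k) \<Rightarrow> 'v \<Rightarrow> 'e list \<Rightarrow> ('v, 'e) qpath \<Rightarrow> 'k" where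
  "path_der \<phi> u [] = 0"
| "path_der \<phi> u (e # es) = \<phi> e \<star> vec (head G e, es) + arrow e \<star> path_der \<phi> (head G e) es"

lemma vec_nonzero: "vec p q \<noteq> 0 \<Longrightarrow> q = p"
  by (simp add: path_vec_def split: if_splits)

text \<open>Control of the end points serves twice: it lets vertices act as identities in
  \<open>path_der_append\<close>, and it makes the Leibniz terms of non-composable paths vanish in
  \<open>der_of_derivation\<close>.\<close>

lemma path_der_support:
  assumes "admissible \<phi>" "awalk u es v"
  shows "path_der \<phi> u es \<in> carrier A \<and> (\<forall>p. path_der \<phi> u es p \<noteq> 0 \<longrightarrow> qtail p = u \<and> qhead G p = v)"
  using assms(2)
proof (induction es arbitrary: u)
  case Nil
  have "path_der \<phi> u [] = 0" by (rule path_der.simps)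
  then show ?case using zero_closed by (metis zero_fun_apply)
next
  case (Cons e es)
  note w = vec_Cons[OF Cons.prems]
  note IH = Cons.IH[OF w(4)]
  have cl: "\<phi> e \<in> carrier A" "vec (head G e, es) \<in> carrier A" "arrow e \<in> carrier A" "path_der \<phi> (head G e) es \<in> carrier A"
    using admissibleD[OF assms(1) w(2)] vec_closed[OF w(5)] arrow_closed[OF w(2)] IH by auto
  have hd: "qhead G (head G e, es) = v" using awalk_qpaths[OF w(4)] by simp
  show ?case
  proof (intro conjI allI impI)
    show "path_der \<phi> u (e # es) \<in> carrier A" using cl by (simp add: closed)
    fix r assume "path_der \<phi> u (e # es) r \<noteq> 0"
    then have "(\<phi> e \<star> vec (head G e, es)) r \<noteq> 0 \<or> (arrow e \<star> path_der \<phi> (head G e) es) r \<noteq> 0"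
      by auto
    then have "qtail r = u \<and> qhead G r = v"
    proof
      assume "(\<phi> e \<star> vec (head G e, es)) r \<noteq> 0"
      then obtain p q where pq: "p \<in> qpaths G" "q \<in> qpaths G" "qhead G p = qtail q" "r = concat_path p q"
        "\<phi> e p \<noteq> 0" "vec (head G e, es) q \<noteq> 0" by (rule mult_nonzero)
      then show ?thesis
        using concat_path[OF pq(1-3)] admissibleD[OF assms(1) w(2)] vec_nonzero[OF pq(6)] hd w(3) by simp
    next
      assume "(arrow e \<star> path_der \<phi> (head G e) es) r \<noteq> 0"
      then obtain p q where pq: "p \<in> qpaths G" "q \<in> qpaths G" "qhead G p = qtail q" "r = concat_path p q"
        "arrow e p \<noteq> 0" "path_der \<phi> (head G e) es q \<noteq> 0" by (rule mult_nonzero)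
      then show ?thesis
        using concat_path[OF pq(1-3)] vec_nonzero[OF pq(5)] IH w(3) arrow_path[OF w(2)] by simp
    qed
    then show "qtail r = u" "qhead G r = v" by auto
  qed
qed

text \<open>The Leibniz rule for composable paths. The recursion peels arrows off the first path,
  and associativity moves the remaining factor to the right.\<close>

lemma path_der_append:
  assumes \<phi>: "admissible \<phi>" and "awalk u es v" and fs: "awalk v fs w"
  shows "path_der \<phi> u (es @ fs) = path_der \<phi> u es \<star> vec (v, fs) + vec (u, es) \<star> path_der \<phi> v fs"
  using assms(2)
proof (induction es arbitrary: u)
  case Nil
  then have "u = v" "v \<in> verts G" by (auto simp: awalk_Nil_iff)
  moreover have "vertex v \<star> path_der \<phi> v fs = path_der \<phi> v fs"
    using path_der_support[OF \<phi> fs] by (intro vertex_mult_self \<open>v \<in> verts G\<close>) auto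
  ultimately show ?case by (simp add: mult_zero_l del: zero_fun_apply plus_fun_apply)
next
  case (Cons e es)
  note c = vec_Cons[OF Cons.prems]
  have vfs: "(v, fs) \<in> qpaths G" using awalk_qpaths[OF fs] by simp
  have hd: "qhead G (head G e, es) = v" using awalk_qpaths[OF c(4)] by simp
  have cl: "\<phi> e \<in> carrier A" "vec (head G e, es) \<in> carrier A" "arrow e \<in> carrier A"
    "path_der \<phi> (head G e) es \<in> carrier A" "vec (v, fs) \<in> carrier A" "path_der \<phi> v fs \<in> carrier A"
    using admissibleD[OF \<phi> c(2)] vec_closed[OF c(5)] arrow_closed[OF c(2)] path_der_support[OF \<phi> c(4)]
      vec_closed[OF vfs] path_der_support[OF \<phi> fs] by auto
  have "vec (head G e, es @ fs) = vec (head G e, es) \<star> vec (v, fs)"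
    using vec_mult[OF c(5) vfs] hd by (simp add: concat_path_def trivial_path)
  then have "path_der \<phi> u ((e # es) @ fs) = \<phi> e \<star> (vec (head G e, es) \<star> vec (v, fs)) +
      arrow e \<star> (path_der \<phi> (head G e) es \<star> vec (v, fs) + vec (head G e, es) \<star> path_der \<phi> v fs)"
    by (simp only: append_Cons path_der.simps Cons.IH[OF c(4)])
  also have "\<dots> = path_der \<phi> u (e # es) \<star> vec (v, fs) + vec (u, e # es) \<star> path_der \<phi> v fs"
    unfolding c(1) path_der.simps using cl
    by (simp only: mult_add_l mult_add_r mult_associative closed add.assoc)
  finally show ?case .
qed

definition lin_ext :: "(('v, 'e) qpath \<Rightarrow> ('v, 'e) qpath \<Rightarrow> 'k) \<Rightarrow> (('v, 'e) qpath \<Rightarrow> 'k) \<Rightarrow> ('v, 'e) qpath \<Rightarrow> 'k" where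
  "lin_ext f x r = (\<Sum>p\<in>{p. x p \<noteq> 0}. x p * f p r)"

lemma lin_ext_superset:
  "finite S \<Longrightarrow> {p. x p \<noteq> 0} \<subseteq> S \<Longrightarrow> lin_ext f x r = (\<Sum>p\<in>S. x p * f p r)"
  unfolding lin_ext_def by (intro sum.mono_neutral_left) auto

lemma lin_ext_add:
  assumes "x \<in> carrier A" "y \<in> carrier A"
  shows "lin_ext f (x + y) = lin_ext f x + lin_ext f y"
proof
  fix r
  let ?S = "{p. x p \<noteq> 0} \<union> {p. y p \<noteq> 0}"
  have S: "finite ?S" using assms by (auto simp: carrier_iff)
  have "lin_ext f x r = (\<Sum>p\<in>?S. x p * f p r)" "lin_ext f y r = (\<Sum>p\<in>?S. y p * f p r)"
    "lin_ext f (x + y) r = (\<Sum>p\<in>?S. (x + y) p * f p r)"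
    by (intro lin_ext_superset S; auto)+
  then show "lin_ext f (x + y) r = (lin_ext f x + lin_ext f y) r"
    by (simp add: distrib_right sum.distrib)
qed

lemma lin_ext_smult:
  assumes "x \<in> carrier A"
  shows "lin_ext f (c \<cdot> x) = c \<cdot> lin_ext f x"
proof
  fix r
  have S: "finite {p. x p \<noteq> 0}" using assms by (simp add: carrier_iff)
  have "lin_ext f (c \<cdot> x) r = (\<Sum>p\<in>{p. x p \<noteq> 0}. (c \<cdot> x) p * f p r)"
    by (rule lin_ext_superset[OF S]) (auto simp: smult_apply)
  then show "lin_ext f (c \<cdot> x) r = (c \<cdot> lin_ext f x) r"
    by (simp add: smult_apply lin_ext_def sum_distrib_left mult.assoc)
qed

lemma lin_ext_vec: "lin_ext f (vec p) = f p"
proof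
  fix r
  have "lin_ext f (vec p) r = (\<Sum>q\<in>{p}. vec p q * f q r)"
    by (rule lin_ext_superset) (auto dest: vec_nonzero)
  then show "lin_ext f (vec p) r = f p r" by (simp add: path_vec_def)
qed

lemma lin_ext_zero: "lin_ext f 0 = 0"
  by (simp add: fun_eq_iff lin_ext_def)

lemma lin_ext_closed:
  assumes f: "\<And>p. p \<in> qpaths G \<Longrightarrow> f p \<in> carrier A" and x: "x \<in> carrier A"
  shows "lin_ext f x \<in> carrier A"
proof (rule path_algebra_induct[OF x, of "\<lambda>x. lin_ext f x \<in> carrier A"])
  show "lin_ext f 0 \<in> carrier A" by (simp only: lin_ext_zero zero_closed)
next
  fix c p x
  assume "p \<in> qpaths G" "x \<in> carrier A" "lin_ext f x \<in> carrier A"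
  then show "lin_ext f (c \<cdot> vec p + x) \<in> carrier A"
    by (simp only: lin_ext_add lin_ext_smult lin_ext_vec vec_closed closed f)
qed

definition der_of :: "('e \<Rightarrow> ('v, 'e) qpath \<Rightarrow> 'k) \<Rightarrow> (('v, 'e) qpath \<Rightarrow> 'k) \<Rightarrow> ('v, 'e) qpath \<Rightarrow> 'k" where
  "der_of \<phi> = (\<lambda>x\<in>carrier A. lin_ext (\<lambda>p. path_der \<phi> (fst p) (snd p)) x)"

text \<open>The Leibniz rule is checked on pairs of paths (\<open>vv\<close>), then extended
  linearly in the second factor (\<open>vy\<close>) and in the first (\<open>xy\<close>).\<close>

lemma der_of_derivation:
  assumes \<phi>: "admissible \<phi>"
  shows "der_of \<phi> \<in> derivations A"
proof -
  let ?f = "\<lambda>p. path_der \<phi> (fst p) (snd p)"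
  let ?D = "lin_ext ?f"
  have f: "?f p \<in> carrier A" "?f p q \<noteq> 0 \<Longrightarrow> qtail q = qtail p" "?f p q \<noteq> 0 \<Longrightarrow> qhead G q = qhead G p"
    if "p \<in> qpaths G" for p q
  proof -
    have "awalk (fst p) (snd p) (qhead G p)" using qpathsD[of "fst p" "snd p"] that by simp
    note sup = path_der_support[OF \<phi> this]
    show "?f p \<in> carrier A" using sup by blast
    show "?f p q \<noteq> 0 \<Longrightarrow> qtail q = qtail p" "?f p q \<noteq> 0 \<Longrightarrow> qhead G q = qhead G p"
      unfolding qtail_def[of p] using sup by blast+
  qed
  note lin = mult_add_l mult_add_r mult_smult_l mult_smult_r mult_zero_l mult_zero_r
    lin_ext_add lin_ext_smult lin_ext_vec lin_ext_zero vec_closed closed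
  have vv: "?D (vec p \<star> vec q) = ?D (vec p) \<star> vec q + vec p \<star> ?D (vec q)"
    if p: "p \<in> qpaths G" and q: "q \<in> qpaths G" for p q
  proof (cases "qhead G p = qtail q")
    case True
    have "awalk (fst p) (snd p) (fst q)" "awalk (fst q) (snd q) (qhead G q)"
      using qpathsD[of "fst p" "snd p"] qpathsD[of "fst q" "snd q"] p q True by (simp_all add: qtail_def)
    from path_der_append[OF \<phi> this] have "?f (concat_path p q) = ?f p \<star> vec q + vec p \<star> ?f q"
      by (simp add: concat_path_def)
    moreover have "vec p \<star> vec q = vec (concat_path p q)" using vec_mult[OF p q] True by simp
    ultimately show ?thesis by (simp only: lin_ext_vec)
  next
    case False
    \<comment> \<open>All paths in \<open>?f p\<close> end where \<open>p\<close> ends and all paths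
      in \<open>?f q\<close> start where \<open>q\<close> starts, so these are non-composable as
      well and both Leibniz terms vanish separately.\<close>
    have "?f p \<star> vec q = 0" "vec p \<star> ?f q = 0"
      by (rule mult_vanishes; use f[OF p] f[OF q] False in \<open>auto dest!: vec_nonzero\<close>)+
    moreover have "vec p \<star> vec q = 0" using vec_mult[OF p q] False by simp
    ultimately show ?thesis by (simp only: lin_ext_vec lin_ext_zero add_0)
  qed
  have vy: "?D (vec p \<star> y) = ?D (vec p) \<star> y + vec p \<star> ?D y"
    if p: "p \<in> qpaths G" and y: "y \<in> carrier A" for p y
  proof (rule path_algebra_induct[OF y, of "\<lambda>y. ?D (vec p \<star> y) = ?D (vec p) \<star> y + vec p \<star> ?D y"])
    fix c q y
    assume q: "q \<in> qpaths G" and y: "y \<in> carrier A"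
      and IH: "?D (vec p \<star> y) = ?D (vec p) \<star> y + vec p \<star> ?D y"
    have "?D (vec p \<star> (c \<cdot> vec q + y)) = c \<cdot> ?D (vec p \<star> vec q) + ?D (vec p \<star> y)"
      using p q y by (simp only: lin)
    also have "\<dots> = c \<cdot> (?D (vec p) \<star> vec q) + c \<cdot> (vec p \<star> ?D (vec q))
        + (?D (vec p) \<star> y + vec p \<star> ?D y)"
      unfolding vv[OF p q] IH using f[OF p] f[OF q] p q by (simp only: lin smult_add_right)
    also have "\<dots> = ?D (vec p) \<star> (c \<cdot> vec q + y) + vec p \<star> ?D (c \<cdot> vec q + y)"
      using p q y by (simp only: lin add_ac)
    finally show "?D (vec p \<star> (c \<cdot> vec q + y)) =
      ?D (vec p) \<star> (c \<cdot> vec q + y) + vec p \<star> ?D (c \<cdot> vec q + y)" .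
  qed (simp only: lin add_0)
  have xy: "?D (x \<star> y) = ?D x \<star> y + x \<star> ?D y"
    if x: "x \<in> carrier A" and y: "y \<in> carrier A" for x y
  proof (rule path_algebra_induct[OF x, of "\<lambda>x. ?D (x \<star> y) = ?D x \<star> y + x \<star> ?D y"])
    fix c p x
    assume p: "p \<in> qpaths G" and x: "x \<in> carrier A"
      and IH: "?D (x \<star> y) = ?D x \<star> y + x \<star> ?D y"
    have Dy: "?D y \<in> carrier A" by (rule lin_ext_closed[OF f(1) y])
    have "?D ((c \<cdot> vec p + x) \<star> y) = c \<cdot> ?D (vec p \<star> y) + ?D (x \<star> y)"
      using p x y by (simp only: lin)
    also have "\<dots> = c \<cdot> (?D (vec p) \<star> y) + c \<cdot> (vec p \<star> ?D y)
        + (?D x \<star> y + x \<star> ?D y)"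
      unfolding vy[OF p y] IH using f[OF p] p y Dy by (simp only: lin smult_add_right)
    also have "\<dots> = ?D (c \<cdot> vec p + x) \<star> y + (c \<cdot> vec p + x) \<star> ?D y"
      using p x by (simp only: lin add_ac)
    finally show "?D ((c \<cdot> vec p + x) \<star> y) =
      ?D (c \<cdot> vec p + x) \<star> y + (c \<cdot> vec p + x) \<star> ?D y" .
  qed (simp only: lin add_0)
  show ?thesis unfolding der_of_def
    by (rule derivationI) (simp_all only: restrict_extensional restrict_apply' closed xy lin_ext_add lin_ext_smult
        lin_ext_closed[OF f(1)])
qed

text \<open>Normalized derivations: for a finite acyclic quiver every class in \<open>HH1\<close>
  has a representative here, by \<open>derivation_reduction\<close>.\<close>

definition Der0 :: "((('v, 'e) qpath \<Rightarrow> 'k) \<Rightarrow> ('v, 'e) qpath \<Rightarrow> 'k) set" where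
  "Der0 = {D \<in> derivations A. \<forall>v\<in>verts G. D (vertex v) = 0}"

lemma Der0D:
  assumes "D \<in> Der0"
  shows Der0_derivation: "D \<in> derivations A" and Der0_vertex: "v \<in> verts G \<Longrightarrow> D (vertex v) = 0"
  using assms by (auto simp: Der0_def)

text \<open>An arrow is fixed by multiplication with its tail on the left and its head on the right.
  Since \<open>D\<close> kills both vertices, the Leibniz rule shows that \<open>D (arrow e)\<close>
  is fixed by them too, hence supported on paths parallel to \<open>e\<close>.\<close>

lemma Der0_admissible:
  assumes D: "D \<in> Der0"
  shows "admissible (\<lambda>e. D (arrow e))"
  unfolding admissible_def
proof (intro ballI conjI allI impI)
  fix e assume e: "e \<in> arcs G"
  note d = Der0_derivation[OF D]
  have cl: "arrow e \<in> carrier A" "vertex (tail G e) \<in> carrier A" "vertex (head G e) \<in> carrier A"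
    using e by (simp_all add: arrow_closed vertex_closed)
  show De: "D (arrow e) \<in> carrier A" by (rule der_closed[OF d cl(1)])
  fix p assume p: "D (arrow e) p \<noteq> 0"
  have ends: "vertex (tail G e) \<star> arrow e = arrow e" "arrow e \<star> vertex (head G e) = arrow e"
    using e arrow_path[OF e] cl by (auto intro!: vertex_mult_self dest!: vec_nonzero)
  have "D (arrow e) = vertex (tail G e) \<star> D (arrow e)"
    using der_mult[OF d cl(2,1)] e by (simp add: ends Der0_vertex[OF D] mult_zero_l)
  then have "(vertex (tail G e) \<star> D (arrow e)) p \<noteq> 0" using p by simp
  then have t: "qtail p = tail G e"
    using vertex_mult(1)[of "tail G e" "D (arrow e)" p] e De by (simp split: if_splits)
  have "D (arrow e) = D (arrow e) \<star> vertex (head G e)"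
    using der_mult[OF d cl(1,3)] e by (simp add: ends Der0_vertex[OF D] mult_zero_r)
  then have "(D (arrow e) \<star> vertex (head G e)) p \<noteq> 0" using p by simp
  then have "qhead G p = head G e"
    using vertex_mult(2)[of "head G e" "D (arrow e)" p] e De by (simp split: if_splits)
  then show "parallel G p (arrow_path G e)" using t arrow_path[OF e] by (simp add: parallel_def)
qed

lemma Der0_vec:
  assumes D: "D \<in> Der0" and "awalk u es v"
  shows "D (vec (u, es)) = path_der (\<lambda>e. D (arrow e)) u es"
  using assms(2)
proof (induction es arbitrary: u)
  case Nil
  then have v: "u = v" "v \<in> verts G" by (auto simp: awalk_Nil_iff)
  show ?case unfolding v(1) path_der.simps by (rule Der0_vertex[OF D v(2)])
next
  case (Cons e es)
  note c = vec_Cons[OF Cons.prems]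
  show ?case
    unfolding c(1) path_der.simps der_mult[OF Der0_derivation[OF D] arrow_closed[OF c(2)] vec_closed[OF c(5)]]
      Cons.IH[OF c(4)] ..
qed

lemma path_der_cong: "set es \<subseteq> arcs G \<Longrightarrow> (\<And>e. e \<in> arcs G \<Longrightarrow> \<phi> e = \<psi> e) \<Longrightarrow> path_der \<phi> u es = path_der \<psi> u es"
  by (induction es arbitrary: u) auto

lemma Der0_eqI:
  assumes D: "D \<in> Der0" and E: "E \<in> Der0" and eq: "\<And>e. e \<in> arcs G \<Longrightarrow> D (arrow e) = E (arrow e)"
  shows "D = E"
proof (rule derivation_eqI[OF Der0_derivation[OF D] Der0_derivation[OF E]])
  fix x assume x: "x \<in> carrier A"
  show "D x = E x"
  proof (rule linear_eqI[OF _ _ _ _ _ x])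
    fix p assume p: "p \<in> qpaths G"
    have w: "awalk (fst p) (snd p) (qhead G p)" using qpathsD[of "fst p" "snd p"] p by simp
    then have "set (snd p) \<subseteq> arcs G" by auto
    then show "D (vec p) = E (vec p)"
      using Der0_vec[OF D w] Der0_vec[OF E w] path_der_cong[OF _ eq] by simp
  qed (simp_all add: der_add der_smult Der0_derivation[OF D] Der0_derivation[OF E] del: plus_fun_apply)
qed

lemma der_of_Der0:
  assumes \<phi>: "admissible \<phi>"
  shows "der_of \<phi> \<in> Der0" "e \<in> arcs G \<Longrightarrow> der_of \<phi> (arrow e) = \<phi> e"
proof -
  have vec: "der_of \<phi> (vec (u, es)) = path_der \<phi> u es" if "(u, es) \<in> qpaths G" for u es
    using vec_closed[OF that] by (simp add: der_of_def lin_ext_vec)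
  then show "der_of \<phi> \<in> Der0"
    using der_of_derivation[OF \<phi>] by (simp add: Der0_def trivial_path)
  assume e: "e \<in> arcs G"
  have "der_of \<phi> (arrow e) = \<phi> e \<star> vertex (head G e)"
    using vec[of "tail G e" "[e]"] arrow_path(1)[OF e] by (simp add: arrow_path_def mult_zero_r)
  also have "\<dots> = \<phi> e"
    using admissibleD[OF \<phi> e] e by (intro vertex_mult_self) auto
  finally show "der_of \<phi> (arrow e) = \<phi> e" .
qed

text \<open>This justifies the definite description: \<open>der_of\<close> gives existence,
  \<open>Der0_eqI\<close> uniqueness.\<close>

lemma arrow_derivation_eq:
  assumes \<phi>: "admissible \<phi>"
  shows "arrow_derivation G \<phi> = der_of \<phi>"
  unfolding arrow_derivation_def
proof (rule the_equality)
  show "der_of \<phi> \<in> derivations A \<and> (\<forall>v\<in>verts G. der_of \<phi> (vertex v) = (\<lambda>_. 0)) \<and>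
      (\<forall>e\<in>arcs G. der_of \<phi> (arrow e) = \<phi> e)"
    using der_of_Der0[OF \<phi>] by (auto simp: Der0_def zero_fun_def)
next
  fix D assume "D \<in> derivations A \<and> (\<forall>v\<in>verts G. D (vertex v) = (\<lambda>_. 0)) \<and> (\<forall>e\<in>arcs G. D (arrow e) = \<phi> e)"
  then show "D = der_of \<phi>"
    using der_of_Der0[OF \<phi>] by (intro Der0_eqI) (auto simp: Der0_def zero_fun_def)
qed

lemma arrow_derivation_Der0:
  assumes "admissible \<phi>"
  shows "arrow_derivation G \<phi> \<in> Der0" "e \<in> arcs G \<Longrightarrow> arrow_derivation G \<phi> (arrow e) = \<phi> e"
  using der_of_Der0[OF assms] arrow_derivation_eq[OF assms] by simp_all

text \<open>By the Leibniz rule the weights of the arrows add up along a path. This is the source of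
  the sum over the arrows of \<open>s\<close> in the eigenvalue.\<close>

lemma Der0_diagonal_vec:
  assumes D: "D \<in> Der0" and x: "\<And>e. e \<in> arcs G \<Longrightarrow> D (arrow e) = x e \<cdot> arrow e" and "awalk u es v"
  shows "D (vec (u, es)) = (\<Sum>e\<leftarrow>es. x e) \<cdot> vec (u, es)"
  using assms(3)
proof (induction es arbitrary: u)
  case Nil
  then have "D (vertex v) = 0 \<cdot> vertex v" "u = v"
    using Der0_vertex[OF D] smult_zero_left[OF vertex_closed] by (auto simp: awalk_Nil_iff)
  then show ?case by simp
next
  case (Cons e es)
  note c = vec_Cons[OF Cons.prems]
  note cl = arrow_closed[OF c(2)] vec_closed[OF c(5)]
  show ?case
    unfolding c(1) der_mult[OF Der0_derivation[OF D] cl] Cons.IH[OF c(4)] x[OF c(2)]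
    using cl by (simp add: mult_smult_l mult_smult_r smult_add_left closed)
qed

lemma Der0_add: "D \<in> Der0 \<Longrightarrow> E \<in> Der0 \<Longrightarrow> D \<oplus>\<^bsub>Der A\<^esub> E \<in> Der0"
  and Der0_smult: "D \<in> Der0 \<Longrightarrow> c \<odot>\<^bsub>Der A\<^esub> D \<in> Der0"
  and Der0_zero: "\<zero>\<^bsub>Der A\<^esub> \<in> Der0"
  by (simp_all add: Der0_def Der_simps Der_closed vertex_closed smult_zero_right)

lemma Der0_bracket: "D \<in> Der0 \<Longrightarrow> E \<in> Der0 \<Longrightarrow> D \<otimes>\<^bsub>Der A\<^esub> E \<in> Der0"
  by (simp add: Der0_def Der_bracket Der_bracket_closed vertex_closed der_zero)

lemma Der0_diff:
  assumes D: "D \<in> Der0" and E: "E \<in> Der0"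
  shows "(\<lambda>x\<in>carrier A. D x - E x) \<in> Der0"
proof -
  have "(\<lambda>x\<in>carrier A. D x - E x) = D \<oplus>\<^bsub>Der A\<^esub> ((- 1) \<odot>\<^bsub>Der A\<^esub> E)"
    using Der0_derivation[OF E] by (auto simp: Der_simps smult_minus_one der_closed intro!: restrict_ext)
  then show ?thesis using Der0_add[OF D Der0_smult[OF E]] by simp
qed

lemmas Der0_closed = Der0_add Der0_smult Der0_zero Der0_bracket Der0_diff

lemma Der_arrow:
  assumes "e \<in> arcs G"
  shows "(D \<oplus>\<^bsub>Der A\<^esub> E) (arrow e) = D (arrow e) + E (arrow e)"
    "(c \<odot>\<^bsub>Der A\<^esub> D) (arrow e) = c \<cdot> D (arrow e)"
    "\<zero>\<^bsub>Der A\<^esub> (arrow e) = 0"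
  using arrow_closed[OF assms] by (simp_all add: Der_simps)

section \<open>The span of the derivations of almost oriented cycles\<close>

lemma D_rs_Der0:
  assumes r: "r \<in> arcs G" "s \<in> qpaths G" "parallel G s (arrow_path G r)"
  shows "D_rs G r s \<in> Der0" "e \<in> arcs G \<Longrightarrow> D_rs G r s (arrow e) = (if e = r then vec s else 0)"
proof -
  have z: "(\<lambda>_. 0) = (0 :: ('v, 'e) qpath \<Rightarrow> 'k)" by (simp add: zero_fun_def)
  have "admissible (\<lambda>q. if q = r then vec s else 0)"
    using r vec_closed zero_closed by (auto simp: admissible_def dest!: vec_nonzero)
  from arrow_derivation_Der0[OF this]
  show "D_rs G r s \<in> Der0" "e \<in> arcs G \<Longrightarrow> D_rs G r s (arrow e) = (if e = r then vec s else 0)"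
    unfolding D_rs_def z by auto
qed

text \<open>A description of \<open>D_AL G\<close> without spans, see \<open>D_AL_eq\<close>:
  membership is tested on single coefficients.\<close>

definition AL_der :: "((('v, 'e) qpath \<Rightarrow> 'k) \<Rightarrow> ('v, 'e) qpath \<Rightarrow> 'k) set" where
  "AL_der = {D \<in> Der0. \<forall>e\<in>arcs G. D (arrow e) (arrow_path G e) = 0}"

lemma AL_der_subspace: "linear_subspace (Der A) AL_der"
proof (rule linear_subspaceI[OF module_Der])
  show "AL_der \<subseteq> carrier (Der A)" by (auto simp: AL_der_def Der0_def Der_simps)
  show "\<zero>\<^bsub>Der A\<^esub> \<in> AL_der" by (simp add: AL_der_def Der0_closed Der_arrow)
  show "D \<oplus>\<^bsub>Der A\<^esub> E \<in> AL_der" if "D \<in> AL_der" "E \<in> AL_der" for D E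
    using that by (simp add: AL_der_def Der0_closed Der_arrow)
  show "c \<odot>\<^bsub>Der A\<^esub> D \<in> AL_der" if "D \<in> AL_der" for c D
    using that by (simp add: AL_der_def Der0_closed Der_arrow smult_apply)
qed

lemma D_rs_AL_der:
  assumes "(r, s) \<in> almost_oriented_cycles G"
  shows "D_rs G r s \<in> AL_der"
  using assms D_rs_Der0[of r s] by (auto simp: almost_oriented_cycles_def AL_der_def path_vec_def)

text \<open>The pairs in the support of \<open>D\<close> are removed one by one by subtracting
  multiples of \<open>D_rs\<close>. \<open>S\<close> only has to contain the support, so that the
  induction also passes through pairs at which \<open>D\<close> vanishes. \<open>W\<close> is
  arbitrary because the span is an intersection of subspaces.\<close>

lemma AL_der_in_span:
  assumes W: "linear_subspace (Der A) W" and gens: "\<And>r s. (r, s) \<in> almost_oriented_cycles G \<Longrightarrow> D_rs G r s \<in> W"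
    and "finite S" "D \<in> AL_der" "\<And>e s. e \<in> arcs G \<Longrightarrow> D (arrow e) s \<noteq> 0 \<Longrightarrow> (e, s) \<in> S"
  shows "D \<in> W"
  using assms(3-5)
proof (induction S arbitrary: D rule: finite_induct)
  case empty
  then have D0: "D \<in> Der0" by (simp add: AL_der_def)
  have "D = \<zero>\<^bsub>Der A\<^esub>"
  proof (rule Der0_eqI[OF D0])
    show "\<zero>\<^bsub>Der A\<^esub> \<in> Der0" by (rule Der0_zero)
    fix e assume e: "e \<in> arcs G"
    then have "D (arrow e) s = 0" for s using empty.prems(2)[OF e, of s] by auto
    then show "D (arrow e) = \<zero>\<^bsub>Der A\<^esub> (arrow e)" by (simp add: Der_arrow[OF e] fun_eq_iff)
  qed
  then show ?case using linear_subspace_zero[OF W] by simp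
next
  case (insert es S)
  obtain e s where es: "es = (e, s)" by (rule prod.exhaust)
  have D0: "D \<in> Der0" using insert.prems(1) by (simp add: AL_der_def)
  show ?case
  proof (cases "e \<in> arcs G \<and> D (arrow e) s \<noteq> 0")
    case False
    then show ?thesis using insert.IH[OF insert.prems(1)] insert.prems(2) es by blast
  next
    case True
    define c where "c = D (arrow e) s"
    have par: "parallel G s (arrow_path G e)"
      using Der0_admissible[OF D0] True unfolding admissible_def by blast
    have s: "s \<in> qpaths G" using carrierD[of "D (arrow e)" s] True der_closed[OF Der0_derivation[OF D0]] arrow_closed by blast
    have ne: "s \<noteq> arrow_path G e" using insert.prems(1) True by (auto simp: AL_der_def)
    have mem: "(e, s) \<in> almost_oriented_cycles G" using True s ne par by (simp add: almost_oriented_cycles_def)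
    define D' where "D' = D \<oplus>\<^bsub>Der A\<^esub> ((- c) \<odot>\<^bsub>Der A\<^esub> D_rs G e s)"
    have "D_rs G e s \<in> AL_der" by (rule D_rs_AL_der[OF mem])
    then have D': "D' \<in> AL_der" unfolding D'_def
      using insert.prems(1) linear_subspace_add[OF AL_der_subspace] linear_subspace_smult[OF AL_der_subspace] by blast
    have val: "D' (arrow a) p = D (arrow a) p - c * (if a = e \<and> p = s then 1 else 0)" if "a \<in> arcs G" for a p
    proof -
      have "vec s p = (if p = s then 1 else 0)" by (simp add: path_vec_def)
      then show ?thesis
        using D_rs_Der0(2)[of e s a] True s par that
        by (cases "a = e") (simp_all add: D'_def Der_arrow smult_apply)
    qed
    have "D' \<in> W"
    proof (rule insert.IH[OF D'])
      fix a p assume a: "a \<in> arcs G" "D' (arrow a) p \<noteq> 0"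
      have "(a, p) \<noteq> (e, s)" using a val[OF a(1), of p] by (auto simp: c_def)
      then have "D (arrow a) p \<noteq> 0" using a val[OF a(1), of p] by (auto split: if_splits)
      then show "(a, p) \<in> S" using insert.prems(2)[OF a(1)] \<open>(a, p) \<noteq> (e, s)\<close> es by blast
    qed
    moreover have "D = D' \<oplus>\<^bsub>Der A\<^esub> (c \<odot>\<^bsub>Der A\<^esub> D_rs G e s)"
    proof (rule Der0_eqI[OF D0])
      have R: "D_rs G e s \<in> Der0" using True s par by (intro D_rs_Der0) auto
      have "D' \<in> Der0" using D' by (simp add: AL_der_def)
      then show "D' \<oplus>\<^bsub>Der A\<^esub> (c \<odot>\<^bsub>Der A\<^esub> D_rs G e s) \<in> Der0" by (intro Der0_closed R)
      fix a assume a: "a \<in> arcs G"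
      show "D (arrow a) = (D' \<oplus>\<^bsub>Der A\<^esub> (c \<odot>\<^bsub>Der A\<^esub> D_rs G e s)) (arrow a)"
        by (simp add: D'_def Der_arrow[OF a] fun_eq_iff smult_apply)
    qed
    moreover have "c \<odot>\<^bsub>Der A\<^esub> D_rs G e s \<in> W" by (rule linear_subspace_smult[OF W gens[OF mem]])
    ultimately show ?thesis using linear_subspace_add[OF W] by metis
  qed
qed

end

section \<open>Acyclic quivers: inner derivations and the filtration by path length\<close>

locale acyclic_quiver_algebra = quiver_algebra G field_type + fin_digraph G
  for G :: "('v, 'e) pre_digraph" and field_type :: "'k::field itself" +
  assumes acyclic: "acyclic_quiver G"
begin

lemma closed_path_trivial:
  assumes "p \<in> qpaths G" "qtail p = qhead G p"
  shows "snd p = []"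
proof (rule ccontr)
  assume ne: "snd p \<noteq> []"
  have "awalk (fst p) (snd p) (fst p)"
    using qpathsD[of "fst p" "snd p"] assms by (simp add: qtail_def)
  then have "closed_w (snd p)" using ne by (auto simp: closed_w_def)
  then show False using closed_w_imp_cycle acyclic by (auto simp: acyclic_quiver_def)
qed

lemma arrow_not_loop: "e \<in> arcs G \<Longrightarrow> tail G e \<noteq> head G e"
  using closed_path_trivial[of "arrow_path G e"] arrow_path[of e] by (auto simp: arrow_path_def)

lemma D_AL_eq: "D_AL G = AL_der"
proof
  show "D_AL G \<subseteq> AL_der" unfolding D_AL_def
    by (rule linear_span_minimal[OF AL_der_subspace]) (auto intro: D_rs_AL_der)
  show "AL_der \<subseteq> D_AL G"
  proof
    fix D assume D: "D \<in> AL_der"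
    have fin: "finite {s. D (arrow e) s \<noteq> 0}" if "e \<in> arcs G" for e
    proof -
      have "D (arrow e) \<in> carrier A"
        using D arrow_closed[OF that] by (auto simp: AL_der_def intro: der_closed Der0_derivation)
      then show ?thesis by (simp add: carrier_iff)
    qed
    have "finite (SIGMA e:arcs G. {s. D (arrow e) s \<noteq> 0})" using fin by (intro finite_SigmaI) auto
    then show "D \<in> D_AL G" unfolding D_AL_def linear_span_def
      by (intro InterI) (auto intro!: AL_der_in_span[OF _ _ _ D])
  qed
qed

text \<open>If the inner derivation of \<open>a\<close> kills all vertices, then \<open>a\<close>
  commutes with them and is supported on closed paths. These are trivial by acyclicity, so
  \<open>a\<close> is a combination of vertices and acts on an arrow by a difference of two
  coefficients, that is, by a cut.\<close>

lemma inner_Der0_arrow: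
  assumes a: "a \<in> carrier A" and D: "inner_derivation A a \<in> Der0" and e: "e \<in> arcs G"
  shows "inner_derivation A a (arrow e) = (a (tail G e, []) - a (head G e, [])) \<cdot> arrow e"
proof -
  have triv: "snd p = []" if p: "a p \<noteq> 0" for p
  proof (rule closed_path_trivial)
    show pq: "p \<in> qpaths G" by (rule carrierD[OF a p])
    let ?v = "qtail p"
    have v: "?v \<in> verts G" using qpath_ends[OF pq] by simp
    \<comment> \<open>The second product has coefficient \<open>a p\<close> at \<open>p\<close>, the
      first has it only if \<open>p\<close> also ends at \<open>?v\<close>.\<close>
    have "(a \<star> vertex ?v - vertex ?v \<star> a) p = 0"
      using Der0_vertex[OF D v] vertex_closed[OF v] by (simp add: inner_derivation_eq[OF a])
    then show "qtail p = qhead G p" using p vertex_mult[OF v a, of p] by (simp split: if_splits)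
  qed
  show ?thesis
  proof
    fix r
    have "inner_derivation A a (arrow e) r = (a \<star> arrow e) r - (arrow e \<star> a) r"
      using arrow_closed[OF e] by (simp add: inner_derivation_eq[OF a])
    also have "\<dots> = a (qtail r, []) * arrow e r - arrow e r * a (qhead G r, [])"
      using vertex_mult_left[OF triv a arrow_closed[OF e]] vertex_mult_right[OF triv a arrow_closed[OF e]] by simp
    also have "\<dots> = ((a (tail G e, []) - a (head G e, [])) \<cdot> arrow e) r"
      using arrow_path[OF e] by (auto simp: smult_apply path_vec_def)
    finally show "inner_derivation A a (arrow e) r = \<dots>" .
  qed
qed

text \<open>Converse of \<open>inner_Der0_arrow\<close>: the cut of \<open>\<phi>\<close> comes from
  the combination of vertices with coefficients \<open>\<phi>\<close>.\<close>

lemma coboundary_inner: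
  obtains a where "a \<in> carrier A" "inner_derivation A a \<in> Der0"
    "\<And>e. e \<in> arcs G \<Longrightarrow> inner_derivation A a (arrow e) = (\<phi> (tail G e) - \<phi> (head G e)) \<cdot> arrow e"
proof -
  define a :: "('v, 'e) qpath \<Rightarrow> 'k" where "a p = (if snd p = [] \<and> fst p \<in> verts G then \<phi> (fst p) else 0)" for p
  have triv: "snd p = []" "p \<in> (\<lambda>v. (v, [])) ` verts G" if "a p \<noteq> 0" for p
    using that by (auto simp: a_def image_iff prod_eq_iff split: if_splits)
  then have "{p. a p \<noteq> 0} \<subseteq> (\<lambda>v. (v, [])) ` verts G" by blast
  then have "finite {p. a p \<noteq> 0}" by (rule finite_subset) simp
  moreover have "p \<in> qpaths G" if "a p \<noteq> 0" for p using triv(2)[OF that] trivial_path(1) by auto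
  ultimately have a: "a \<in> carrier A" unfolding carrier_iff by blast
  have D: "inner_derivation A a \<in> Der0" unfolding Der0_def
  proof (intro CollectI conjI ballI inner_derivation_derivation a)
    fix v assume v: "v \<in> verts G"
    show "inner_derivation A a (vertex v) = 0"
    proof
      fix r
      have "inner_derivation A a (vertex v) r = a (qtail r, []) * vertex v r - vertex v r * a (qhead G r, [])"
        using vertex_mult_left[OF triv(1) a vertex_closed[OF v], of r]
          vertex_mult_right[OF triv(1) a vertex_closed[OF v], of r] vertex_closed[OF v]
        by (simp add: inner_derivation_eq[OF a])
      also have "\<dots> = 0" using trivial_path(2)[of v] by (auto simp: path_vec_def trivial_path(3))
      finally show "inner_derivation A a (vertex v) r = 0 r" by simp
    qed
  qed
  show thesis
  proof (rule that[OF a D])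
    fix e assume e: "e \<in> arcs G"
    show "inner_derivation A a (arrow e) = (\<phi> (tail G e) - \<phi> (head G e)) \<cdot> arrow e"
      using inner_Der0_arrow[OF a D e] e by (simp add: a_def)
  qed
qed

text \<open>The witness below is the sum of the products of \<open>D (vertex v)\<close> and \<open>vertex v\<close> over all vertices \<open>v\<close>.\<close>

lemma derivation_reduction:
  assumes D: "D \<in> derivations A"
  obtains a where "a \<in> carrier A" "(\<lambda>x\<in>carrier A. D x - inner_derivation A a x) \<in> Der0"
proof -
  define a where "a p = (if p \<in> qpaths G then D (vertex (qhead G p)) p else 0)" for p
  have cl: "D (vertex v) \<in> carrier A" if "v \<in> verts G" for v
    by (rule der_closed[OF D vertex_closed[OF that]])
  have "{p. a p \<noteq> 0} \<subseteq> (\<Union>v\<in>verts G. {p. D (vertex v) p \<noteq> 0})"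
    using qpath_ends by (auto simp: a_def split: if_splits)
  moreover have "finite (\<Union>v\<in>verts G. {p. D (vertex v) p \<noteq> 0})"
    using cl by (intro finite_UN_I finite_verts) (auto simp: carrier_iff)
  ultimately have "finite {p. a p \<noteq> 0}" by (rule finite_subset)
  moreover have "\<forall>p. a p \<noteq> 0 \<longrightarrow> p \<in> qpaths G" unfolding a_def by presburger
  ultimately have a: "a \<in> carrier A" unfolding carrier_iff by blast
  have van: "D (vertex w) - inner_derivation A a (vertex w) = 0" if w: "w \<in> verts G" for w
  proof
    fix r
    have eq: "inner_derivation A a (vertex w) r = (if qhead G r = w then a r else 0) - (if qtail r = w then a r else 0)"
      using vertex_closed[OF w] vertex_mult[OF w a, of r] by (simp add: inner_derivation_eq[OF a])
    show "(D (vertex w) - inner_derivation A a (vertex w)) r = 0 r"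
    proof (cases "r \<in> qpaths G")
      case False
      then have "D (vertex w) r = 0" using carrierD[OF cl[OF w]] by blast
      then show ?thesis using False eq by (simp add: a_def)
    next
      case True
      define h where "h = qhead G r"
      have h: "h \<in> verts G" using qpath_ends[OF True] by (simp add: h_def)
      have ar: "a r = D (vertex h) r" using True by (simp add: a_def h_def)
      \<comment> \<open>Used for \<open>v = w\<close>, where the product is idempotent, and for
        \<open>v = h\<close> different from \<open>w\<close>, where it is 0. The first shows that
        \<open>D (vertex w)\<close> has no coefficient at closed paths at \<open>w\<close>, the
        second that it is minus \<open>D (vertex h)\<close> at paths from \<open>w\<close> to
        \<open>h\<close>.\<close>
      have prod: "D (vertex w \<star> vertex v) r =
          (if h = v then D (vertex w) r else 0) + (if qtail r = w then D (vertex v) r else 0)" if v: "v \<in> verts G" for v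
        using der_mult[OF D vertex_closed[OF w] vertex_closed[OF v]]
          vertex_mult(2)[OF v cl[OF w], of r] vertex_mult(1)[OF w cl[OF v], of r] by (simp add: h_def)
      show ?thesis
      proof (cases "h = w")
        case eqw: True
        have "vertex w \<star> vertex w = vertex w"
          using vec_mult[of "(w, [])" "(w, [])"] w by (simp add: trivial_path concat_path_def)
        then have "D (vertex w) r = D (vertex w) r + (if qtail r = w then D (vertex w) r else 0)"
          using prod[OF w] eqw by simp
        then show ?thesis using eq ar eqw by (auto simp: h_def split: if_splits)
      next
        case False
        have "vertex w \<star> vertex h = 0"
          using vec_mult[of "(w, [])" "(h, [])"] w h False by (simp add: trivial_path)
        then have "D (vertex w) r + (if qtail r = w then D (vertex h) r else 0) = 0"
          using prod[OF h] der_zero[OF D] by simp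
        then show ?thesis using eq ar False by (auto simp: h_def add_eq_0_iff2 split: if_splits)
      qed
    qed
  qed
  have "(\<lambda>x\<in>carrier A. D x - inner_derivation A a x) \<in> derivations A"
  proof -
    interpret abelian_group "Der A" by (rule abelian_group_Der)
    have "D \<ominus>\<^bsub>Der A\<^esub> inner_derivation A a \<in> carrier (Der A)"
      using D inner_derivation_derivation[OF a] by (intro minus_closed) (simp_all add: Der_simps(1))
    then show ?thesis by (simp add: Der_minus[OF D inner_derivation_derivation[OF a]] Der_simps(1))
  qed
  then have "(\<lambda>x\<in>carrier A. D x - inner_derivation A a x) \<in> Der0"
    using van vertex_closed by (simp add: Der0_def del: minus_apply)
  then show thesis using a that by blast
qed

text \<open>On the carrier, membership in the \<open>n\<close>-th power of the ideal generated by
  the arrows.\<close>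

definition min_length :: "nat \<Rightarrow> (('v, 'e) qpath \<Rightarrow> 'k) \<Rightarrow> bool" where
  "min_length n x \<longleftrightarrow> (\<forall>p. x p \<noteq> 0 \<longrightarrow> n \<le> length (snd p))"

lemma min_length_mult:
  assumes "min_length m x" "min_length n y"
  shows "min_length (m + n) (x \<star> y)"
  unfolding min_length_def
proof (intro allI impI)
  fix r assume "(x \<star> y) r \<noteq> 0"
  then obtain p q where pq: "r = concat_path p q" "x p \<noteq> 0" "y q \<noteq> 0" by (rule mult_nonzero)
  then have "m \<le> length (snd p)" "n \<le> length (snd q)" using assms unfolding min_length_def by blast+
  then show "m + n \<le> length (snd r)" by (simp add: pq(1) concat_path_def)
qed

lemma min_length_add: "min_length n x \<Longrightarrow> min_length n y \<Longrightarrow> min_length n (x + y)"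
  unfolding min_length_def by (metis add_0 plus_fun_apply)

lemma min_length_smult: "min_length n x \<Longrightarrow> min_length n (c \<cdot> x)"
  unfolding min_length_def smult_apply by (simp only: mult_eq_0_iff de_Morgan_disj) blast

lemma min_length_vec: "min_length (length (snd p)) (vec p)"
  by (auto simp: min_length_def dest: vec_nonzero)

lemma Der0_arrow_parallel:
  assumes D: "D \<in> Der0" and e: "e \<in> arcs G" and p: "D (arrow e) p \<noteq> 0"
  shows "p \<in> qpaths G" "qtail p = tail G e" "qhead G p = head G e"
  using admissibleD[OF Der0_admissible[OF D] e] p carrierD by blast+

text \<open>A trivial path parallel to an arrow would make the arrow a loop.\<close>

lemma Der0_arrow_min_length: "D \<in> Der0 \<Longrightarrow> e \<in> arcs G \<Longrightarrow> min_length 1 (D (arrow e))"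
  unfolding min_length_def
proof (intro allI impI)
  fix p assume D: "D \<in> Der0" and e: "e \<in> arcs G" and p: "D (arrow e) p \<noteq> 0"
  note par = Der0_arrow_parallel[OF D e p]
  have "snd p \<noteq> []"
  proof
    assume "snd p = []"
    then have "p = (qtail p, [])" by (simp add: qtail_def prod_eq_iff)
    then have "qhead G p = qtail p" using trivial_path(2)[of "qtail p"] by metis
    then show False using par arrow_not_loop[OF e] by simp
  qed
  then show "1 \<le> length (snd p)" by (simp add: Suc_le_eq)
qed

lemma Der0_min_length_vec:
  assumes D: "D \<in> Der0" and "awalk u es v"
  shows "min_length (length es) (D (vec (u, es)))"
  using assms(2)
proof (induction es arbitrary: u)
  case Nil
  then show ?case by (simp add: min_length_def)
next
  case (Cons e es)
  note c = vec_Cons[OF Cons.prems]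
  have split: "D (vec (u, e # es)) = D (arrow e) \<star> vec (head G e, es) + arrow e \<star> D (vec (head G e, es))"
    unfolding c(1) by (rule der_mult[OF Der0_derivation[OF D] arrow_closed[OF c(2)] vec_closed[OF c(5)]])
  have "min_length (1 + length es) (D (arrow e) \<star> vec (head G e, es))"
    using min_length_vec[of "(head G e, es)"] by (intro min_length_mult Der0_arrow_min_length D c(2)) simp
  moreover have "min_length (1 + length es) (arrow e \<star> D (vec (head G e, es)))"
    using min_length_vec[of "arrow_path G e"] by (intro min_length_mult Cons.IH[OF c(4)]) (simp add: arrow_path_def)
  ultimately have "min_length (1 + length es) (D (vec (u, e # es)))" unfolding split by (rule min_length_add)
  then show ?case by simp
qed

text \<open>Derivations that kill the vertices respect the length filtration, because they cannot
  shorten an arrow.\<close>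

lemma Der0_min_length:
  assumes D: "D \<in> Der0" and x: "x \<in> carrier A" and len: "min_length n x"
  shows "min_length n (D x)"
proof -
  have "min_length n x \<longrightarrow> min_length n (D x)"
  proof (rule path_algebra_induct[OF x, of "\<lambda>x. min_length n x \<longrightarrow> min_length n (D x)"])
    have "min_length n (D 0)" unfolding der_zero[OF Der0_derivation[OF D]] by (simp add: min_length_def)
    then show "min_length n 0 \<longrightarrow> min_length n (D 0)" by blast
  next
    fix c :: 'k and p x
    assume p: "p \<in> qpaths G" and x: "x \<in> carrier A" "x p = 0" "c \<noteq> 0"
      and IH: "min_length n x \<longrightarrow> min_length n (D x)"
    show "min_length n (c \<cdot> vec p + x) \<longrightarrow> min_length n (D (c \<cdot> vec p + x))"
    proof
      assume m: "min_length n (c \<cdot> vec p + x)"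
      \<comment> \<open>As \<open>x p = 0\<close>, no terms cancel and both summands inherit the
        length bound of the sum.\<close>
      have val: "(c \<cdot> vec p + x) q = (if q = p then c else x q)" for q
        using x(2) by (simp add: smult_apply path_vec_def)
      have "n \<le> length (snd p)" using m val[of p] x(3) unfolding min_length_def by metis
      moreover have "awalk (fst p) (snd p) (qhead G p)" using qpathsD[of "fst p" "snd p"] p by simp
      then have "min_length (length (snd p)) (D (vec p))" using Der0_min_length_vec[OF D] by fastforce
      ultimately have "min_length n (D (vec p))" unfolding min_length_def by (meson order_trans)
      moreover have "min_length n x"
        unfolding min_length_def
      proof (intro allI impI)
        fix q assume "x q \<noteq> 0"
        then have "(c \<cdot> vec p + x) q \<noteq> 0" using val[of q] x(2) by auto
        then show "n \<le> length (snd q)" using m unfolding min_length_def by blast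
      qed
      moreover have "D (c \<cdot> vec p + x) = c \<cdot> D (vec p) + D x"
        using p x(1) by (simp only: der_add der_smult Der0_derivation[OF D] vec_closed closed)
      ultimately show "min_length n (D (c \<cdot> vec p + x))"
        using IH min_length_add min_length_smult by simp
    qed
  qed
  then show ?thesis using len by simp
qed

text \<open>
  This fails for two parallel arrows: the bracket of the derivations that replace one of them by the other is
  diagonal.
\<close>

lemma AL_der_ideal:
  assumes multi: "nomulti_digraph G" and D: "D \<in> Der0" and E: "E \<in> AL_der"
  shows "D \<otimes>\<^bsub>Der A\<^esub> E \<in> AL_der"
proof -
  have E0: "E \<in> Der0" using E by (simp add: AL_der_def)
  note d = Der0_derivation[OF D] Der0_derivation[OF E0]
  \<comment> \<open>A path of length 1 parallel to \<open>e\<close> is an arrow with the ends of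
    \<open>e\<close>, which is \<open>e\<close> itself because parallel arrows are excluded.\<close>
  have long: "2 \<le> length (snd p)" if D: "D \<in> Der0" and e: "e \<in> arcs G" and p: "D (arrow e) p \<noteq> 0"
    and ne: "p \<noteq> arrow_path G e" for D e p
  proof (rule ccontr)
    assume short: "\<not> 2 \<le> length (snd p)"
    have "1 \<le> length (snd p)" using Der0_arrow_min_length[OF D e] p unfolding min_length_def by blast
    with short have "length (snd p) = 1" by simp
    then obtain f where f: "snd p = [f]" by (auto simp: length_Suc_conv)
    note par = Der0_arrow_parallel[OF D e p]
    have "awalk (fst p) (snd p) (qhead G p)" using qpathsD[of "fst p" "snd p"] par(1) by simp
    then have "awalk (fst p) [f] (qhead G p)" by (simp only: f)
    then have "f \<in> arcs G" "tail G f = fst p" "head G f = qhead G p" by (auto simp: awalk_simps)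
    then have "f = e"
      using par e multi by (intro nomulti_digraph.no_multi_arcs[OF multi]) (auto simp: arc_to_ends_def qtail_def)
    then show False using ne f \<open>tail G f = fst p\<close> by (simp add: arrow_path_def prod_eq_iff)
  qed
  have short: "x (arrow_path G e) = 0" if "min_length 2 x" for x e
    using that by (fastforce simp: min_length_def arrow_path_def)
  have "(D \<otimes>\<^bsub>Der A\<^esub> E) (arrow e) (arrow_path G e) = 0" if e: "e \<in> arcs G" for e
  proof -
    have cl: "arrow e \<in> carrier A" "D (arrow e) \<in> carrier A" "E (arrow e) \<in> carrier A"
      using arrow_closed[OF e] d by (auto intro: der_closed)
    have Ez: "E (arrow e) (arrow_path G e) = 0" using E e by (simp add: AL_der_def)
    then have "min_length 2 (E (arrow e))" unfolding min_length_def
      by (intro allI impI) (rule long[OF E0 e], auto)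
    then have "min_length 2 (D (E (arrow e)))" by (rule Der0_min_length[OF D cl(3)])
    then have 1: "D (E (arrow e)) (arrow_path G e) = 0" by (rule short)
    \<comment> \<open>Up to the multiple \<open>c\<close> of \<open>arrow e\<close>, the value
      \<open>D (arrow e)\<close> has length at least 2, and \<open>E\<close> keeps it there. So only
      \<open>c \<cdot> E (arrow e)\<close> could contribute at \<open>e\<close>, and its coefficient
      is 0.\<close>
    define c where "c = D (arrow e) (arrow_path G e)"
    define y where "y = D (arrow e) - c \<cdot> arrow e"
    have y: "y \<in> carrier A" using cl by (simp add: y_def closed)
    have "min_length 2 y" unfolding min_length_def
    proof (intro allI impI)
      fix p assume p: "y p \<noteq> 0"
      have "p \<noteq> arrow_path G e" using p by (auto simp: y_def c_def smult_apply path_vec_def)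
      moreover from this have "D (arrow e) p \<noteq> 0" using p by (simp add: y_def smult_apply path_vec_def)
      ultimately show "2 \<le> length (snd p)" by (intro long[OF D e])
    qed
    then have "min_length 2 (E y)" by (rule Der0_min_length[OF E0 y])
    then have 2: "E y (arrow_path G e) = 0" by (rule short)
    have "D (arrow e) = c \<cdot> arrow e + y" by (simp add: y_def)
    then have "E (D (arrow e)) = c \<cdot> E (arrow e) + E y"
      using cl y by (simp only: der_add[OF d(2)] der_smult[OF d(2)] closed)
    then have "E (D (arrow e)) (arrow_path G e) = 0" using Ez 2 by (simp add: smult_apply)
    then show ?thesis using 1 cl by (simp add: Der_bracket[OF d])
  qed
  then show ?thesis using Der0_bracket[OF D E0] by (simp add: AL_der_def)
qed

end

section \<open>The two sides of an arc\<close>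

text \<open>\<open>s1\<close> is the last parameter before \<open>t\<close>, and \<open>s2\<close>
  the first after \<open>t\<close>, at distance at least \<open>\<rho>\<close> from
  \<open>g t\<close>. They exist by compactness, as the ends of the arc lie outside the
  disc.\<close>

lemma crosscut_of_ball:
  fixes g :: "real \<Rightarrow> complex"
  assumes g: "arc g" and t: "0 < t" "t < 1"
    and \<rho>: "0 < \<rho>" "g 0 \<notin> cball (g t) \<rho>" "g 1 \<notin> cball (g t) \<rho>"
  obtains s1 s2 where "0 < s1" "s1 < t" "t < s2" "s2 < 1"
    "g s1 \<in> sphere (g t) \<rho>" "g s2 \<in> sphere (g t) \<rho>"
    "\<And>s. s1 < s \<Longrightarrow> s < s2 \<Longrightarrow> g s \<in> ball (g t) \<rho>"
proof -
  have cont: "continuous_on {0..1} g"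
    using g by (simp add: arc_def path_def)
  define d where "d s = dist (g t) (g s)" for s
  have cd: "continuous_on {0..1} d"
    unfolding d_def by (intro continuous_intros cont)
  define A where "A = {0..t} \<inter> d -` {\<rho>..}"
  define B where "B = {t..1} \<inter> d -` {\<rho>..}"
  have "continuous_on {0..t} d" "continuous_on {t..1} d"
    using cd t by (auto elim: continuous_on_subset)
  then have "closed A" "closed B"
    unfolding A_def B_def
    by (auto intro!: continuous_closed_preimage)
  moreover have "bounded A" "bounded B"
    by (auto simp: A_def B_def intro: bounded_subset[of "{0..1}"])
  ultimately have cX: "compact A" and cY: "compact B"
    by (auto simp: compact_eq_bounded_closed)
  have neX: "0 \<in> A" and neY: "1 \<in> B"
    using \<rho> t by (auto simp: A_def B_def d_def)
  obtain s1 where s1: "s1 \<in> A" "\<And>s. s \<in> A \<Longrightarrow> s \<le> s1"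
    using compact_attains_sup[OF cX] neX by blast
  obtain s2 where s2: "s2 \<in> B" "\<And>s. s \<in> B \<Longrightarrow> s2 \<le> s"
    using compact_attains_inf[OF cY] neY by blast
  have dt: "d t = 0" by (simp add: d_def)
  have "s1 \<noteq> t" "s2 \<noteq> t"
    using s1(1) s2(1) dt \<rho>(1) by (auto simp: A_def B_def)
  then have lt: "s1 < t" "t < s2" using s1(1) s2(1) by (auto simp: A_def B_def)
  have in01: "s1 \<in> {0..1}" "s2 \<in> {0..1}" using s1 s2 lt t by (auto simp: A_def B_def)
  have inX: "d s < \<rho>" if "s1 < s" "s < s2" for s
  proof (cases "s \<le> t")
    case True
    then show ?thesis using s1(2)[of s] that in01 by (force simp: A_def)
  next
    case False
    then show ?thesis using s2(2)[of s] that in01 by (force simp: B_def)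
  qed
  have d1: "d s1 = \<rho>"
  proof (rule antisym)
    \<comment> \<open>The distance falls from at least \<open>\<rho>\<close> at \<open>s1\<close> to
      0 at \<open>t\<close>; by maximality of \<open>s1\<close>, the parameter at which it equals
      \<open>\<rho>\<close> is \<open>s1\<close> itself.\<close>
    have "\<exists>x\<ge>s1. x \<le> t \<and> d x = \<rho>"
      using IVT2'[of d t \<rho> s1] s1(1) lt dt \<rho>(1) continuous_on_subset[OF cd, of "{s1..t}"] in01 t
      by (auto simp: A_def)
    then obtain x where "s1 \<le> x" "x \<le> t" "d x = \<rho>" by blast
    moreover then have "x \<le> s1" using s1 in01 by (auto simp: A_def)
    ultimately show "d s1 \<le> \<rho>" by auto
    show "\<rho> \<le> d s1" using s1(1) by (auto simp: A_def)
  qed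
  have d2: "d s2 = \<rho>"
  proof (rule antisym)
    have "\<exists>x\<ge>t. x \<le> s2 \<and> d x = \<rho>"
      using IVT'[of d t \<rho> s2] s2(1) lt dt \<rho>(1) continuous_on_subset[OF cd, of "{t..s2}"] in01 t
      by (auto simp: B_def)
    then obtain x where "x \<le> s2" "t \<le> x" "d x = \<rho>" by blast
    moreover then have "s2 \<le> x" using s2 in01 by (auto simp: B_def)
    ultimately show "d s2 \<le> \<rho>" by auto
    show "\<rho> \<le> d s2" using s2(1) by (auto simp: B_def)
  qed
  have "s1 \<noteq> 0" "s2 \<noteq> 1" using d1 d2 \<rho> by (auto simp: d_def)
  show thesis
    by (rule that[of s1 s2]) (use lt in01 \<open>s1 \<noteq> 0\<close> \<open>s2 \<noteq> 1\<close> d1 d2 inX in \<open>auto simp: d_def\<close>)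
qed

text \<open>\<open>P\<close> and \<open>N\<close> are the points near \<open>g t\<close> on the left and on the right of the arc \<open>g\<close>.\<close>

definition side_chart ::
  "complex set \<Rightarrow> (real \<Rightarrow> complex) \<Rightarrow> real \<Rightarrow> real \<Rightarrow> complex set \<Rightarrow> complex set \<Rightarrow> (complex \<Rightarrow> complex) \<Rightarrow> bool" where
  "side_chart K g t r P N h \<longleftrightarrow>
     0 < r \<and> ball (g t) r \<inter> K = {} \<and> ball (g t) r - path_image g = P \<union> N \<and>
     g t \<in> closure P \<and> g t \<in> closure N \<and> continuous_on (ball (g t) r) h \<and>
     (\<forall>x\<in>P. winding_number g x = h x + 1) \<and> (\<forall>x\<in>N. winding_number g x = h x) \<and>
     (\<forall>x\<in>P. \<forall>y\<in>P. connected_component (- (K \<union> path_image g)) x y) \<and>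
     (\<forall>x\<in>N. \<forall>y\<in>N. connected_component (- (K \<union> path_image g)) x y)"

text \<open>
  Close a crosscut \<open>\<sigma>\<close> of a small disc around \<open>g t\<close> by an arc \<open>\<beta>\<close> of its boundary circle to a Jordan curve
  \<open>J\<close>. Near \<open>g t\<close> the winding numbers of \<open>g\<close> and \<open>J\<close> differ by a continuous function. The rest of \<open>g\<close>, the
  set \<open>K\<close> and the complement of the disc form a closed set meeting \<open>J\<close> only in \<open>\<beta>\<close>, so by Janiszewski's
  theorem points near \<open>g t\<close> on the same side of \<open>J\<close> are connected off \<open>K\<close> and \<open>g\<close>.
\<close>

lemma arc_local_sides:
  fixes g :: "real \<Rightarrow> complex"
  assumes g: "arc g" and t: "0 < t" "t < 1" and K: "closed K" "g t \<notin> K"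
  obtains r P N h where "side_chart K g t r P N h"
proof -
  define p where "p = g t"
  have inj: "inj_on g {0..1}" and pg: "path g" and cont: "continuous_on {0..1} g"
    using g by (auto simp: arc_def path_def)
  \<comment> \<open>The end points are added to \<open>K\<close> because the disc has to avoid them
    for the crosscut to exist.\<close>
  have "closed (K \<union> {g 0, g 1})" using K by auto
  moreover have "p \<notin> K \<union> {g 0, g 1}"
    using K t inj inj_onD[OF inj, of t 0] inj_onD[OF inj, of t 1] by (auto simp: p_def)
  ultimately have "open (- (K \<union> {g 0, g 1}))" "p \<in> - (K \<union> {g 0, g 1})" by auto
  then obtain \<rho> where \<rho>: "0 < \<rho>" "cball p \<rho> \<subseteq> - (K \<union> {g 0, g 1})"
    using open_contains_cball by blast
  then have "g 0 \<notin> cball (g t) \<rho>" "g 1 \<notin> cball (g t) \<rho>" by (auto simp: p_def)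
  from crosscut_of_ball[OF g t \<rho>(1) this] obtain s1 s2 where
    s: "0 < s1" "s1 < t" "t < s2" "s2 < 1"
    and sph: "g s1 \<in> sphere p \<rho>" "g s2 \<in> sphere p \<rho>"
    and inb: "\<And>s. s1 < s \<Longrightarrow> s < s2 \<Longrightarrow> g s \<in> ball p \<rho>"
    unfolding p_def by blast
  define \<sigma> where "\<sigma> = subpath s1 s2 g"
  have arc\<sigma>: "arc \<sigma>" unfolding \<sigma>_def using g s by (intro arc_subpath_arc) auto
  have im\<sigma>: "path_image \<sigma> = g ` {s1..s2}" using s by (simp add: \<sigma>_def path_image_subpath)
  have ne: "g s2 \<noteq> g s1" using inj_onD[OF inj, of s2 s1] s by auto
  have "path_connected (sphere p \<rho>)" by (rule path_connected_sphere) simp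
  then obtain \<beta> where \<beta>: "arc \<beta>" "path_image \<beta> \<subseteq> sphere p \<rho>" "pathstart \<beta> = g s2" "pathfinish \<beta> = g s1"
    using ne sph unfolding path_connected_arcwise by blast
  define J where "J = \<sigma> +++ \<beta>"
  have ends\<sigma>: "pathstart \<sigma> = g s1" "pathfinish \<sigma> = g s2" by (auto simp: \<sigma>_def)
  have J: "simple_path J" "pathfinish J = pathstart J"
  proof -
    have "path_image \<sigma> \<inter> path_image \<beta> \<subseteq> {pathstart \<sigma>, pathstart \<beta>}"
    proof
      fix x assume "x \<in> path_image \<sigma> \<inter> path_image \<beta>"
      then obtain s where "s \<in> {s1..s2}" "x = g s" "dist p (g s) = \<rho>"
        using \<beta>(2) by (auto simp: im\<sigma>)
      then have "s = s1 \<or> s = s2" using inb[of s] by (force simp: less_le)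
      then show "x \<in> {pathstart \<sigma>, pathstart \<beta>}" using \<open>x = g s\<close> \<beta>(3) ends\<sigma> by auto
    qed
    then show "simple_path J" unfolding J_def
      using arc\<sigma> \<beta> ends\<sigma> by (intro simple_path_join_loop) auto
    show "pathfinish J = pathstart J" using \<beta> ends\<sigma> by (simp add: J_def)
  qed
  have imJ: "path_image J = g ` {s1..s2} \<union> path_image \<beta>"
    unfolding J_def using \<beta> ends\<sigma> by (simp add: path_image_join im\<sigma>)
  \<comment> \<open>Everything a small disc around \<open>p\<close> must avoid: \<open>K\<close> and
    the two pieces of \<open>g\<close> outside the crosscut, which may return close to
    \<open>p\<close>. In the smaller disc of radius \<open>r\<close>, the curves \<open>g\<close>
    and \<open>J\<close> then coincide.\<close>
  define A where "A = K \<union> g ` {0..s1} \<union> g ` {s2..1}"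
  have "compact (g ` {0..s1})" "compact (g ` {s2..1})"
    using s t by (auto intro!: compact_continuous_image continuous_on_subset[OF cont])
  then have "closed A" unfolding A_def using K by (auto intro: compact_imp_closed)
  moreover have pA: "p \<notin> A" unfolding A_def p_def using K(2) inj s
    by (auto simp: inj_on_def) force+
  ultimately obtain r0 where r0: "0 < r0" "ball p r0 \<subseteq> - A"
    by (metis ComplI open_Compl openE)
  define r where "r = min r0 \<rho>"
  have r: "0 < r" "r \<le> \<rho>" "ball p r \<inter> A = {}" using r0 \<rho> by (auto simp: r_def)
  define S where "S = A \<union> - ball p \<rho>"
  have clS: "closed S" unfolding S_def using \<open>closed A\<close> by auto
  have SJ: "path_image J \<inter> S = path_image \<beta>"
  proof
    show "path_image \<beta> \<subseteq> path_image J \<inter> S" using imJ \<beta>(2) by (auto simp: S_def)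
    show "path_image J \<inter> S \<subseteq> path_image \<beta>"
    proof
      fix x assume x: "x \<in> path_image J \<inter> S"
      show "x \<in> path_image \<beta>"
      proof (rule ccontr)
        assume nb: "x \<notin> path_image \<beta>"
        then obtain u where u: "u \<in> {s1..s2}" "x = g u" using x imJ by auto
        have "u \<noteq> s1" "u \<noteq> s2" using u nb \<beta> pathstart_in_path_image[of \<beta>] pathfinish_in_path_image[of \<beta>] by auto
        then have u': "s1 < u" "u < s2" using u by auto
        have "x \<in> ball p \<rho>" using inb[OF u'] u by simp
        moreover have "x \<notin> K" using \<rho>(2) calculation by (auto simp: subset_iff)
        moreover have "x \<notin> g ` {0..s1} \<union> g ` {s2..1}"
        proof
          assume "x \<in> g ` {0..s1} \<union> g ` {s2..1}"
          then obtain v where "v \<in> {0..s1} \<union> {s2..1}" "g u = g v" using u by (metis UnE UnI1 UnI2 imageE)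
          then have "u = v" using inj u' s t by (auto simp: inj_on_def)
          then show False using \<open>v \<in> _\<close> u' by auto
        qed
        ultimately show False using x by (auto simp: S_def A_def)
      qed
    qed
  qed
  have img: "path_image g \<subseteq> path_image J \<union> A"
    unfolding imJ A_def path_image_def[of g] using s t
  proof clarsimp
    fix v assume v: "g v \<notin> g ` {s1..s2}" "g v \<notin> g ` {s2..1}" "g v \<notin> g ` {0..s1}" "0 \<le> v" "v \<le> 1"
    then show "g v \<in> K" by (metis atLeastAtMost_iff imageI linear)
  qed
  have ballJ: "ball p r \<inter> path_image g = ball p r \<inter> path_image J"
  proof -
    have "ball p r \<inter> path_image g \<subseteq> path_image J" using img r by auto
    moreover have "ball p r \<inter> path_image J \<subseteq> path_image g"
      using imJ \<beta>(2) r s t by (auto simp: path_image_def)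
    ultimately show ?thesis by auto
  qed
  have conn: "connected_component (- (K \<union> path_image g)) x y"
    if "x \<in> ball p r" "y \<in> ball p r" "connected_component (- path_image J) x y" for x y
  proof -
    have "ball p r \<subseteq> - S" using r by (auto simp: S_def)
    then have "connected_component (- S) x y"
      using that by (meson connected_ball connected_component_def)
    then have "connected_component (- (path_image J \<union> S)) x y"
      using Janiszewski[of "path_image J" S x y] clS J SJ that \<beta>(1)
      by (simp add: compact_simple_path_image connected_arc_image)
    moreover have "- (path_image J \<union> S) \<subseteq> - (K \<union> path_image g)"
      using img by (auto simp: S_def A_def)
    ultimately show ?thesis using connected_component_mono by blast
  qed
  \<comment> \<open>The winding numbers of \<open>g\<close> and \<open>J\<close> share the
    contribution of the crosscut; what is left comes from curves that avoid the disc of radius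
    \<open>r\<close>, so it is continuous there.\<close>
  define h where "h x = winding_number (subpath 0 s1 g) x + winding_number (subpath s2 1 g) x
      - winding_number \<beta> x" for x
  have disj: "ball p r \<inter> path_image (subpath 0 s1 g) = {}" "ball p r \<inter> path_image (subpath s2 1 g) = {}"
    "ball p r \<inter> path_image \<beta> = {}"
    using r s \<beta>(2) by (auto simp: path_image_subpath A_def)
  have ps: "path (subpath 0 s1 g)" "path (subpath s2 1 g)" "path \<beta>"
    using pg s \<beta> by (auto intro: arc_imp_path)
  have conth: "continuous_on (ball p r) h" unfolding h_def
    using disj by (intro continuous_intros continuous_on_subset[OF continuous_on_winding_number] ps) auto
  have wn: "winding_number g x = winding_number J x + h x" if "x \<in> ball p r - path_image g" for x
  proof -
    have x: "x \<notin> path_image g" "x \<notin> path_image \<beta>" "x \<notin> path_image \<sigma>"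
      using that disj im\<sigma> s t by (auto simp: path_image_def)
    have "winding_number g x = winding_number (subpath 0 s2 g) x + winding_number (subpath s2 1 g) x"
      using winding_number_subpath_combine[OF pg x(1), of 0 s2 1] s by simp
    also have "winding_number (subpath 0 s2 g) x = winding_number (subpath 0 s1 g) x + winding_number \<sigma> x"
      using winding_number_subpath_combine[OF pg x(1), of 0 s1 s2] s by (simp add: \<sigma>_def)
    finally have "winding_number g x = winding_number (subpath 0 s1 g) x + winding_number \<sigma> x
      + winding_number (subpath s2 1 g) x" .
    moreover have "winding_number J x = winding_number \<sigma> x + winding_number \<beta> x"
      unfolding J_def using x \<beta> arc\<sigma> ends\<sigma> by (intro winding_number_join) (auto intro: arc_imp_path)
    ultimately show ?thesis by (simp add: h_def)
  qed
  note JJ = Jordan_inside_outside[OF J]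
  let ?I = "inside (path_image J) \<inter> ball p r" and ?O = "outside (path_image J) \<inter> ball p r"
  have un: "ball p r - path_image g = ?I \<union> ?O" using JJ ballJ by blast
  have pJ: "p \<in> path_image J" using s by (auto simp: imJ p_def)
  have dj: "inside (path_image J) \<subseteq> - path_image J" "outside (path_image J) \<subseteq> - path_image J"
    using JJ by (metis Un_upper1, metis Un_upper2)
  have clo: "p \<in> closure ?I" "p \<in> closure ?O"
  proof -
    have "p \<in> closure (inside (path_image J))" "p \<in> closure (outside (path_image J))"
      using JJ pJ by (auto simp: frontier_def)
    then show "p \<in> closure ?I" "p \<in> closure ?O"
      using r(1) open_Int_closure_subset[OF open_ball, of p r] by (force simp: Int_commute[of _ "ball p r"])+
  qed
  have cI: "connected_component (- (K \<union> path_image g)) x y" if "x \<in> ?I" "y \<in> ?I" for x y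
    using that JJ dj by (intro conn connected_componentI[of "inside (path_image J)"]) auto
  have cO: "connected_component (- (K \<union> path_image g)) x y" if "x \<in> ?O" "y \<in> ?O" for x y
    using that JJ dj by (intro conn connected_componentI[of "outside (path_image J)"]) auto
  have wO: "winding_number g x = h x" if "x \<in> ?O" for x
    using that un wn[of x] winding_number_zero_in_outside[of J x] J simple_path_imp_path by auto
  have KK: "ball p r \<inter> K = {}" using r by (auto simp: A_def)
  from J(1) show thesis
  proof (rule simple_closed_path_winding_number_inside)
    assume w: "\<And>z. z \<in> inside (path_image J) \<Longrightarrow> winding_number J z = 1"
    have "winding_number g x = h x + 1" if "x \<in> ?I" for x
      using that un wn[of x] w by auto
    then have "side_chart K g t r ?I ?O h"
      unfolding side_chart_def p_def[symmetric]
      using r(1) KK un clo conth wO cI cO by blast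
    then show thesis by (rule that)
  next
    \<comment> \<open>Nothing determines which circular arc \<open>\<beta>\<close> is, so
      \<open>J\<close> may run clockwise. Then the outside of \<open>J\<close> is on the left of
      \<open>g\<close>: the two sides exchange their roles, and \<open>h\<close> is lowered by
      1.\<close>
    assume w: "\<And>z. z \<in> inside (path_image J) \<Longrightarrow> winding_number J z = - 1"
    have wI: "winding_number g x = h x - 1" if "x \<in> ?I" for x
      using that un wn[of x] w by auto
    have "continuous_on (ball p r) (\<lambda>x. h x - 1)" by (intro continuous_intros conth)
    moreover have "\<forall>x\<in>?O. winding_number g x = h x - 1 + 1" using wO by simp
    moreover have "ball p r - path_image g = ?O \<union> ?I" using un by auto
    ultimately have "side_chart K g t r ?O ?I (\<lambda>x. h x - 1)"
      unfolding side_chart_def p_def[symmetric]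
      using r(1) KK clo wI cI cO by blast
    then show thesis by (rule that)
  qed
qed


section \<open>The components on the right and on the left of an arc\<close>

lemma continuous_on_ball_oscillation:
  fixes h :: "complex \<Rightarrow> complex"
  assumes "continuous_on (ball p r) h" "q \<in> ball p r" "0 < e"
  obtains d where "0 < d" "ball q d \<subseteq> ball p r"
    "\<And>x y. x \<in> ball q d \<Longrightarrow> y \<in> ball q d \<Longrightarrow> cmod (h x - h y) < e"
proof -
  obtain d1 where d1: "0 < d1" "ball q d1 \<subseteq> ball p r"
    using assms(2) open_ball openE by metis
  have "isCont h q" using assms continuous_on_eq_continuous_at open_ball by blast
  then obtain d2 where d2: "0 < d2" "\<And>x. dist x q < d2 \<Longrightarrow> dist (h x) (h q) < e / 2"
    using \<open>0 < e\<close> unfolding continuous_at_eps_delta by (metis half_gt_zero)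
  show thesis
  proof (rule that[of "min d1 d2"])
    fix x y assume "x \<in> ball q (min d1 d2)" "y \<in> ball q (min d1 d2)"
    then have "dist (h x) (h q) < e / 2" "dist (h y) (h q) < e / 2"
      using d2(2)[of x] d2(2)[of y] by (auto simp: dist_commute)
    then have "dist (h x) (h y) < e" by (rule dist_triangle_half_l)
    then show "cmod (h x - h y) < e" by (simp add: dist_norm)
  qed (use d1 d2 in auto)
qed

text \<open>The winding number minus \<open>h\<close> is 1 on \<open>P\<close> and 0 on
  \<open>N\<close>, so from \<open>x\<close> to \<open>y\<close> it changes by 0, 1 or -1. Two
  errors below 1/2 add up to less than 1, which leaves only the change by 1.\<close>

lemma side_chart_jump:
  assumes c: "side_chart K g t r P N h" and x: "x \<in> P \<union> N" and y: "y \<in> P \<union> N"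
    and h: "cmod (h y - h x) < 1/2"
    and w: "cmod (winding_number g y - winding_number g x - 1) < 1/2"
  shows "x \<in> N \<and> y \<in> P"
proof -
  have P: "winding_number g z = h z + 1" if "z \<in> P" for z using c that by (auto simp: side_chart_def)
  have N: "winding_number g z = h z" if "z \<in> N" for z using c that by (auto simp: side_chart_def)
  let ?u = "winding_number g y - winding_number g x"
  have tri: "cmod ((?u - (h y - h x)) - 1) < 1"
    using norm_triangle_ineq4[of "?u - 1" "h y - h x"] h w by (simp add: algebra_simps)
  have "?u - (h y - h x) \<noteq> 0" "?u - (h y - h x) \<noteq> - 1"
    using tri by auto
  then have "\<not> (x \<in> P \<and> y \<in> P)" "\<not> (x \<in> P \<and> y \<in> N)" "\<not> (x \<in> N \<and> y \<in> N)"
    using P N by (auto simp: algebra_simps)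
  then show ?thesis using x y by blast
qed

lemma closure_pick:
  fixes p :: complex assumes "p \<in> closure S" "0 < d" obtains x where "x \<in> S" "x \<in> ball p d"
  using assms by (metis closure_approachable dist_commute mem_ball)

text \<open>Reversal negates the winding number. The new right side is \<open>P\<close>, where it
  equals \<open>- h x - 1\<close>.\<close>

lemma side_chart_reversepath:
  assumes "path g" and c: "side_chart K g t r P N h"
  shows "side_chart K (reversepath g) (1 - t) r N P (\<lambda>x. - h x - 1)"
proof -
  have "reversepath g (1 - t) = g t" by (simp add: reversepath_def)
  moreover have "P \<union> N \<subseteq> - path_image g" using c by (auto simp: side_chart_def)
  then have "winding_number (reversepath g) x = - winding_number g x" if "x \<in> P \<union> N" for x
    using that assms(1) by (auto simp: winding_number_reversepath)
  ultimately show ?thesis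
    using c by (auto simp: side_chart_def intro: continuous_intros)
qed

text \<open>\<open>lies_right_of\<close> may use any one interior parameter, so the charts at all of
  them must have their right sides in the same \<open>fR\<close>. By \<open>side_chart_jump\<close>,
  a point \<open>z\<close> as in the definition then lies in \<open>N\<close>; conversely points of
  \<open>N\<close> and \<open>P\<close> close to \<open>g (1/2)\<close> are witnesses for
  \<open>fR\<close>.\<close>

lemma lies_right_of_iff:
  assumes F: "\<And>f f' x. f \<in> \<F> \<Longrightarrow> f' \<in> \<F> \<Longrightarrow> x \<in> f \<Longrightarrow> x \<in> f' \<Longrightarrow> f = f'"
    and fR: "fR \<in> \<F>" and f: "f \<in> \<F>"
    and chart: "\<And>t. 0 < t \<Longrightarrow> t < 1 \<Longrightarrow> \<exists>r P N h. side_chart K g t r P N h \<and> N \<subseteq> fR"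
  shows "lies_right_of f g \<longleftrightarrow> f = fR"
proof -
  have near: "x \<in> N \<and> y \<in> P"
    if c: "side_chart K g t r P N h" and \<epsilon>: "0 < \<epsilon>" "\<epsilon> \<le> 1/2" "ball (g t) \<epsilon> \<subseteq> ball (g t) r"
      "\<And>x y. x \<in> ball (g t) \<epsilon> \<Longrightarrow> y \<in> ball (g t) \<epsilon> \<Longrightarrow> cmod (h x - h y) < 1/2"
      and xy: "x \<notin> path_image g" "y \<notin> path_image g" "dist x (g t) < \<epsilon>" "dist y (g t) < \<epsilon>"
      "cmod (winding_number g y - winding_number g x - 1) < \<epsilon>" for t r P N h \<epsilon> x y
  proof -
    have b: "x \<in> ball (g t) \<epsilon>" "y \<in> ball (g t) \<epsilon>" using xy(3,4) by (simp_all add: dist_commute)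
    have eq: "ball (g t) r - path_image g = P \<union> N" using c by (simp add: side_chart_def)
    have PN: "x \<in> P \<union> N" "y \<in> P \<union> N"
      unfolding eq[symmetric] using b \<epsilon>(3) xy(1,2) by blast+
    show ?thesis
      by (rule side_chart_jump[OF c PN \<epsilon>(4)[OF b(2,1)]]) (use xy(5) \<epsilon>(2) in linarith)
  qed
  have osc: "\<exists>\<epsilon>. 0 < \<epsilon> \<and> \<epsilon> \<le> 1/2 \<and> ball (g t) \<epsilon> \<subseteq> ball (g t) r \<and>
      (\<forall>x\<in>ball (g t) \<epsilon>. \<forall>y\<in>ball (g t) \<epsilon>. cmod (h x - h y) < e)"
    if c: "side_chart K g t r P N h" and e: "0 < e" for t r P N h e
  proof -
    obtain d where d: "0 < d" "ball (g t) d \<subseteq> ball (g t) r"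
        "\<And>x y. x \<in> ball (g t) d \<Longrightarrow> y \<in> ball (g t) d \<Longrightarrow> cmod (h x - h y) < e"
      by (rule continuous_on_ball_oscillation[of "g t" r h "g t" e]) (use c e in \<open>auto simp: side_chart_def\<close>)
    then show ?thesis by (intro exI[of _ "min d (1/2)"]) auto
  qed
  show ?thesis
  proof
    assume "lies_right_of f g"
    then obtain t where t: "t \<in> {0<..<1}"
      and *: "\<And>\<epsilon>. \<epsilon> > 0 \<Longrightarrow> \<exists>z\<in>f - path_image g. \<exists>w\<in>- path_image g. dist z (g t) < \<epsilon> \<and> dist w (g t) < \<epsilon> \<and>
        cmod (winding_number g w - winding_number g z - 1) < \<epsilon>"
      unfolding lies_right_of_def by blast
    obtain r P N h where c: "side_chart K g t r P N h" and PN: "N \<subseteq> fR"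
      using chart[of t] t by auto
    obtain \<epsilon> where \<epsilon>: "0 < \<epsilon>" "\<epsilon> \<le> 1/2" "ball (g t) \<epsilon> \<subseteq> ball (g t) r"
      "\<And>x y. x \<in> ball (g t) \<epsilon> \<Longrightarrow> y \<in> ball (g t) \<epsilon> \<Longrightarrow> cmod (h x - h y) < 1/2"
      using osc[OF c, of "1/2"] by auto
    obtain z w where zw: "z \<in> f" "z \<notin> path_image g" "w \<notin> path_image g" "dist z (g t) < \<epsilon>" "dist w (g t) < \<epsilon>"
      "cmod (winding_number g w - winding_number g z - 1) < \<epsilon>" using *[OF \<epsilon>(1)] by blast
    have "z \<in> N" using near[OF c \<epsilon> zw(2-6)] ..
    then show "f = fR" using F[OF f fR zw(1)] PN by auto
  next
    assume "f = fR"
    moreover have "lies_right_of fR g"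
      unfolding lies_right_of_def
    proof (intro bexI[of _ "1/2::real"] allI impI)
      fix \<epsilon> :: real assume "0 < \<epsilon>"
      obtain r P N h where c: "side_chart K g (1/2) r P N h" and PN: "N \<subseteq> fR"
        using chart[of "1/2"] by auto
      obtain d where d: "0 < d" "ball (g (1/2)) d \<subseteq> ball (g (1/2)) r"
        "\<And>x y. x \<in> ball (g (1/2)) d \<Longrightarrow> y \<in> ball (g (1/2)) d \<Longrightarrow> cmod (h x - h y) < \<epsilon>"
        using osc[OF c \<open>0 < \<epsilon>\<close>] by auto
      obtain x where x: "x \<in> N" "x \<in> ball (g (1/2)) (min d \<epsilon>)"
        using closure_pick[of "g (1/2)" N "min d \<epsilon>"] c d \<open>0 < \<epsilon>\<close> by (auto simp: side_chart_def)
      obtain y where y: "y \<in> P" "y \<in> ball (g (1/2)) (min d \<epsilon>)"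
        using closure_pick[of "g (1/2)" P "min d \<epsilon>"] c d \<open>0 < \<epsilon>\<close> by (auto simp: side_chart_def)
      have mem: "x \<in> fR - path_image g" "y \<in> - path_image g"
        using c x y PN by (auto simp: side_chart_def)
      have "winding_number g y - winding_number g x - 1 = h y - h x"
        using c x y by (simp add: side_chart_def)
      moreover have "cmod (h y - h x) < \<epsilon>" using d(3)[of y x] x y by simp
      ultimately have "cmod (winding_number g y - winding_number g x - 1) < \<epsilon>" by simp
      moreover have dxy: "dist x (g (1/2)) < \<epsilon>" "dist y (g (1/2)) < \<epsilon>"
        using x y by (auto simp: dist_commute)
      ultimately show "\<exists>z\<in>fR - path_image g. \<exists>w\<in>- path_image g. dist z (g (1/2)) < \<epsilon> \<and>
          dist w (g (1/2)) < \<epsilon> \<and> cmod (winding_number g w - winding_number g z - 1) < \<epsilon>"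
        by (intro bexI[OF _ mem(1)] bexI[OF _ mem(2)] conjI)
    qed auto
    ultimately show "lies_right_of f g" by simp
  qed
qed

text \<open>Each interior parameter has a right and a left component from its chart. Charts at
  nearby parameters overlap and agree on which side is which, so the pair of components is locally
  constant in the parameter, hence constant on the connected open unit interval.\<close>

lemma arc_sides:
  fixes g :: "real \<Rightarrow> complex"
  assumes g: "arc g" and K: "closed K" and disj: "\<And>t. 0 < t \<Longrightarrow> t < 1 \<Longrightarrow> g t \<notin> K"
  defines "\<F> \<equiv> components (- (K \<union> path_image g))"
  shows "\<exists>fR\<in>\<F>. \<exists>fL\<in>\<F>. (\<forall>f\<in>\<F>. lies_right_of f g \<longleftrightarrow> f = fR) \<and> (\<forall>f\<in>\<F>. lies_left_of f g \<longleftrightarrow> f = fL) \<and>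
    (\<forall>t\<in>{0<..<1}. \<exists>r P N h. side_chart K g t r P N h \<and> P \<subseteq> fL \<and> N \<subseteq> fR)"
proof -
  have path: "path g" and cont: "continuous_on {0..1} g" using g by (auto simp: arc_def path_def)
  let ?M = "- (K \<union> path_image g)"
  define good where "good t fR fL \<longleftrightarrow> fR \<in> \<F> \<and> fL \<in> \<F> \<and>
     (\<exists>r P N h. side_chart K g t r P N h \<and> P \<subseteq> fL \<and> N \<subseteq> fR)" for t fR fL
  have "\<exists>fR fL. good t fR fL" if t: "0 < t" "t < 1" for t
  proof -
    obtain r P N h where c: "side_chart K g t r P N h"
      using arc_local_sides[OF g t K disj[OF t]] .
    then have "P \<noteq> {}" "N \<noteq> {}" by (auto simp: side_chart_def)
    then obtain x y where xy: "x \<in> P" "y \<in> N" by blast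
    have "P \<union> N \<subseteq> ?M" using c by (auto simp: side_chart_def)
    then have "connected_component_set ?M y \<in> \<F>" "connected_component_set ?M x \<in> \<F>"
      using xy by (auto simp: \<F>_def intro!: componentsI)
    moreover have "P \<subseteq> connected_component_set ?M x" "N \<subseteq> connected_component_set ?M y"
      using c xy by (auto simp: side_chart_def)
    ultimately show ?thesis using c unfolding good_def by blast
  qed
  then obtain FR FL where good: "\<And>t. 0 < t \<Longrightarrow> t < 1 \<Longrightarrow> good t (FR t) (FL t)" by metis
  have same: "f = f'" if "f \<in> \<F>" "f' \<in> \<F>" "x \<in> f" "x \<in> f'" for f f' x
    using that components_nonoverlap[of f ?M f'] by (auto simp: \<F>_def)
  have inF: "FR t \<in> \<F>" "FL t \<in> \<F>" if "0 < t" "t < 1" for t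
    using good[OF that] by (auto simp: good_def)
  have loc: "\<exists>d>0. \<forall>t'\<in>{0<..<1}. dist t' t < d \<longrightarrow> FR t' = FR t \<and> FL t' = FL t"
    if t: "0 < t" "t < 1" for t
  proof -
    obtain r P N h where c: "side_chart K g t r P N h" and PN: "P \<subseteq> FL t" "N \<subseteq> FR t"
      using good[OF t] by (auto simp: good_def)
    then have r: "0 < r" by (simp add: side_chart_def)
    have "continuous (at t within {0..1}) g" using cont t by (simp add: continuous_on_eq_continuous_within)
    then obtain d where d: "0 < d" "\<And>t'. t' \<in> {0..1} \<Longrightarrow> dist t' t < d \<Longrightarrow> dist (g t') (g t) < r"
      using r unfolding continuous_within_eps_delta by metis
    show ?thesis
    proof (intro exI[of _ d] conjI d(1) ballI impI)
      fix t' assume t': "t' \<in> {0<..<1}" "dist t' t < d"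
      then have q: "g t' \<in> ball (g t) r" using d(2)[of t'] by (auto simp: dist_commute)
      obtain r' P' N' h' where c': "side_chart K g t' r' P' N' h'" and PN': "P' \<subseteq> FL t'" "N' \<subseteq> FR t'"
        using good[of t'] t' by (auto simp: good_def)
      obtain d1 where d1: "0 < d1" "ball (g t') d1 \<subseteq> ball (g t) r"
        "\<And>x y. x \<in> ball (g t') d1 \<Longrightarrow> y \<in> ball (g t') d1 \<Longrightarrow> cmod (h x - h y) < 1/2"
        using continuous_on_ball_oscillation[OF _ q, of h "1/2"] c by (auto simp: side_chart_def)
      obtain d2 where d2: "0 < d2" "ball (g t') d2 \<subseteq> ball (g t') r'"
        "\<And>x y. x \<in> ball (g t') d2 \<Longrightarrow> y \<in> ball (g t') d2 \<Longrightarrow> cmod (h' x - h' y) < 1/2"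
        using continuous_on_ball_oscillation[of "g t'" r' h' "g t'" "1/2"] c' by (auto simp: side_chart_def)
      define d where "d = min d1 d2"
      have d: "0 < d" "ball (g t') d \<subseteq> ball (g t') d1" "ball (g t') d \<subseteq> ball (g t') d2"
        using d1 d2 by (auto simp: d_def)
      obtain x where x: "x \<in> N'" "x \<in> ball (g t') d"
        using closure_pick[of "g t'" N' d] c' d by (auto simp: side_chart_def)
      obtain y where y: "y \<in> P'" "y \<in> ball (g t') d"
        using closure_pick[of "g t'" P' d] c' d by (auto simp: side_chart_def)
      \<comment> \<open>\<open>x\<close> and \<open>y\<close> lie on known sides in the chart at
        \<open>t'\<close>, so the winding number rises by almost 1 from \<open>x\<close> to
        \<open>y\<close>. As both points also belong to the chart at \<open>t\<close>,
        \<open>side_chart_jump\<close> places them on the same sides there.\<close>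
      have "winding_number g y - winding_number g x - 1 = h' y - h' x"
        using c' x y by (simp add: side_chart_def)
      moreover have "cmod (h' y - h' x) < 1/2" "cmod (h y - h x) < 1/2"
        using x y d d1(3) d2(3) by blast+
      moreover have "x \<in> P \<union> N" "y \<in> P \<union> N"
      proof -
        have "x \<notin> path_image g" "y \<notin> path_image g"
          using x(1) y(1) c' by (auto simp: side_chart_def)
        moreover have "x \<in> ball (g t) r" "y \<in> ball (g t) r" using x(2) y(2) d(2) d1(2) by blast+
        ultimately have "x \<in> ball (g t) r - path_image g" "y \<in> ball (g t) r - path_image g" by auto
        then show "x \<in> P \<union> N" "y \<in> P \<union> N" using c by (auto simp: side_chart_def)
      qed
      ultimately have "x \<in> N \<and> y \<in> P" using side_chart_jump[OF c] by metis
      then have mem: "x \<in> FR t" "y \<in> FL t" "x \<in> FR t'" "y \<in> FL t'"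
        using x(1) y(1) PN PN' by auto
      have "0 < t'" "t' < 1" using t' by auto
      then show "FR t' = FR t" "FL t' = FL t"
        using same[OF inF(1) inF(1) mem(3,1)] same[OF inF(2) inF(2) mem(4,2)] t by blast+
    qed
  qed
  have const: "FR s = FR t \<and> FL s = FL t" if "s \<in> {0<..<1}" "t \<in> {0<..<1}" for s t
  proof -
    have "(FR s, FL s) = (FR t, FL t)"
    proof (rule connected_local_const[of "{0<..<1::real}" _ _ "\<lambda>t. (FR t, FL t)"])
      show "\<forall>a\<in>{0<..<1}. \<forall>\<^sub>F b in at a within {0<..<1}. (FR a, FL a) = (FR b, FL b)"
      proof
        fix a :: real assume "a \<in> {0<..<1}"
        then obtain d where "d > 0" "\<forall>t'\<in>{0<..<1}. dist t' a < d \<longrightarrow> FR t' = FR a \<and> FL t' = FL a"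
          using loc[of a] by auto
        then show "\<forall>\<^sub>F b in at a within {0<..<1}. (FR a, FL a) = (FR b, FL b)"
          unfolding eventually_at by (intro exI[of _ d]) auto
      qed
    qed (use that in auto)
    then show ?thesis by simp
  qed
  have sides: "\<exists>r P N h. side_chart K g t r P N h \<and> P \<subseteq> FL (1/2) \<and> N \<subseteq> FR (1/2)" if t: "0 < t" "t < 1" for t
    using good[OF t] const[of t "1/2"] t by (auto simp: good_def)
  have right: "lies_right_of f g \<longleftrightarrow> f = FR (1/2)" if "f \<in> \<F>" for f
  proof (rule lies_right_of_iff[OF same])
    show "\<exists>r P N h. side_chart K g t r P N h \<and> N \<subseteq> FR (1/2)" if "0 < t" "t < 1" for t
      using sides[OF that] by blast
  qed (use that inF[of "1/2"] in auto)
  have left: "lies_left_of f g \<longleftrightarrow> f = FL (1/2)" if "f \<in> \<F>" for f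
    unfolding lies_left_of_def
  proof (rule lies_right_of_iff[OF same])
    fix t :: real assume "0 < t" "t < 1"
    then obtain r P N h where "side_chart K g (1 - t) r P N h" "P \<subseteq> FL (1/2)" using sides[of "1 - t"] by auto
    then show "\<exists>r P N h. side_chart K (reversepath g) t r P N h \<and> N \<subseteq> FL (1/2)"
      using side_chart_reversepath[OF path, of K "1 - t" r P N h] by auto
  qed (use that inF[of "1/2"] in auto)
  have charts: "\<forall>t\<in>{0<..<1}. \<exists>r P N h. side_chart K g t r P N h \<and> P \<subseteq> FL (1/2) \<and> N \<subseteq> FR (1/2)"
    using sides by simp
  show ?thesis
  proof (rule bexI[of _ "FR (1/2)"], rule bexI[of _ "FL (1/2)"], intro conjI)
    show "\<forall>f\<in>\<F>. lies_right_of f g \<longleftrightarrow> f = FR (1/2)" using right by blast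
    show "\<forall>f\<in>\<F>. lies_left_of f g \<longleftrightarrow> f = FL (1/2)" using left by blast
  qed (use charts inF[of "1/2"] in simp_all)
qed

section \<open>Cycles and faces of plane quivers\<close>

text \<open>Without loops every curve is an arc, as \<open>arc_sides\<close> requires.\<close>

locale planar_quiver = fin_digraph G for G :: "('v, 'e) pre_digraph" +
  fixes pos :: "'v \<Rightarrow> complex" and curve :: "'e \<Rightarrow> real \<Rightarrow> complex"
  assumes loopfree: "e \<in> arcs G \<Longrightarrow> tail G e \<noteq> head G e"
    and embedding: "planar_embedding G pos curve"
begin

text \<open>All vertices are kept, so that deleting an arrow removes exactly the interior of its
  curve from the drawing.\<close>

definition skel :: "'e set \<Rightarrow> complex set" where
  "skel F = pos ` verts G \<union> (\<Union>e\<in>F. path_image (curve e))"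

lemma skel_mono: "F \<subseteq> F' \<Longrightarrow> skel F \<subseteq> skel F'"
  by (auto simp: skel_def)

lemma skel_insert: "skel (insert e F) = skel F \<union> path_image (curve e)"
  by (auto simp: skel_def)

lemma drawing_eq_skel: "drawing G pos curve = skel (arcs G)"
  by (simp add: drawing_def skel_def)

lemma inj_pos: "inj_on pos (verts G)"
  using embedding by (simp add: planar_embedding_def)

lemma curve_props:
  assumes "e \<in> arcs G"
  shows "simple_path (curve e)" "pathstart (curve e) = pos (tail G e)"
    "pathfinish (curve e) = pos (head G e)"
    "path_image (curve e) \<inter> pos ` verts G = {pos (tail G e), pos (head G e)}"
  using embedding assms by (auto simp: planar_embedding_def)

lemma curves_meet:
  "e \<in> arcs G \<Longrightarrow> e' \<in> arcs G \<Longrightarrow> e \<noteq> e' \<Longrightarrow>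
    path_image (curve e) \<inter> path_image (curve e') \<subseteq> pos ` verts G"
  using embedding by (simp add: planar_embedding_def)

lemma arc_curve: "e \<in> arcs G \<Longrightarrow> Path_Connected.arc (curve e)"
  using curve_props[of e] loopfree[of e] inj_pos by (auto simp: arc_simple_path inj_on_def)

lemma compact_skel: "F \<subseteq> arcs G \<Longrightarrow> compact (skel F)"
  unfolding skel_def
  by (intro compact_Un compact_UN finite_imp_compact finite_imageI finite_verts compact_simple_path_image
      curve_props finite_subset[OF _ finite_arcs]) auto

lemma closed_skel: "F \<subseteq> arcs G \<Longrightarrow> closed (skel F)"
  by (simp add: compact_skel compact_imp_closed)

lemma curve_interior_notin_skel:
  assumes e: "e \<in> arcs G" and F: "F \<subseteq> arcs G - {e}" and t: "0 < t" "t < 1"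
  shows "curve e t \<notin> skel F"
proof
  assume "curve e t \<in> skel F"
  moreover have im: "curve e t \<in> path_image (curve e)" using t by (auto simp: path_image_def)
  ultimately have "curve e t \<in> pos ` verts G"
    using curves_meet[OF e] F by (auto simp: skel_def)
  then have "curve e t = curve e 0 \<or> curve e t = curve e 1"
    using curve_props[OF e] im by (auto simp: pathstart_def pathfinish_def)
  moreover have "inj_on (curve e) {0..1}" using arc_curve[OF e] by (simp add: Path_Connected.arc_def)
  ultimately show False using t inj_onD[of "curve e" "{0..1}" t 0] inj_onD[of "curve e" "{0..1}" t 1] by auto
qed

lemma curve_point_cases:
  assumes e: "e \<in> arcs G" and x: "x \<in> path_image (curve e)" "x \<notin> skel F"
  obtains t where "0 < t" "t < 1" "x = curve e t"
proof -
  obtain t where t: "t \<in> {0..1}" "x = curve e t" using x by (auto simp: path_image_def)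
  have "x \<noteq> pathstart (curve e)" "x \<noteq> pathfinish (curve e)"
    using x curve_props[OF e] e by (auto simp: skel_def)
  then have "t \<noteq> 0" "t \<noteq> 1" using t by (auto simp: pathstart_def pathfinish_def)
  then show thesis using t by (intro that[of t]) auto
qed

definition right_face :: "'e \<Rightarrow> complex set" where
  "right_face e = (THE f. f \<in> faces G pos curve \<and> lies_right_of f (curve e))"

definition left_face :: "'e \<Rightarrow> complex set" where
  "left_face e = (THE f. f \<in> faces G pos curve \<and> lies_left_of f (curve e))"

text \<open>\<open>arc_sides\<close> with \<open>K\<close> the rest of the drawing: the components
  off \<open>K\<close> and the curve of \<open>e\<close> are then the faces of the whole
  quiver.\<close>

lemma side_faces:
  assumes e: "e \<in> arcs G"
  shows right_face_in: "right_face e \<in> faces G pos curve"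
    and left_face_in: "left_face e \<in> faces G pos curve"
    and right_face_iff: "f \<in> faces G pos curve \<Longrightarrow> lies_right_of f (curve e) \<longleftrightarrow> f = right_face e"
    and left_face_iff: "f \<in> faces G pos curve \<Longrightarrow> lies_left_of f (curve e) \<longleftrightarrow> f = left_face e"
    and chart: "0 < t \<Longrightarrow> t < 1 \<Longrightarrow> \<exists>r P N h. side_chart (skel (arcs G - {e})) (curve e) t r P N h \<and>
      P \<subseteq> left_face e \<and> N \<subseteq> right_face e"
proof -
  have "skel (arcs G - {e}) \<union> path_image (curve e) = skel (arcs G)"
    using e skel_insert[of e "arcs G - {e}"] by (simp add: insert_absorb)
  then have faces: "components (- (skel (arcs G - {e}) \<union> path_image (curve e))) = faces G pos curve"
    by (simp only: faces_def drawing_eq_skel)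
  have "closed (skel (arcs G - {e}))" by (rule closed_skel) auto
  then have "\<exists>fR\<in>faces G pos curve. \<exists>fL\<in>faces G pos curve.
    (\<forall>f\<in>faces G pos curve. lies_right_of f (curve e) \<longleftrightarrow> f = fR) \<and>
    (\<forall>f\<in>faces G pos curve. lies_left_of f (curve e) \<longleftrightarrow> f = fL) \<and>
    (\<forall>t\<in>{0<..<1}. \<exists>r P N h. side_chart (skel (arcs G - {e})) (curve e) t r P N h \<and> P \<subseteq> fL \<and> N \<subseteq> fR)"
    unfolding faces[symmetric]
    by (rule arc_sides[OF arc_curve[OF e]]) (rule curve_interior_notin_skel[OF e subset_refl])
  then obtain fR fL where f: "fR \<in> faces G pos curve" "fL \<in> faces G pos curve"
    and fR: "\<forall>f\<in>faces G pos curve. lies_right_of f (curve e) \<longleftrightarrow> f = fR"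
    and fL: "\<forall>f\<in>faces G pos curve. lies_left_of f (curve e) \<longleftrightarrow> f = fL"
    and ch: "\<forall>t\<in>{0<..<1}. \<exists>r P N h. side_chart (skel (arcs G - {e})) (curve e) t r P N h \<and>
      P \<subseteq> fL \<and> N \<subseteq> fR"
    by (elim bexE conjE)
  have R: "right_face e = fR" unfolding right_face_def
    by (rule the_equality) (use f(1) fR in blast)+
  have L: "left_face e = fL" unfolding left_face_def
    by (rule the_equality) (use f(2) fL in blast)+
  show "right_face e \<in> faces G pos curve" "left_face e \<in> faces G pos curve"
    unfolding R L by (fact f)+
  show "f \<in> faces G pos curve \<Longrightarrow> lies_right_of f (curve e) \<longleftrightarrow> f = right_face e"
    unfolding R using fR by (rule bspec)
  show "f \<in> faces G pos curve \<Longrightarrow> lies_left_of f (curve e) \<longleftrightarrow> f = left_face e"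
    unfolding L using fL by (rule bspec)
  show "0 < t \<Longrightarrow> t < 1 \<Longrightarrow> \<exists>r P N h. side_chart (skel (arcs G - {e})) (curve e) t r P N h \<and>
      P \<subseteq> left_face e \<and> N \<subseteq> right_face e"
    unfolding R L using ch by simp
qed

lemma face_coeff_eq:
  assumes "e \<in> arcs G" "f \<in> faces G pos curve"
  shows "face_coeff curve f e = of_bool (f = right_face e) - of_bool (f = left_face e)"
  using assms by (simp add: face_coeff_def right_face_iff left_face_iff)

definition face_point :: "complex set \<Rightarrow> complex" where
  "face_point f = (SOME x. x \<in> f)"

lemma face_point_in: "f \<in> faces G pos curve \<Longrightarrow> face_point f \<in> f"
  by (simp add: face_point_def faces_def some_in_eq in_components_nonempty)

text \<open>The sample points are taken in faces of the whole quiver and serve for every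
  \<open>F\<close>, because a face lies in a single component of the complement of
  \<open>skel F\<close>.\<close>

abbreviation "lpt e \<equiv> face_point (left_face e)"
abbreviation "rpt e \<equiv> face_point (right_face e)"

lemma face_connected:
  assumes "f \<in> faces G pos curve" "x \<in> f" "F \<subseteq> arcs G"
  shows "connected_component (- skel F) (face_point f) x"
proof (rule connected_componentI)
  have "f \<subseteq> - skel (arcs G)" using assms(1) in_components_subset by (auto simp: faces_def drawing_eq_skel)
  then show "f \<subseteq> - skel F" using skel_mono[OF assms(3)] by auto
  show "topological_space_class.connected f"
    using assms(1) unfolding faces_def by (rule in_components_connected)
qed (use assms(1,2) face_point_in in auto)

lemma face_point_notin_skel: "f \<in> faces G pos curve \<Longrightarrow> face_point f \<notin> skel (arcs G)"
  using face_connected[OF _ face_point_in subset_refl] connected_component_in by blast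

section \<open>Cycles of the graph and their winding functions\<close>

definition bdry :: "'e set \<Rightarrow> ('e \<Rightarrow> 'a::comm_ring_1) \<Rightarrow> 'v \<Rightarrow> 'a" where
  "bdry F x v = (\<Sum>e\<in>F. x e * (of_bool (head G e = v) - of_bool (tail G e = v)))"

text \<open>The kernel of the boundary map of the underlying graph. The coefficient ring is left
  open, since integral, rational and \<open>'k\<close>-valued cycles all occur.\<close>

definition is_cycle :: "'e set \<Rightarrow> ('e \<Rightarrow> 'a::comm_ring_1) \<Rightarrow> bool" where
  "is_cycle F x \<longleftrightarrow> (\<forall>v\<in>verts G. bdry F x v = 0)"

lemma bdry_add: "bdry F (\<lambda>e. x e + y e) v = bdry F x v + bdry F y v"
  by (simp add: bdry_def distrib_right sum.distrib)

lemma bdry_scale: "bdry F (\<lambda>e. c * x e) v = c * bdry F x v"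
  by (simp add: bdry_def sum_distrib_left mult.assoc)

lemma bdry_cong: "(\<And>e. e \<in> F \<Longrightarrow> x e = y e) \<Longrightarrow> bdry F x v = bdry F y v"
  by (simp add: bdry_def cong: sum.cong)

lemma bdry_insert: "finite F \<Longrightarrow> e \<notin> F \<Longrightarrow>
    bdry (insert e F) x v = x e * (of_bool (head G e = v) - of_bool (tail G e = v)) + bdry F x v"
  by (simp add: bdry_def)

lemma bdry_of_int: "bdry F (\<lambda>e. of_int (z e)) v = of_int (bdry F z v)"
  by (simp add: bdry_def)

lemma is_cycle_of_int: "is_cycle F z \<Longrightarrow> is_cycle F (\<lambda>e. of_int (z e))"
  by (simp add: is_cycle_def bdry_of_int)

text \<open>Summation by parts: pairing a chain with the coboundary of \<open>\<phi>\<close> is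
  pairing its boundary with \<open>\<phi>\<close>.\<close>

lemma cycle_pairing:
  assumes x: "is_cycle F x" and F: "F \<subseteq> arcs G"
  shows "(\<Sum>e\<in>F. x e * (\<phi> (head G e) - \<phi> (tail G e))) = 0"
proof -
  have "(\<Sum>e\<in>F. x e * (\<phi> (head G e) - \<phi> (tail G e))) =
      (\<Sum>e\<in>F. \<Sum>v\<in>verts G. \<phi> v * (x e * (of_bool (head G e = v) - of_bool (tail G e = v))))"
  proof (rule sum.cong)
    fix e assume "e \<in> F"
    then have e: "head G e \<in> verts G" "tail G e \<in> verts G" using F by auto
    have "\<phi> u = (\<Sum>v\<in>verts G. \<phi> v * of_bool (u = v))" if "u \<in> verts G" for u
    proof -
      have "(\<Sum>v\<in>verts G. \<phi> v * of_bool (u = v)) = (\<Sum>v\<in>verts G. if u = v then \<phi> v else 0)"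
        by (rule sum.cong) auto
      then show ?thesis using that by simp
    qed
    note delta = this[OF e(1)] this[OF e(2)]
    have "(\<Sum>v\<in>verts G. \<phi> v * (x e * (of_bool (head G e = v) - of_bool (tail G e = v)))) =
       (\<Sum>v\<in>verts G. x e * (\<phi> v * of_bool (head G e = v)) - x e * (\<phi> v * of_bool (tail G e = v)))"
      by (intro sum.cong refl) (simp only: right_diff_distrib mult.left_commute)
    also have "\<dots> = x e * (\<phi> (head G e) - \<phi> (tail G e))"
      unfolding sum_subtractf sum_distrib_left[symmetric] delta[symmetric] right_diff_distrib ..
    finally show "x e * (\<phi> (head G e) - \<phi> (tail G e)) =
       (\<Sum>v\<in>verts G. \<phi> v * (x e * (of_bool (head G e = v) - of_bool (tail G e = v))))" ..
  qed simp
  also have "\<dots> = (\<Sum>v\<in>verts G. \<phi> v * bdry F x v)"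
    by (subst sum.swap) (simp add: bdry_def sum_distrib_left)
  also have "\<dots> = 0" using x by (simp add: is_cycle_def)
  finally show ?thesis .
qed

definition winding :: "'e set \<Rightarrow> ('e \<Rightarrow> int) \<Rightarrow> complex \<Rightarrow> complex" where
  "winding F z x = (\<Sum>e\<in>F. of_int (z e) * winding_number (curve e) x)"

text \<open>Up to an integer, \<open>2 * pi * \<i>\<close> times the winding number of a curve is a
  difference of logarithms at its ends. These differences form a coboundary, which the cycle
  annihilates, and only the integers remain.\<close>

lemma winding_Ints:
  assumes z: "is_cycle F z" and F: "F \<subseteq> arcs G" and x: "x \<notin> skel F"
  shows "winding F z x \<in> \<int>"
proof -
  \<comment> \<open>Any choice of logarithms would do, provided that it depends on the vertex alone
    and not on the curve.\<close>
  define l where "l v = Ln (pos v - x)" for v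
  have l: "exp (l v) = pos v - x" if "v \<in> verts G" for v
  proof -
    have "pos v - x \<noteq> 0" using that x by (auto simp: skel_def)
    then show ?thesis by (simp add: l_def)
  qed
  define c :: complex where "c = 2 * pi * \<i>"
  have "\<exists>n::int. c * winding_number (curve e) x = l (head G e) - l (tail G e) + c * of_int n" if "e \<in> F" for e
  proof -
    have e: "e \<in> arcs G" "x \<notin> path_image (curve e)" using that F x by (auto simp: skel_def)
    have "exp (l (head G e)) = exp (c * winding_number (curve e) x) * exp (l (tail G e))"
      using winding_number_exp_2pi[of "curve e" x] e curve_props[OF e(1)] l
      by (simp add: simple_path_imp_path c_def)
    then have "exp (c * winding_number (curve e) x + l (tail G e)) = exp (l (head G e))"
      by (simp add: exp_add)
    then obtain n :: int where "c * winding_number (curve e) x + l (tail G e) = l (head G e) + (of_int (2 * n) * pi) * \<i>"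
      by (blast dest: exp_eq[THEN iffD1])
    then show ?thesis by (intro exI[of _ n]) (simp add: c_def algebra_simps)
  qed
  then obtain n :: "'e \<Rightarrow> int" where
    n: "\<And>e. e \<in> F \<Longrightarrow> c * winding_number (curve e) x = l (head G e) - l (tail G e) + c * of_int (n e)"
    by metis
  have "c * winding F z x = (\<Sum>e\<in>F. c * (of_int (z e) * winding_number (curve e) x))"
    by (simp only: winding_def sum_distrib_left)
  also have "\<dots> = (\<Sum>e\<in>F. of_int (z e) * (l (head G e) - l (tail G e)) + c * of_int (z e * n e))"
  proof (rule sum.cong)
    fix e assume "e \<in> F"
    have "c * (of_int (z e) * winding_number (curve e) x) = of_int (z e) * (c * winding_number (curve e) x)"
      by simp
    also have "\<dots> = of_int (z e) * (l (head G e) - l (tail G e)) + c * of_int (z e * n e)"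
      unfolding n[OF \<open>e \<in> F\<close>] by (simp add: algebra_simps)
    finally show "c * (of_int (z e) * winding_number (curve e) x) = \<dots>" .
  qed simp
  also have "\<dots> = c * of_int (\<Sum>e\<in>F. z e * n e)"
    using cycle_pairing[OF is_cycle_of_int[OF z] F, of l]
    by (simp only: sum.distrib sum_distrib_left of_int_sum add_0)
  finally have "c * winding F z x = c * of_int (\<Sum>e\<in>F. z e * n e)" .
  moreover have "c \<noteq> 0" by (simp add: c_def)
  ultimately have "winding F z x = of_int (\<Sum>e\<in>F. z e * n e)" by (simp only: mult_cancel_left) simp
  then show ?thesis by (simp only: Ints_of_int)
qed

lemma winding_continuous:
  assumes F: "F \<subseteq> arcs G" and S: "S \<inter> skel F = {}"
  shows "continuous_on S (winding F z)"
  unfolding winding_def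
proof (intro continuous_intros)
  fix e assume "e \<in> F"
  then have "path (curve e)" "S \<subseteq> - path_image (curve e)"
    using F S curve_props by (auto simp: skel_def simple_path_imp_path)
  then show "continuous_on S (winding_number (curve e))"
    using continuous_on_winding_number continuous_on_subset by blast
qed

lemma Ints_norm_less_1: "a \<in> \<int> \<Longrightarrow> cmod a < 1 \<Longrightarrow> a = 0"
proof -
  assume a: "a \<in> \<int>" "cmod a < 1"
  then obtain n where n: "a = of_int n" by (auto elim: Ints_cases)
  with a have "\<bar>real_of_int n\<bar> < 1" by simp
  then have "n = 0" by linarith
  then show "a = 0" using n by simp
qed

lemma winding_constant:
  assumes z: "is_cycle F z" and F: "F \<subseteq> arcs G" and xy: "connected_component (- skel F) x y"
  shows "winding F z x = winding F z y"
proof -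
  obtain C where C: "topological_space_class.connected C" "C \<subseteq> - skel F" "x \<in> C" "y \<in> C"
    using xy by (auto simp: connected_component_def)
  have "winding F z constant_on C"
  proof (rule continuous_discrete_range_constant[OF C(1)])
    show "continuous_on C (winding F z)" using F C by (intro winding_continuous) auto
    fix a assume a: "a \<in> C"
    show "\<exists>e>0. \<forall>b. b \<in> C \<and> winding F z b \<noteq> winding F z a \<longrightarrow> e \<le> cmod (winding F z b - winding F z a)"
    proof (intro exI[of _ 1] conjI allI impI)
      fix b assume b: "b \<in> C \<and> winding F z b \<noteq> winding F z a"
      then have "winding F z b - winding F z a \<in> \<int>"
        using a b subsetD[OF C(2), of a] subsetD[OF C(2), of b] by (intro Ints_diff winding_Ints[OF z F]) auto
      with b show "1 \<le> cmod (winding F z b - winding F z a)"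
        using Ints_norm_less_1[of "winding F z b - winding F z a"] by (metis le_less_linear right_minus_eq)
    qed simp
  qed
  then show ?thesis using C by (auto simp: constant_on_def)
qed

text \<open>Close to the middle of \<open>e\<close> the other arrows contribute continuously, while
  the winding number of \<open>e\<close> jumps by 1. This gives the difference with an error below
  1, and integrality makes it exact.\<close>

lemma winding_jump:
  assumes z: "is_cycle F z" and F: "F \<subseteq> arcs G" and e: "e \<in> F"
  shows "winding F z (lpt e) - winding F z (rpt e) = of_int (z e)"
proof -
  have ea: "e \<in> arcs G" using e F by auto
  define p where "p = curve e (1/2)"
  obtain r P N h where c: "side_chart (skel (arcs G - {e})) (curve e) (1/2) r P N h"
    and PN: "P \<subseteq> left_face e" "N \<subseteq> right_face e"
    using chart[OF ea, of "1/2"] by auto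
  \<comment> \<open>\<open>winding F z\<close> with the jump across \<open>e\<close> removed: it
    equals \<open>q\<close> on \<open>N\<close> and \<open>q\<close> plus \<open>z e\<close> on
    \<open>P\<close>.\<close>
  define q where "q x = of_int (z e) * h x + winding (F - {e}) z x" for x
  have split: "winding F z x = of_int (z e) * winding_number (curve e) x + winding (F - {e}) z x" for x
    unfolding winding_def using e F finite_subset[OF F] by (intro sum.remove) auto
  have "ball p r \<inter> skel (F - {e}) = {}"
    using c skel_mono[of "F - {e}" "arcs G - {e}"] F by (auto simp: side_chart_def p_def)
  then have cq: "continuous_on (ball p r) q" unfolding q_def
    using c F by (intro continuous_intros winding_continuous) (auto simp: side_chart_def p_def)
  have "p \<in> ball p r" using c by (simp add: side_chart_def)
  have "\<exists>d>0. \<forall>x\<in>ball p d. \<forall>y\<in>ball p d. cmod (q x - q y) < 1"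
  proof (rule continuous_on_ball_oscillation[OF cq \<open>p \<in> ball p r\<close> zero_less_one])
    fix d :: real
    assume "0 < d" "\<And>x y. x \<in> ball p d \<Longrightarrow> y \<in> ball p d \<Longrightarrow> cmod (q x - q y) < 1"
    then show ?thesis by (intro exI[of _ d] conjI ballI)
  qed
  then obtain d where d: "0 < d" "\<forall>x\<in>ball p d. \<forall>y\<in>ball p d. cmod (q x - q y) < 1" by (elim exE conjE)
  obtain x where x: "x \<in> N" "x \<in> ball p d"
  proof (rule closure_pick)
    show "p \<in> closure N" using c by (simp add: side_chart_def p_def)
  qed (use d(1) in auto)
  obtain y where y: "y \<in> P" "y \<in> ball p d"
  proof (rule closure_pick)
    show "p \<in> closure P" using c by (simp add: side_chart_def p_def)
  qed (use d(1) in auto)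
  have conn: "connected_component (- skel F) (lpt e) y" "connected_component (- skel F) (rpt e) x"
    using PN x(1) y(1) by (auto intro!: face_connected left_face_in right_face_in ea F)
  have W: "winding F z (lpt e) = winding F z y" "winding F z (rpt e) = winding F z x"
    using winding_constant[OF z F] conn by auto
  have "winding_number (curve e) y = h y + 1" "winding_number (curve e) x = h x"
    using c x(1) y(1) by (simp_all add: side_chart_def)
  then have "winding F z y = of_int (z e) + q y" "winding F z x = q x"
    unfolding split q_def by (simp_all add: algebra_simps)
  then have qq: "winding F z y - winding F z x - of_int (z e) = q y - q x" by simp
  have "y \<notin> skel F" "x \<notin> skel F" using connected_component_in[OF conn(1)] connected_component_in[OF conn(2)] by auto
  then have "winding F z y - winding F z x - of_int (z e) \<in> \<int>"
    using winding_Ints[OF z F] by auto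
  then have "q y - q x = 0" unfolding qq using d(2)[rule_format, OF y(2) x(2)] by (rule Ints_norm_less_1)
  then have "winding F z y - winding F z x - of_int (z e) = 0" unfolding qq .
  then show ?thesis unfolding W by (simp only: right_minus_eq)
qed

text \<open>The winding function is already integral; the floor of its real part merely turns it
  into a function with values in \<open>int\<close>.\<close>

lemma cycle_potential:
  assumes z: "is_cycle F z" and F: "F \<subseteq> arcs G"
  obtains n :: "complex \<Rightarrow> int" where
    "\<And>x y. connected_component (- skel F) x y \<Longrightarrow> n x = n y"
    "\<And>e. e \<in> F \<Longrightarrow> n (lpt e) - n (rpt e) = z e"
proof (rule that[of "\<lambda>x. \<lfloor>Re (winding F z x)\<rfloor>"])
  fix x y assume "connected_component (- skel F) x y"
  then show "\<lfloor>Re (winding F z x)\<rfloor> = \<lfloor>Re (winding F z y)\<rfloor>" using winding_constant[OF z F] by simp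
next
  fix e assume e: "e \<in> F"
  then have "lpt e \<notin> skel F" "rpt e \<notin> skel F"
    using face_point_notin_skel[OF left_face_in, of e] face_point_notin_skel[OF right_face_in, of e]
      skel_mono[OF F] subsetD[OF F e] by auto
  then have ints: "winding F z (lpt e) \<in> \<int>" "winding F z (rpt e) \<in> \<int>"
    by (simp_all add: winding_Ints[OF z F])
  obtain a where a: "winding F z (lpt e) = of_int a" using ints(1) by (rule Ints_cases)
  obtain b where b: "winding F z (rpt e) = of_int b" using ints(2) by (rule Ints_cases)
  have "(of_int (a - b) :: complex) = of_int (z e)"
    using winding_jump[OF z F e] by (simp only: a b of_int_diff)
  then have "a - b = z e" by (simp only: of_int_eq_iff)
  then show "\<lfloor>Re (winding F z (lpt e))\<rfloor> - \<lfloor>Re (winding F z (rpt e))\<rfloor> = z e"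
    by (simp add: a b)
qed

section \<open>Deleting an arrow: bridges and functions with equal values on both sides\<close>

lemma bdry_update:
  assumes "finite F" "e \<in> F"
  shows "bdry F (z(e := z e + c)) v = bdry F z v + c * (of_bool (head G e = v) - of_bool (tail G e = v))"
proof -
  have split: "bdry F y v = y e * (of_bool (head G e = v) - of_bool (tail G e = v)) + bdry (F - {e}) y v" for y
    unfolding bdry_def using assms by (simp add: sum.remove)
  have "bdry (F - {e}) (z(e := z e + c)) v = bdry (F - {e}) z v"
    by (rule bdry_cong) auto
  then show ?thesis unfolding split[of "z(e := z e + c)"] split[of z] by (simp only: fun_upd_same distrib_right add_ac)
qed

text \<open>
  The vertices homologous to the head of \<open>e\<close> in \<open>F\<close> and the remaining ones split the drawing of \<open>F\<close> into two
  disjoint compact parts, each of which meets the curve of \<open>e\<close> in a single end point; so Janiszewski's theorem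
  applies twice.
\<close>

lemma bridge_sides_connected:
  assumes e: "e \<in> arcs G" and F: "F \<subseteq> arcs G - {e}"
    and bridge: "\<nexists>z :: 'e \<Rightarrow> int. is_cycle (insert e F) z \<and> z e = 1"
  shows "connected_component (- skel (insert e F)) (lpt e) (rpt e)"
proof -
  have finF: "finite F" using F finite_subset[OF _ finite_arcs] by auto
  have eF: "e \<notin> F" using F by auto
  \<comment> \<open>Chains stand in for undirected walks: negative coefficients traverse arrows
    backwards.\<close>
  define reach where "reach u \<longleftrightarrow> u \<in> verts G \<and> (\<exists>z :: 'e \<Rightarrow> int. \<forall>v\<in>verts G.
      bdry F z v = of_bool (u = v) - of_bool (head G e = v))" for u
  have rh: "reach (head G e)"
    unfolding reach_def using e by (auto intro!: exI[of _ "\<lambda>_. 0"] simp: bdry_def)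
  have rt: "\<not> reach (tail G e)"
  proof
    assume "reach (tail G e)"
    then obtain z :: "'e \<Rightarrow> int" where z: "\<forall>v\<in>verts G. bdry F z v = of_bool (tail G e = v) - of_bool (head G e = v)"
      by (auto simp: reach_def)
    \<comment> \<open>A chain from the head to the tail of \<open>e\<close> is closed by
      \<open>e\<close> itself to a cycle with coefficient 1 at \<open>e\<close>.\<close>
    have "bdry F (z(e := 1)) v = bdry F z v" for v using eF by (intro bdry_cong) auto
    then have "is_cycle (insert e F) (z(e := 1))"
      using z by (simp add: is_cycle_def bdry_insert[OF finF eF])
    then show False using bridge by (metis fun_upd_same)
  qed
  have step: "reach (head G a) \<longleftrightarrow> reach (tail G a)" if "a \<in> F" for a
  proof
    assume "reach (head G a)"
    then obtain z :: "'e \<Rightarrow> int" where z: "\<forall>v\<in>verts G. bdry F z v = of_bool (head G a = v) - of_bool (head G e = v)"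
      by (auto simp: reach_def)
    then have "\<forall>v\<in>verts G. bdry F (z(a := z a + (- 1))) v = of_bool (tail G a = v) - of_bool (head G e = v)"
      unfolding bdry_update[OF finF that] by simp
    moreover have "tail G a \<in> verts G" using that F by auto
    ultimately show "reach (tail G a)" unfolding reach_def by (intro conjI exI)
  next
    assume "reach (tail G a)"
    then obtain z :: "'e \<Rightarrow> int" where z: "\<forall>v\<in>verts G. bdry F z v = of_bool (tail G a = v) - of_bool (head G e = v)"
      by (auto simp: reach_def)
    then have "\<forall>v\<in>verts G. bdry F (z(a := z a + 1)) v = of_bool (head G a = v) - of_bool (head G e = v)"
      unfolding bdry_update[OF finF that] by simp
    moreover have "head G a \<in> verts G" using that F by auto
    ultimately show "reach (head G a)" unfolding reach_def by (intro conjI exI)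
  qed
  define part where "part b = pos ` {v \<in> verts G. reach v = b} \<union>
      (\<Union>a\<in>{a \<in> F. reach (tail G a) = b}. path_image (curve a))" for b
  have comp: "compact (part b)" for b
  proof -
    have "compact (pos ` {v \<in> verts G. reach v = b})" by (intro finite_imp_compact) auto
    moreover have "compact (\<Union>a\<in>{a \<in> F. reach (tail G a) = b}. path_image (curve a))"
      using finF F by (intro compact_UN compact_simple_path_image curve_props) auto
    ultimately show ?thesis unfolding part_def by (rule compact_Un)
  qed
  have curve_verts: "x \<in> pos ` {v \<in> verts G. reach v = b}"
    if "a \<in> F" "reach (tail G a) = b" "x \<in> path_image (curve a)" "x \<in> pos ` verts G" for a b x
  proof -
    have a: "a \<in> arcs G" using that F by auto
    then have "x = pos (tail G a) \<or> x = pos (head G a)" using curve_props(4)[OF a] that by blast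
    then show ?thesis using step[OF that(1)] that(2) a by auto
  qed
  have part_verts: "x \<in> pos ` {v \<in> verts G. reach v = b}" if "x \<in> part b" "x \<in> pos ` verts G" for x b
    using that curve_verts unfolding part_def by blast
  have disj: "part True \<inter> part False = {}"
  proof (rule ccontr)
    assume "part True \<inter> part False \<noteq> {}"
    then obtain x where x: "x \<in> part True" "x \<in> part False" by auto
    have "x \<in> pos ` verts G"
    proof (rule ccontr)
      assume nv: "x \<notin> pos ` verts G"
      then obtain a a' where a: "a \<in> F" "reach (tail G a)" "x \<in> path_image (curve a)"
          "a' \<in> F" "\<not> reach (tail G a')" "x \<in> path_image (curve a')"
        using x unfolding part_def by blast
      then have "a \<noteq> a'" "a \<in> arcs G" "a' \<in> arcs G" using F by auto
      then show False using curves_meet[of a a'] a nv by auto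
    qed
    then obtain v v' where "v \<in> verts G" "reach v" "x = pos v" "v' \<in> verts G" "\<not> reach v'" "x = pos v'"
      using part_verts[OF x(1)] part_verts[OF x(2)] by auto
    then show False using inj_onD[OF inj_pos, of v v'] by auto
  qed
  let ?g = "path_image (curve e)"
  have part_curve: "part b \<inter> ?g \<subseteq> pos ` {v \<in> {head G e, tail G e}. reach v = b}" for b
  proof
    fix x assume x: "x \<in> part b \<inter> ?g"
    have "x \<in> pos ` verts G"
    proof (rule ccontr)
      assume nv: "x \<notin> pos ` verts G"
      then obtain a where "a \<in> F" "x \<in> path_image (curve a)" using x unfolding part_def by blast
      moreover then have "a \<noteq> e" "a \<in> arcs G" using F by auto
      ultimately show False using curves_meet[OF e, of a] x nv by auto
    qed
    then have "x \<in> {pos (tail G e), pos (head G e)}" "x \<in> pos ` {v \<in> verts G. reach v = b}"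
      using curve_props(4)[OF e] part_verts[of x b] x by auto
    then obtain u v where "u \<in> {head G e, tail G e}" "x = pos u" "v \<in> verts G" "reach v = b" "x = pos v"
      by auto
    moreover then have "u = v" using inj_onD[OF inj_pos, of u v] e by auto
    ultimately show "x \<in> pos ` {v \<in> {head G e, tail G e}. reach v = b}" by blast
  qed
  have ends: "pos (head G e) \<in> ?g" "pos (tail G e) \<in> ?g"
    using curve_props(4)[OF e] by auto
  have "part True \<inter> ?g \<subseteq> {pos (head G e)}" using part_curve[of True] rt by auto
  moreover have "pos (head G e) \<in> part True" using rh e by (auto simp: part_def)
  ultimately have pT: "part True \<inter> ?g = {pos (head G e)}" using ends by blast
  have "part False \<inter> ?g \<subseteq> {pos (tail G e)}" using part_curve[of False] rh by auto
  moreover have "pos (tail G e) \<in> part False" using rt e by (auto simp: part_def)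
  ultimately have pF: "part False \<inter> ?g = {pos (tail G e)}" using ends by blast
  have union: "skel (insert e F) = part True \<union> (part False \<union> ?g)"
    unfolding skel_insert skel_def part_def by blast
  define p where "p = curve e (1/2)"
  obtain r P N h where c: "side_chart (skel (arcs G - {e})) (curve e) (1/2) r P N h"
    and PN: "P \<subseteq> left_face e" "N \<subseteq> right_face e"
    using chart[OF e, of "1/2"] by auto
  have "P \<noteq> {}" "N \<noteq> {}" using c by (auto simp: side_chart_def)
  then obtain x y where xy: "x \<in> P" "y \<in> N" by blast
  have "P \<union> N = ball p r - ?g" "ball p r \<inter> skel (arcs G - {e}) = {}"
    using c by (simp_all add: side_chart_def p_def)
  moreover have "skel F \<subseteq> skel (arcs G - {e})" using F by (rule skel_mono)
  moreover have "part b \<subseteq> skel F" for b unfolding part_def skel_def by blast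
  ultimately have ball: "x \<in> ball p r" "y \<in> ball p r" "x \<notin> ?g" "y \<notin> ?g" "ball p r \<subseteq> - part b" for b
    using xy by blast+
  have cb: "connected_component (- part b) x y" for b
    using ball by (intro connected_componentI[of "ball p r"]) auto
  \<comment> \<open>An arc does not separate the plane.\<close>
  have cg: "connected_component (- ?g) x y"
    using connected_arc_complement[OF arc_curve[OF e]] ball
    by (intro connected_componentI[of "- ?g"]) auto
  have cF: "connected_component (- (part False \<union> ?g)) x y"
    by (rule Janiszewski[OF comp _ _ cb cg])
      (use pF in \<open>simp_all add: compact_imp_closed compact_simple_path_image curve_props e\<close>)
  have "connected_component (- (part True \<union> (part False \<union> ?g))) x y"
  proof (rule Janiszewski[OF comp _ _ cb cF])
    show "closed (part False \<union> ?g)"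
      by (intro closed_Un compact_imp_closed comp compact_simple_path_image curve_props e)
    have "part True \<inter> (part False \<union> ?g) = {pos (head G e)}" using disj pT by blast
    then show "topological_space_class.connected (part True \<inter> (part False \<union> ?g))" by simp
  qed
  then have xy': "connected_component (- skel (insert e F)) x y" by (simp only: union)
  have sub: "insert e F \<subseteq> arcs G" using e F by auto
  have "connected_component (- skel (insert e F)) (lpt e) x" "connected_component (- skel (insert e F)) (rpt e) y"
    using face_connected[OF left_face_in[OF e] _ sub] face_connected[OF right_face_in[OF e] _ sub] xy PN by auto
  then show ?thesis using xy' by (meson connected_component_sym connected_component_trans)
qed

text \<open>The common value of \<open>g\<close> on the two sides of \<open>e\<close> is used on the
  curve as well. Near an interior point of the curve the chart shows nothing but these two sides, so
  \<open>g'\<close> is locally constant off \<open>skel F\<close>.\<close>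

lemma locally_constant_extend:
  fixes g :: "complex \<Rightarrow> 'a"
  assumes e: "e \<in> arcs G" and F: "F \<subseteq> arcs G - {e}"
    and g: "\<And>x y. connected_component (- skel (insert e F)) x y \<Longrightarrow> g x = g y"
    and eq: "g (lpt e) = g (rpt e)"
    and xy: "connected_component (- skel F) x y"
  defines "g' \<equiv> \<lambda>x. if x \<in> skel (insert e F) then g (rpt e) else g x"
  shows "g' x = g' y"
proof -
  have sub: "insert e F \<subseteq> arcs G" using e F by auto
  obtain C where C: "topological_space_class.connected C" "C \<subseteq> - skel F" "x \<in> C" "y \<in> C"
    using xy by (auto simp: connected_component_def)
  have loc: "\<exists>d>0. \<forall>b\<in>C. dist b a < d \<longrightarrow> g' a = g' b" if a: "a \<in> C" for a
  proof (cases "a \<in> skel (insert e F)")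
    case False
    have "open (- skel (insert e F))" using closed_skel[OF sub] by auto
    then obtain d where d: "d > 0" "ball a d \<subseteq> - skel (insert e F)"
      using False by (metis ComplI openE)
    have "g' a = g' b" if "dist b a < d" for b
    proof -
      have b: "b \<in> ball a d" "a \<in> ball a d" using that d by (auto simp: dist_commute)
      then have "connected_component (- skel (insert e F)) a b"
        using d by (intro connected_componentI[of "ball a d"]) auto
      then have "g a = g b" by (rule g)
      moreover have "b \<notin> skel (insert e F)" using b d by auto
      ultimately show ?thesis using False by (simp add: g'_def)
    qed
    then show ?thesis using d by blast
  next
    case True
    have aF: "a \<notin> skel F" using a C by auto
    then have "a \<in> path_image (curve e)" using True by (auto simp: skel_insert)
    from curve_point_cases[OF e this aF] obtain t where t: "0 < t" "t < 1" "a = curve e t" .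
    obtain r P N h where c: "side_chart (skel (arcs G - {e})) (curve e) t r P N h"
      and PN: "P \<subseteq> left_face e" "N \<subseteq> right_face e"
      using chart[OF e t(1,2)] by auto
    have r: "r > 0" "ball a r - path_image (curve e) = P \<union> N" using c t by (simp_all add: side_chart_def)
    have ga: "g' a = g (rpt e)" using True by (simp add: g'_def)
    have "g' b = g (rpt e)" if b: "dist b a < r" for b
    proof (cases "b \<in> skel (insert e F)")
      case True
      then show ?thesis by (simp add: g'_def)
    next
      case False
      then have "b \<notin> path_image (curve e)" by (simp add: skel_insert)
      moreover have "b \<in> ball a r" using b by (simp add: dist_commute)
      ultimately have "b \<in> P \<union> N" using r(2) by blast
      then have "g b = g (rpt e)"
      proof
        assume "b \<in> P"
        then have "connected_component (- skel (insert e F)) (lpt e) b"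
          using PN face_connected[OF left_face_in[OF e] _ sub] by auto
        then show ?thesis using g eq by metis
      next
        assume "b \<in> N"
        then have "connected_component (- skel (insert e F)) (rpt e) b"
          using PN face_connected[OF right_face_in[OF e] _ sub] by auto
        then show ?thesis using g by metis
      qed
      then show ?thesis using False by (simp add: g'_def)
    qed
    then show ?thesis using r(1) ga by auto
  qed
  show ?thesis
  proof (rule connected_local_const[OF C(1,3,4)])
    show "\<forall>a\<in>C. \<forall>\<^sub>F b in at a within C. g' a = g' b"
    proof
      fix a assume "a \<in> C"
      from loc[OF this] show "\<forall>\<^sub>F b in at a within C. g' a = g' b"
        unfolding eventually_at by blast
    qed
  qed
qed

text \<open>Functions that are locally constant off \<open>skel F\<close> replace functions on
  faces, since deleting arrows merges faces while the sample points stay the same.\<close>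

lemma locally_constant_difference_is_cycle:
  fixes g :: "complex \<Rightarrow> 'a::comm_ring_1"
  assumes "F \<subseteq> arcs G"
    and "\<And>x y. connected_component (- skel F) x y \<Longrightarrow> g x = g y"
  shows "is_cycle F (\<lambda>e. g (lpt e) - g (rpt e))"
proof -
  have "finite F" using assms(1) by (rule finite_subset) simp
  then show ?thesis using assms
  proof (induction F arbitrary: g rule: finite_induct)
    case empty
    show ?case by (simp add: is_cycle_def bdry_def)
  next
    case (insert e F)
    have e: "e \<in> arcs G" and F: "F \<subseteq> arcs G - {e}" and sub: "F \<subseteq> arcs G"
      using insert.prems(1) insert.hyps(2) by auto
    \<comment> \<open>If \<open>k\<close> agrees on both sides of \<open>e\<close>, the coefficient
      of \<open>e\<close> is 0 and the claim reduces to \<open>F\<close>, after \<open>k\<close> is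
      extended over the curve.\<close>
    have main: "is_cycle (insert e F) (\<lambda>e. k (lpt e) - k (rpt e))"
      if k: "\<And>x y. connected_component (- skel (insert e F)) x y \<Longrightarrow> k x = k y"
        and keq: "k (lpt e) = k (rpt e)" for k :: "complex \<Rightarrow> 'a"
    proof -
      let ?k = "\<lambda>x. if x \<in> skel (insert e F) then k (rpt e) else k x"
      have "is_cycle F (\<lambda>e. ?k (lpt e) - ?k (rpt e))"
        by (rule insert.IH[OF sub]) (rule locally_constant_extend[OF e F k keq])
      moreover have "bdry F (\<lambda>e. ?k (lpt e) - ?k (rpt e)) v = bdry F (\<lambda>e. k (lpt e) - k (rpt e)) v" for v
      proof (rule bdry_cong)
        fix a assume "a \<in> F"
        then have "a \<in> arcs G" using sub by auto
        then have "lpt a \<notin> skel (insert e F)" "rpt a \<notin> skel (insert e F)"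
          using face_point_notin_skel[OF left_face_in] face_point_notin_skel[OF right_face_in]
            skel_mono[OF insert.prems(1)] by auto
        then show "?k (lpt a) - ?k (rpt a) = k (lpt a) - k (rpt a)" by simp
      qed
      ultimately show ?thesis
        by (simp add: is_cycle_def bdry_insert[OF insert.hyps(1,2)] keq)
    qed
    show ?case
    proof (cases "g (lpt e) = g (rpt e)")
      case True
      then show ?thesis using main insert.prems(2) by blast
    next
      case False
      \<comment> \<open>Contrapositive of \<open>bridge_sides_connected\<close>: different values on
        the two sides mean that these are not connected off the drawing.\<close>
      then have "\<exists>z :: 'e \<Rightarrow> int. is_cycle (insert e F) z \<and> z e = 1"
        using bridge_sides_connected[OF e F] insert.prems(2) by blast
      then obtain z :: "'e \<Rightarrow> int" where z: "is_cycle (insert e F) z" "z e = 1" by blast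
      obtain n :: "complex \<Rightarrow> int" where
        n: "\<And>x y. connected_component (- skel (insert e F)) x y \<Longrightarrow> n x = n y"
        and nz: "\<And>a. a \<in> insert e F \<Longrightarrow> n (lpt a) - n (rpt a) = z a"
        using cycle_potential[OF z(1) insert.prems(1)] by metis
      define c where "c = g (lpt e) - g (rpt e)"
      \<comment> \<open>The potential \<open>n\<close> jumps by 1 across \<open>e\<close>, so
        subtracting \<open>c\<close> times it removes the difference there. On the other arrows it
        changes the vector only by a multiple of the cycle \<open>z\<close>.\<close>
      define k where "k x = g x - c * of_int (n x)" for x
      have jump: "k (lpt a) - k (rpt a) = g (lpt a) - g (rpt a) - c * of_int (z a)" if "a \<in> insert e F" for a
        unfolding nz[OF that, symmetric] by (simp add: k_def algebra_simps)
      have "k (lpt e) - k (rpt e) = 0" using jump[of e] z(2) by (simp add: c_def)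
      moreover have "k x = k y" if "connected_component (- skel (insert e F)) x y" for x y
        using n[OF that] insert.prems(2)[OF that] by (simp add: k_def)
      ultimately have "is_cycle (insert e F) (\<lambda>e. k (lpt e) - k (rpt e))"
        by (intro main) auto
      moreover have "is_cycle (insert e F) (\<lambda>a. of_int (z a) :: 'a)"
        by (rule is_cycle_of_int[OF z(1)])
      then have "is_cycle (insert e F) (\<lambda>a. c * of_int (z a))"
        unfolding is_cycle_def bdry_scale by simp
      ultimately have "is_cycle (insert e F) (\<lambda>a. (k (lpt a) - k (rpt a)) + c * of_int (z a))"
        unfolding is_cycle_def bdry_add by simp
      moreover have "bdry (insert e F) (\<lambda>a. (k (lpt a) - k (rpt a)) + c * of_int (z a)) v =
          bdry (insert e F) (\<lambda>a. g (lpt a) - g (rpt a)) v" for v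
        by (rule bdry_cong) (simp add: jump)
      ultimately show ?thesis unfolding is_cycle_def by simp
    qed
  qed
qed

lemma face_difference_is_cycle:
  fixes g :: "complex set \<Rightarrow> 'a::comm_ring_1"
  shows "is_cycle (arcs G) (\<lambda>e. g (left_face e) - g (right_face e))"
proof -
  let ?M = "- skel (arcs G)"
  have comp: "connected_component_set ?M (face_point f) = f" if "f \<in> faces G pos curve" for f
  proof -
    have f: "f \<in> components ?M" using that by (simp add: faces_def drawing_eq_skel)
    then obtain x where x: "x \<in> ?M" "f = connected_component_set ?M x" by (auto simp: components_def)
    then show ?thesis using face_point_in[OF that] connected_component_eq[of "face_point f" ?M x] by simp
  qed
  have "is_cycle (arcs G) (\<lambda>e. g (connected_component_set ?M (lpt e)) - g (connected_component_set ?M (rpt e)))"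
    by (rule locally_constant_difference_is_cycle[OF subset_refl, of "\<lambda>x. g (connected_component_set ?M x)"])
      (simp add: connected_component_eq)
  moreover have "bdry (arcs G) (\<lambda>e. g (connected_component_set ?M (lpt e)) - g (connected_component_set ?M (rpt e))) v
     = bdry (arcs G) (\<lambda>e. g (left_face e) - g (right_face e)) v" for v
    by (rule bdry_cong) (simp add: comp left_face_in right_face_in)
  ultimately show ?thesis by (simp add: is_cycle_def)
qed

lemma integer_cycle_is_face_difference:
  fixes z :: "'e \<Rightarrow> int"
  assumes "is_cycle (arcs G) z"
  obtains n :: "complex set \<Rightarrow> int" where "\<And>e. e \<in> arcs G \<Longrightarrow> n (left_face e) - n (right_face e) = z e"
proof -
  obtain n :: "complex \<Rightarrow> int" where "\<And>e. e \<in> arcs G \<Longrightarrow> n (lpt e) - n (rpt e) = z e"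
    using cycle_potential[OF assms subset_refl] by metis
  then show thesis by (intro that[of "\<lambda>f. n (face_point f)"]) auto
qed

end

section \<open>Cuts and face vectors\<close>

text \<open>Gram-Schmidt without assuming independence: the new vector \<open>b w\<close> is
  replaced by its component \<open>a\<close> orthogonal to the earlier ones. The order of the field
  enters when a vanishing sum of squares forces \<open>a\<close> to vanish.\<close>

lemma orthogonal_projection_exists:
  fixes b :: "'i \<Rightarrow> 'e \<Rightarrow> 'a::linordered_field"
  assumes "finite I" "finite E"
  shows "\<exists>c. \<forall>v\<in>I. (\<Sum>e\<in>E. (x e - (\<Sum>u\<in>I. c u * b u e)) * b v e) = 0"
  using \<open>finite I\<close>
proof (induction I arbitrary: x rule: finite_induct)
  case (insert w I)
  obtain c0 where c0: "\<forall>v\<in>I. (\<Sum>e\<in>E. (x e - (\<Sum>u\<in>I. c0 u * b u e)) * b v e) = 0"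
    using insert.IH by blast
  obtain c1 where c1: "\<forall>v\<in>I. (\<Sum>e\<in>E. (b w e - (\<Sum>u\<in>I. c1 u * b u e)) * b v e) = 0"
    using insert.IH by blast
  define r where "r e = x e - (\<Sum>u\<in>I. c0 u * b u e)" for e
  define a where "a e = b w e - (\<Sum>u\<in>I. c1 u * b u e)" for e
  define aa where "aa = (\<Sum>e\<in>E. a e * a e)"
  \<comment> \<open>If \<open>aa\<close> is 0, the value of \<open>l\<close> is immaterial, because
    \<open>a\<close> is then zero on \<open>E\<close>.\<close>
  define l where "l = (\<Sum>e\<in>E. r e * a e) / aa"
  define c where "c = (\<lambda>u. if u = w then l else c0 u - l * c1 u)"
  have res: "x e - (\<Sum>u\<in>insert w I. c u * b u e) = r e - l * a e" for e
  proof -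
    have "(\<Sum>u\<in>I. c u * b u e) = (\<Sum>u\<in>I. c0 u * b u e - l * (c1 u * b u e))"
      using insert.hyps(2) by (intro sum.cong) (auto simp: c_def algebra_simps)
    then have "(\<Sum>u\<in>insert w I. c u * b u e)
        = l * b w e + ((\<Sum>u\<in>I. c0 u * b u e) - l * (\<Sum>u\<in>I. c1 u * b u e))"
      using insert.hyps by (simp add: c_def sum_subtractf sum_distrib_left)
    then show ?thesis by (simp add: r_def a_def algebra_simps)
  qed
  have orth: "(\<Sum>e\<in>E. (r e - l * a e) * b v e) = 0" if "v \<in> I" for v
  proof -
    have "(\<Sum>e\<in>E. (r e - l * a e) * b v e) = (\<Sum>e\<in>E. r e * b v e) - l * (\<Sum>e\<in>E. a e * b v e)"
      by (simp add: left_diff_distrib sum_subtractf sum_distrib_left mult.assoc)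
    then show ?thesis using c0 c1 that by (simp add: r_def a_def)
  qed
  have la: "(\<Sum>e\<in>E. (r e - l * a e) * a e) = 0"
  proof (cases "aa = 0")
    case True
    then have "\<forall>e\<in>E. a e * a e = 0" unfolding aa_def
      by (subst (asm) sum_nonneg_eq_0_iff) (use assms(2) in auto)
    then show ?thesis by simp
  next
    case False
    have "(\<Sum>e\<in>E. (r e - l * a e) * a e) = (\<Sum>e\<in>E. r e * a e) - l * aa"
      by (simp add: left_diff_distrib sum_subtractf sum_distrib_left mult.assoc aa_def)
    then show ?thesis using False by (simp add: l_def)
  qed
  \<comment> \<open>\<open>b w\<close> is \<open>a\<close> plus a combination of the earlier
    vectors, and the residue is orthogonal to all of these.\<close>
  have "(\<Sum>e\<in>E. (r e - l * a e) * b w e)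
      = (\<Sum>e\<in>E. (r e - l * a e) * a e) + (\<Sum>e\<in>E. \<Sum>u\<in>I. c1 u * ((r e - l * a e) * b u e))"
    unfolding sum.distrib[symmetric]
  proof (rule sum.cong)
    fix e
    have "b w e = a e + (\<Sum>u\<in>I. c1 u * b u e)" by (simp add: a_def)
    then show "(r e - l * a e) * b w e = (r e - l * a e) * a e + (\<Sum>u\<in>I. c1 u * ((r e - l * a e) * b u e))"
      by (simp only: distrib_left sum_distrib_left mult.left_commute)
  qed simp
  also have "(\<Sum>e\<in>E. \<Sum>u\<in>I. c1 u * ((r e - l * a e) * b u e))
      = (\<Sum>u\<in>I. c1 u * (\<Sum>e\<in>E. (r e - l * a e) * b u e))"
    by (subst sum.swap) (simp only: sum_distrib_left)
  also have "\<dots> = 0" using orth by simp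
  finally have "(\<Sum>e\<in>E. (r e - l * a e) * b w e) = 0" using la by simp
  then have "\<forall>v\<in>insert w I. (\<Sum>e\<in>E. (x e - (\<Sum>u\<in>insert w I. c u * b u e)) * b v e) = 0"
    unfolding res using orth by blast
  then show ?case by blast
qed simp

lemma common_denominator:
  fixes z :: "'e \<Rightarrow> rat"
  assumes "finite E"
  obtains N :: int and y :: "'e \<Rightarrow> int" where "0 < N" "\<And>e. e \<in> E \<Longrightarrow> z e = of_int (y e) / of_int N"
proof -
  have "\<exists>N>0. \<forall>e\<in>E. \<exists>m::int. of_int N * z e = of_int m"
    using assms
  proof (induction E rule: finite_induct)
    case empty
    show ?case by (intro exI[of _ 1]) simp
  next
    case (insert a E)
    then obtain N where N: "N > 0" "\<forall>e\<in>E. \<exists>m::int. of_int N * z e = of_int m" by blast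
    obtain p q where pq: "quotient_of (z a) = (p, q)" by fastforce
    then have q: "q > 0" "z a = of_int p / of_int q"
      using quotient_of_denom_pos quotient_of_div by blast+
    show ?case
    proof (rule exI[of _ "N * q"], intro conjI ballI)
      show "0 < N * q" using N q by simp
      fix e assume e: "e \<in> insert a E"
      show "\<exists>m::int. of_int (N * q) * z e = of_int m"
      proof (cases "e = a")
        case True
        then show ?thesis using q by (intro exI[of _ "N * p"]) simp
      next
        case False
        then obtain m :: int where "of_int N * z e = of_int m" using N e by auto
        then have "of_int (N * q) * z e = of_int (m * q)" by (simp add: mult.commute mult.left_commute)
        then show ?thesis by blast
      qed
    qed
  qed
  then obtain N where N: "N > 0" "\<forall>e\<in>E. \<exists>m::int. of_int N * z e = of_int m" by blast
  then obtain y :: "'e \<Rightarrow> int" where y: "\<And>e. e \<in> E \<Longrightarrow> of_int N * z e = of_int (y e)" by metis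
  show thesis
  proof (rule that[of N y, OF N(1)])
    fix e assume "e \<in> E"
    from y[OF this] N(1) show "z e = of_int (y e) / of_int N"
      by (simp add: eq_divide_eq mult.commute)
  qed
qed

context planar_quiver begin

text \<open>The projection to the cuts supplies \<open>\<phi>\<close>. The remainder is orthogonal
  to all cuts, hence a cycle, and its potential on the faces, divided by the common denominator,
  supplies \<open>g\<close>.\<close>

lemma unit_vector_decomposition:
  assumes a: "a \<in> arcs G"
  obtains \<phi> :: "'v \<Rightarrow> 'k::field_char_0" and g :: "complex set \<Rightarrow> 'k"
  where "\<And>e. e \<in> arcs G \<Longrightarrow> of_bool (e = a) =
    (\<phi> (tail G e) - \<phi> (head G e)) + (g (left_face e) - g (right_face e))"
proof -
  \<comment> \<open>The cuts of single vertices. They span all cuts, and pairing with the cut of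
    \<open>v\<close> is, up to sign, the boundary at \<open>v\<close>.\<close>
  let ?b = "\<lambda>v e. of_bool (tail G e = v) - of_bool (head G e = v) :: rat"
  obtain c where c: "\<forall>v\<in>verts G. (\<Sum>e\<in>arcs G. (of_bool (e = a) - (\<Sum>u\<in>verts G. c u * ?b u e)) * ?b v e) = 0"
    using orthogonal_projection_exists[OF finite_verts finite_arcs, of "\<lambda>e. of_bool (e = a)" ?b] by blast
  have cob: "(\<Sum>u\<in>verts G. c u * ?b u e) = c (tail G e) - c (head G e)" if "e \<in> arcs G" for e
  proof -
    have "(\<Sum>u\<in>verts G. c u * ?b u e) =
      (\<Sum>u\<in>verts G. (if tail G e = u then c u else 0) - (if head G e = u then c u else 0))"
      by (intro sum.cong) auto
    then show ?thesis using that by (simp add: sum_subtractf)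
  qed
  define z where "z e = of_bool (e = a) - (c (tail G e) - c (head G e))" for e
  have zc: "is_cycle (arcs G) z"
    unfolding is_cycle_def
  proof
    fix v assume v: "v \<in> verts G"
    have "bdry (arcs G) z v = - (\<Sum>e\<in>arcs G. (of_bool (e = a) - (\<Sum>u\<in>verts G. c u * ?b u e)) * ?b v e)"
      unfolding bdry_def sum_negf[symmetric]
    proof (rule sum.cong)
      fix e assume "e \<in> arcs G"
      show "z e * (of_bool (head G e = v) - of_bool (tail G e = v)) =
        - ((of_bool (e = a) - (\<Sum>u\<in>verts G. c u * ?b u e)) * ?b v e)"
        unfolding cob[OF \<open>e \<in> arcs G\<close>] z_def by (simp add: algebra_simps)
    qed simp
    then show "bdry (arcs G) z v = 0" using c v by simp
  qed
  obtain N :: int and y :: "'e \<Rightarrow> int" where N: "0 < N" and y: "\<And>e. e \<in> arcs G \<Longrightarrow> z e = of_int (y e) / of_int N"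
    using common_denominator[OF finite_arcs, of z] by blast
  have "is_cycle (arcs G) y"
    unfolding is_cycle_def
  proof
    fix v assume v: "v \<in> verts G"
    have "of_int (bdry (arcs G) y v) = bdry (arcs G) (\<lambda>e. of_int N * z e) v"
      unfolding bdry_of_int[symmetric] using N by (intro bdry_cong) (simp add: y)
    also have "\<dots> = 0" using zc v by (simp add: bdry_scale is_cycle_def)
    finally show "bdry (arcs G) y v = 0" by simp
  qed
  then obtain n :: "complex set \<Rightarrow> int" where
    n: "\<And>e. e \<in> arcs G \<Longrightarrow> n (left_face e) - n (right_face e) = y e"
    using integer_cycle_is_face_difference by blast
  show thesis
  proof (rule that[of "\<lambda>v. of_rat (c v)" "\<lambda>f. of_rat (of_int (n f) / of_int N)"])
    fix e assume e: "e \<in> arcs G"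
    have "z e = of_int (n (left_face e)) / of_int N - of_int (n (right_face e)) / of_int N"
      using y[OF e] by (simp add: n[OF e, symmetric] diff_divide_distrib)
    then have "of_bool (e = a) = (c (tail G e) - c (head G e)) +
        (of_int (n (left_face e)) / of_int N - of_int (n (right_face e)) / of_int N)"
      by (simp add: z_def)
    then have "of_rat (of_bool (e = a)) = (of_rat ((c (tail G e) - c (head G e)) +
        (of_int (n (left_face e)) / of_int N - of_int (n (right_face e)) / of_int N)) :: 'k)"
      by (simp only:)
    then show "of_bool (e = a) = of_rat (c (tail G e)) - of_rat (c (head G e)) +
        (of_rat (of_int (n (left_face e)) / of_int N) - of_rat (of_int (n (right_face e)) / of_int N) :: 'k)"
      by (simp only: of_rat_add of_rat_diff) (cases "e = a"; simp)
  qed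
qed

text \<open>Linear extension from the unit vectors, whose decompositions exist already over the
  rationals.\<close>

lemma cut_plus_face:
  fixes x :: "'e \<Rightarrow> 'k::field_char_0"
  obtains \<phi> :: "'v \<Rightarrow> 'k" and g :: "complex set \<Rightarrow> 'k"
  where "\<And>e. e \<in> arcs G \<Longrightarrow> x e = (\<phi> (tail G e) - \<phi> (head G e)) + (g (left_face e) - g (right_face e))"
proof -
  have "\<forall>a. \<exists>\<phi> g. a \<in> arcs G \<longrightarrow> (\<forall>e\<in>arcs G. (of_bool (e = a) :: 'k) =
    (\<phi> (tail G e) - \<phi> (head G e)) + (g (left_face e) - g (right_face e)))"
    by (metis unit_vector_decomposition)
  then obtain \<phi> g where u: "\<And>a e. a \<in> arcs G \<Longrightarrow> e \<in> arcs G \<Longrightarrow> (of_bool (e = a) :: 'k) =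
    (\<phi> a (tail G e) - \<phi> a (head G e)) + (g a (left_face e) - g a (right_face e))"
    by metis
  show thesis
  proof (rule that[of "\<lambda>v. \<Sum>a\<in>arcs G. x a * \<phi> a v" "\<lambda>f. \<Sum>a\<in>arcs G. x a * g a f"])
    fix e assume e: "e \<in> arcs G"
    have "x e = (\<Sum>a\<in>arcs G. if e = a then x a else 0)" using e by simp
    also have "\<dots> = (\<Sum>a\<in>arcs G. x a * of_bool (e = a))" by (intro sum.cong) auto
    also have "\<dots> = (\<Sum>a\<in>arcs G. x a * ((\<phi> a (tail G e) - \<phi> a (head G e)) + (g a (left_face e) - g a (right_face e))))"
      by (intro sum.cong) (simp_all only: u[OF _ e])
    also have "\<dots> = ((\<Sum>a\<in>arcs G. x a * \<phi> a (tail G e)) - (\<Sum>a\<in>arcs G. x a * \<phi> a (head G e))) +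
       ((\<Sum>a\<in>arcs G. x a * g a (left_face e)) - (\<Sum>a\<in>arcs G. x a * g a (right_face e)))"
      by (simp only: right_diff_distrib distrib_left sum.distrib sum_subtractf)
    finally show "x e = \<dots>" .
  qed
qed

text \<open>
  Cuts are orthogonal to cycles, in particular to face differences, so a vector that is both is
  orthogonal to cuts and to face differences, which together span.
\<close>

lemma cut_meets_face_trivially:
  fixes \<phi> :: "'v \<Rightarrow> 'k::field_char_0" and g :: "complex set \<Rightarrow> 'k"
  assumes eq: "\<And>e. e \<in> arcs G \<Longrightarrow> \<phi> (tail G e) - \<phi> (head G e) = g (left_face e) - g (right_face e)"
    and a: "a \<in> arcs G"
  shows "\<phi> (tail G a) - \<phi> (head G a) = 0"
proof -
  define x where "x e = g (left_face e) - g (right_face e)" for e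
  have x: "is_cycle (arcs G) x" unfolding x_def by (rule face_difference_is_cycle)
  obtain \<psi> :: "'v \<Rightarrow> 'k" and k :: "complex set \<Rightarrow> 'k" where
    u: "\<And>e. e \<in> arcs G \<Longrightarrow> of_bool (e = a) = (\<psi> (tail G e) - \<psi> (head G e)) + (k (left_face e) - k (right_face e))"
    using unit_vector_decomposition[OF a] by blast
  define y where "y e = k (left_face e) - k (right_face e)" for e
  have y: "is_cycle (arcs G) y" unfolding y_def by (rule face_difference_is_cycle)
  have "x a = (\<Sum>e\<in>arcs G. if e = a then x e else 0)" using a by simp
  also have "\<dots> = (\<Sum>e\<in>arcs G. x e * of_bool (e = a))" by (intro sum.cong) auto
  also have "\<dots> = (\<Sum>e\<in>arcs G. - (x e * (\<psi> (head G e) - \<psi> (tail G e))) + - (y e * (\<phi> (head G e) - \<phi> (tail G e))))"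
  proof (rule sum.cong)
    fix e assume e: "e \<in> arcs G"
    have "x e * of_bool (e = a) = x e * (\<psi> (tail G e) - \<psi> (head G e)) + x e * y e"
      by (simp only: u[OF e] y_def distrib_left)
    \<comment> \<open>Here \<open>x\<close> is read as the cut of \<open>\<phi>\<close> and paired
      with the cycle \<open>y\<close>; in the other term \<open>x\<close> is the cycle and is paired
      with the cut of \<open>\<psi>\<close>.\<close>
    also have "x e * y e = y e * (\<phi> (tail G e) - \<phi> (head G e))"
      using eq[OF e] by (simp add: x_def)
    finally show "x e * of_bool (e = a) =
        - (x e * (\<psi> (head G e) - \<psi> (tail G e))) + - (y e * (\<phi> (head G e) - \<phi> (tail G e)))"
      by (simp only: mult_minus_right[symmetric] minus_diff_eq)
  qed simp
  also have "\<dots> = 0"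
    unfolding sum.distrib sum_negf cycle_pairing[OF x subset_refl] cycle_pairing[OF y subset_refl] by simp
  finally show ?thesis using eq[OF a] by (simp add: x_def)
qed

end

section \<open>The first Hochschild cohomology of a plane acyclic quiver\<close>

locale planar_quiver_algebra = acyclic_quiver_algebra G field_type + planar_quiver G pos curve
  for G :: "('v, 'e) pre_digraph" and field_type :: "'k::field_char_0 itself"
    and pos :: "'v \<Rightarrow> complex" and curve :: "'e \<Rightarrow> real \<Rightarrow> complex"
begin

lemma diagonal_admissible: "admissible (\<lambda>e. x e \<cdot> arrow e)"
  unfolding admissible_def
proof (intro ballI conjI allI impI)
  fix e assume e: "e \<in> arcs G"
  show "x e \<cdot> arrow e \<in> carrier A" by (simp add: closed arrow_closed[OF e])
  fix p assume "(x e \<cdot> arrow e) p \<noteq> 0"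
  then have "p = arrow_path G e" by (auto simp: smult_apply dest: vec_nonzero)
  then show "parallel G p (arrow_path G e)" by (simp add: parallel_def)
qed

lemma face_derivation_Der0:
  shows "face_derivation G curve f \<in> Der0"
    and "e \<in> arcs G \<Longrightarrow> face_derivation G curve f (arrow e) = face_coeff curve f e \<cdot> arrow e"
proof -
  have "face_derivation G curve f = arrow_derivation G (\<lambda>e. face_coeff curve f e \<cdot> arrow e)"
    unfolding face_derivation_def by (rule arg_cong[of _ _ "arrow_derivation G"]) (intro ext, simp only: smult_apply)
  then show "face_derivation G curve f \<in> Der0"
    "e \<in> arcs G \<Longrightarrow> face_derivation G curve f (arrow e) = face_coeff curve f e \<cdot> arrow e"
    using arrow_derivation_Der0[OF diagonal_admissible] by simp_all
qed

text \<open>A description of \<open>D_F\<close> without spans, see \<open>D_F_eq\<close>. The order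
  left minus right is that of the winding function, so \<open>g f\<close> is minus the coefficient
  of the face derivation of \<open>f\<close>.\<close>

definition F_der :: "((('v, 'e) qpath \<Rightarrow> 'k) \<Rightarrow> ('v, 'e) qpath \<Rightarrow> 'k) set" where
  "F_der = {D \<in> Der0. \<exists>g. \<forall>e\<in>arcs G. D (arrow e) = (g (left_face e) - g (right_face e)) \<cdot> arrow e}"

lemma F_derI:
  "D \<in> Der0 \<Longrightarrow> (\<And>e. e \<in> arcs G \<Longrightarrow> D (arrow e) = (g (left_face e) - g (right_face e)) \<cdot> arrow e) \<Longrightarrow> D \<in> F_der"
  by (auto simp: F_der_def)

lemma F_derE:
  assumes "D \<in> F_der"
  obtains g where "D \<in> Der0" "\<forall>e\<in>arcs G. D (arrow e) = (g (left_face e) - g (right_face e)) \<cdot> arrow e"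
  using assms by (auto simp: F_der_def)

lemma F_der_subspace: "linear_subspace (Der A) F_der"
proof (rule linear_subspaceI[OF module_Der])
  show "F_der \<subseteq> carrier (Der A)" by (auto simp: F_der_def Der0_def Der_simps)
  show "\<zero>\<^bsub>Der A\<^esub> \<in> F_der"
    by (rule F_derI[of _ "\<lambda>_. 0"]) (simp_all add: Der0_closed Der_arrow smult_zero_left arrow_closed)
next
  fix D E assume D: "D \<in> F_der" and E: "E \<in> F_der"
  obtain g where g: "D \<in> Der0" "\<forall>e\<in>arcs G. D (arrow e) = (g (left_face e) - g (right_face e)) \<cdot> arrow e"
    using D by (rule F_derE)
  obtain k where k: "E \<in> Der0" "\<forall>e\<in>arcs G. E (arrow e) = (k (left_face e) - k (right_face e)) \<cdot> arrow e"
    using E by (rule F_derE)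
  show "D \<oplus>\<^bsub>Der A\<^esub> E \<in> F_der"
  proof (rule F_derI[of _ "\<lambda>f. g f + k f"])
    fix e assume e: "e \<in> arcs G"
    show "(D \<oplus>\<^bsub>Der A\<^esub> E) (arrow e) =
        (g (left_face e) + k (left_face e) - (g (right_face e) + k (right_face e))) \<cdot> arrow e"
      unfolding Der_arrow[OF e] bspec[OF g(2) e] bspec[OF k(2) e]
      by (auto simp: fun_eq_iff smult_apply algebra_simps)
  qed (intro Der0_add g k)
next
  fix c D assume D: "D \<in> F_der"
  obtain g where g: "D \<in> Der0" "\<forall>e\<in>arcs G. D (arrow e) = (g (left_face e) - g (right_face e)) \<cdot> arrow e"
    using D by (rule F_derE)
  show "c \<odot>\<^bsub>Der A\<^esub> D \<in> F_der"
  proof (rule F_derI[of _ "\<lambda>f. c * g f"])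
    fix e assume e: "e \<in> arcs G"
    show "(c \<odot>\<^bsub>Der A\<^esub> D) (arrow e) = (c * g (left_face e) - c * g (right_face e)) \<cdot> arrow e"
      unfolding Der_arrow[OF e] bspec[OF g(2) e]
      by (auto simp: fun_eq_iff smult_apply algebra_simps)
  qed (intro Der0_smult g)
qed

lemma face_derivation_F_der:
  assumes f: "f \<in> faces G pos curve"
  shows "face_derivation G curve f \<in> F_der"
proof (rule F_derI[of _ "\<lambda>f'. - of_bool (f = f')"])
  fix e assume e: "e \<in> arcs G"
  show "face_derivation G curve f (arrow e) =
    (- of_bool (f = left_face e) - - of_bool (f = right_face e)) \<cdot> arrow e"
    unfolding face_derivation_Der0(2)[OF e] face_coeff_eq[OF e f] by simp
qed (rule face_derivation_Der0)

text \<open>One face is removed at a time: adding \<open>g f\<close> times its face derivation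
  resets \<open>g\<close> to 0 at \<open>f\<close>.\<close>

lemma F_der_in_span:
  assumes W: "linear_subspace (Der A) W" and gens: "\<And>f. f \<in> faces G pos curve \<Longrightarrow> face_derivation G curve f \<in> W"
    and "finite S" "S \<subseteq> faces G pos curve" "\<And>f. f \<notin> S \<Longrightarrow> g f = 0" "D \<in> Der0"
    "\<And>e. e \<in> arcs G \<Longrightarrow> D (arrow e) = (g (left_face e) - g (right_face e)) \<cdot> arrow e"
  shows "D \<in> W"
  using assms(3-7)
proof (induction S arbitrary: D g rule: finite_induct)
  case empty
  have "D = \<zero>\<^bsub>Der A\<^esub>"
    by (rule Der0_eqI[OF empty(3) Der0_zero])
      (simp add: empty(4) empty(2) Der_arrow smult_zero_left arrow_closed del: zero_fun_apply)
  then show ?case using linear_subspace_zero[OF W] by simp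
next
  case (insert f S)
  have f: "f \<in> faces G pos curve" using insert.prems(1) by simp
  note R = face_derivation_Der0(1)[where f = f]
  define D' where "D' = D \<oplus>\<^bsub>Der A\<^esub> (g f \<odot>\<^bsub>Der A\<^esub> face_derivation G curve f)"
  have D': "D' \<in> Der0" unfolding D'_def by (intro Der0_closed insert.prems(3) R)
  have "D' \<in> W"
  proof (rule insert.IH[of "g(f := 0)" D'])
    show "S \<subseteq> faces G pos curve" using insert.prems(1) by simp
    show "D' \<in> Der0" by (rule D')
    show "(g(f := 0)) f' = 0" if "f' \<notin> S" for f' using insert.prems(2) that by auto
    fix e assume e: "e \<in> arcs G"
    show "D' (arrow e) = ((g(f := 0)) (left_face e) - (g(f := 0)) (right_face e)) \<cdot> arrow e"
      unfolding D'_def Der_arrow[OF e] face_derivation_Der0(2)[OF e] face_coeff_eq[OF e f] insert.prems(4)[OF e]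
      by (auto simp: fun_eq_iff smult_apply algebra_simps)
  qed
  moreover have "D = D' \<oplus>\<^bsub>Der A\<^esub> ((- g f) \<odot>\<^bsub>Der A\<^esub> face_derivation G curve f)"
  proof (rule Der0_eqI[OF insert.prems(3)])
    show "D' \<oplus>\<^bsub>Der A\<^esub> ((- g f) \<odot>\<^bsub>Der A\<^esub> face_derivation G curve f) \<in> Der0"
      by (intro Der0_closed D' R)
    fix e assume e: "e \<in> arcs G"
    show "D (arrow e) = (D' \<oplus>\<^bsub>Der A\<^esub> ((- g f) \<odot>\<^bsub>Der A\<^esub> face_derivation G curve f)) (arrow e)"
      by (simp add: D'_def Der_arrow[OF e] fun_eq_iff smult_apply)
  qed
  moreover have "(- g f) \<odot>\<^bsub>Der A\<^esub> face_derivation G curve f \<in> W"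
    by (rule linear_subspace_smult[OF W gens[OF f]])
  ultimately show ?case using linear_subspace_add[OF W] by metis
qed

lemma D_F_eq: "D_F G pos curve = F_der"
proof
  show "D_F G pos curve \<subseteq> F_der" unfolding D_F_def
    by (rule linear_span_minimal[OF F_der_subspace]) (auto intro: face_derivation_F_der)
  show "F_der \<subseteq> D_F G pos curve"
  proof
    fix D assume "D \<in> F_der"
    then obtain g where g: "D \<in> Der0" "\<forall>e\<in>arcs G. D (arrow e) = (g (left_face e) - g (right_face e)) \<cdot> arrow e"
      by (rule F_derE)
    \<comment> \<open>Only the faces at some arrow affect the derivation. Cutting \<open>g\<close>
      off outside this finite set bypasses the question of how many faces there are.\<close>
    define S where "S = left_face ` arcs G \<union> right_face ` arcs G"
    have S: "finite S" "S \<subseteq> faces G pos curve"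
      using left_face_in right_face_in by (auto simp: S_def)
    define k where "k f = (if f \<in> S then g f else 0)" for f
    have "D (arrow e) = (k (left_face e) - k (right_face e)) \<cdot> arrow e" if "e \<in> arcs G" for e
      using g(2) that by (simp add: k_def S_def)
    then have "D \<in> W" if "linear_subspace (Der A) W" "face_derivation G curve ` faces G pos curve \<subseteq> W" for W
      using that(2) by (intro F_der_in_span[OF that(1) _ S _ g(1), of k]) (auto simp: k_def)
    then show "D \<in> D_F G pos curve" unfolding D_F_def linear_span_def by blast
  qed
qed

text \<open>An inner difference that kills the vertices is a cut. As \<open>D\<close> has no
  diagonal part, this cut is up to sign the face vector of \<open>E\<close>, so both vanish. The
  case in which \<open>D\<close> or \<open>E\<close> is zero yields injectivity of the class
  map.\<close>

lemma AL_F_independent: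
  assumes D: "D \<in> AL_der" and E: "E \<in> F_der" and DE: "(\<lambda>x\<in>carrier A. D x - E x) \<in> InDer A"
  shows "D = \<zero>\<^bsub>Der A\<^esub>" "E = \<zero>\<^bsub>Der A\<^esub>"
proof -
  have D0: "D \<in> Der0" using D by (simp add: AL_der_def)
  obtain g where E0: "E \<in> Der0" and g: "\<forall>e\<in>arcs G. E (arrow e) = (g (left_face e) - g (right_face e)) \<cdot> arrow e"
    using E by (rule F_derE)
  obtain a where a: "a \<in> carrier A" and eq: "(\<lambda>x\<in>carrier A. D x - E x) = inner_derivation A a"
    using DE by (auto simp: InDer_def)
  have I0: "inner_derivation A a \<in> Der0" using Der0_diff[OF D0 E0] by (simp add: eq)
  \<comment> \<open>The sign makes the cut of \<open>\<phi>\<close> equal to the face vector of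
    \<open>E\<close>, which enters the difference with a minus.\<close>
  define \<phi> where "\<phi> v = - a (v, [])" for v
  have val: "D (arrow e) = ((g (left_face e) - g (right_face e)) - (\<phi> (tail G e) - \<phi> (head G e))) \<cdot> arrow e"
    if e: "e \<in> arcs G" for e
  proof -
    have "D (arrow e) - E (arrow e) = (a (tail G e, []) - a (head G e, [])) \<cdot> arrow e"
      using inner_Der0_arrow[OF a I0 e] arrow_closed[OF e] by (simp add: eq[symmetric] del: minus_apply)
    then have "D (arrow e) = E (arrow e) + (a (tail G e, []) - a (head G e, [])) \<cdot> arrow e"
      by (simp only: diff_eq_eq add.commute)
    then show ?thesis using g e by (simp add: fun_eq_iff smult_apply \<phi>_def algebra_simps)
  qed
  have bal: "\<phi> (tail G e) - \<phi> (head G e) = g (left_face e) - g (right_face e)" if e: "e \<in> arcs G" for e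
  proof -
    have "D (arrow e) (arrow_path G e) = 0" using D e by (simp add: AL_der_def)
    then show ?thesis unfolding val[OF e] by (simp add: smult_apply path_vec_def)
  qed
  have zero: "g (left_face e) - g (right_face e) = 0" if e: "e \<in> arcs G" for e
    using cut_meets_face_trivially[of \<phi> g, OF bal e] bal[OF e] by simp
  show "D = \<zero>\<^bsub>Der A\<^esub>"
    by (rule Der0_eqI[OF D0 Der0_zero]) (simp add: val bal Der_arrow smult_zero_left arrow_closed)
  show "E = \<zero>\<^bsub>Der A\<^esub>"
    by (rule Der0_eqI[OF E0 Der0_zero]) (simp add: g zero Der_arrow smult_zero_left arrow_closed)
qed

section \<open>Passage to classes in the first Hochschild cohomology\<close>

lemma zero_mem: "\<zero>\<^bsub>Der A\<^esub> \<in> AL_der" "\<zero>\<^bsub>Der A\<^esub> \<in> F_der"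
  by (rule linear_subspace_zero[OF AL_der_subspace] linear_subspace_zero[OF F_der_subspace])+

lemma AL_der_derivation: "D \<in> AL_der \<Longrightarrow> D \<in> derivations A"
  and F_der_derivation: "D \<in> F_der \<Longrightarrow> D \<in> derivations A"
  by (auto simp: AL_der_def F_der_def Der0_def)

lemma diff_eq_add: "D \<in> derivations A \<Longrightarrow> E \<in> derivations A \<Longrightarrow>
    (\<lambda>x\<in>carrier A. D x - E x) = D \<oplus>\<^bsub>Der A\<^esub> ((- 1) \<odot>\<^bsub>Der A\<^esub> E)"
  by (auto simp: Der_simps smult_minus_one der_closed intro!: restrict_ext)

lemma diff_eq_zero:
  assumes "D \<in> derivations A" "E \<in> derivations A" "(\<lambda>x\<in>carrier A. D x - E x) = \<zero>\<^bsub>Der A\<^esub>"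
  shows "D = E"
proof (rule derivation_eqI[OF assms(1,2)])
  fix x assume "x \<in> carrier A"
  then show "D x = E x" using fun_cong[OF assms(3), of x] by (simp add: Der_simps)
qed

lemma inj_cls_AL: "inj_on cls AL_der"
proof (rule inj_onI)
  fix D E assume D: "D \<in> AL_der" and E: "E \<in> AL_der" and eq: "cls D = cls E"
  let ?d = "\<lambda>x\<in>carrier A. D x - E x"
  note d = AL_der_derivation[OF D] AL_der_derivation[OF E]
  have "?d \<in> AL_der" unfolding diff_eq_add[OF d]
    by (intro linear_subspace_add[OF AL_der_subspace] linear_subspace_smult[OF AL_der_subspace] D E)
  moreover have "(\<lambda>x\<in>carrier A. ?d x - \<zero>\<^bsub>Der A\<^esub> x) = ?d" by (auto simp: Der_simps intro!: restrict_ext)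
  ultimately have "?d = \<zero>\<^bsub>Der A\<^esub>"
    using AL_F_independent(1)[OF _ zero_mem(2), of ?d] eq cls_eq_iff[OF d] by simp
  then show "D = E" by (rule diff_eq_zero[OF d])
qed

lemma inj_cls_F: "inj_on cls F_der"
proof (rule inj_onI)
  fix D E assume D: "D \<in> F_der" and E: "E \<in> F_der" and eq: "cls D = cls E"
  \<comment> \<open>\<open>AL_F_independent\<close> subtracts the member of \<open>F_der\<close>;
    with 0 as the other member it meets the difference in the opposite order.\<close>
  let ?d = "\<lambda>x\<in>carrier A. D x - E x" and ?d' = "\<lambda>x\<in>carrier A. E x - D x"
  note d = F_der_derivation[OF D] F_der_derivation[OF E]
  have "?d \<in> F_der" unfolding diff_eq_add[OF d]
    by (intro linear_subspace_add[OF F_der_subspace] linear_subspace_smult[OF F_der_subspace] D E)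
  moreover have "(\<lambda>x\<in>carrier A. \<zero>\<^bsub>Der A\<^esub> x - ?d x) = ?d'" by (auto simp: Der_simps intro!: restrict_ext)
  ultimately have "?d = \<zero>\<^bsub>Der A\<^esub>"
    using AL_F_independent(2)[OF zero_mem(1), of ?d] eq cls_eq_iff[OF d(2,1)] by simp
  then show "D = E" by (rule diff_eq_zero[OF d])
qed

lemma cls_reduction:
  assumes "D \<in> derivations A"
  obtains E where "E \<in> Der0" "cls D = cls E"
proof -
  obtain a where a: "a \<in> carrier A" "(\<lambda>x\<in>carrier A. D x - inner_derivation A a x) \<in> Der0"
    using assms by (rule derivation_reduction)
  let ?E = "\<lambda>x\<in>carrier A. D x - inner_derivation A a x"
  have "(\<lambda>x\<in>carrier A. D x - ?E x) = inner_derivation A a"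
    by (auto simp: inner_derivation_eq[OF a(1)] intro!: restrict_ext)
  then have "cls D = cls ?E"
    using cls_eq_iff[OF assms Der0_derivation[OF a(2)]] a(1) by (simp add: InDer_def)
  then show thesis using a(2) by (intro that[of ?E])
qed

text \<open>The diagonal coefficients of \<open>D\<close> are a cut plus a face vector. Subtracting
  the corresponding inner derivation and the member \<open>E\<close> of \<open>F_der\<close> leaves
  a derivation with zero diagonal, that is, one in \<open>AL_der\<close>.\<close>

lemma Der0_decomposition:
  assumes D: "D \<in> Der0"
  obtains B E where "B \<in> AL_der" "E \<in> F_der" "cls D = cls (B \<oplus>\<^bsub>Der A\<^esub> E)"
proof -
  define x where "x e = D (arrow e) (arrow_path G e)" for e
  obtain \<phi> and g :: "complex set \<Rightarrow> 'k" where
    x: "\<And>e. e \<in> arcs G \<Longrightarrow> x e = (\<phi> (tail G e) - \<phi> (head G e)) + (g (left_face e) - g (right_face e))"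
    using cut_plus_face[of x] by blast
  define E where "E = der_of (\<lambda>e. (g (left_face e) - g (right_face e)) \<cdot> arrow e)"
  have E0: "E \<in> Der0" unfolding E_def by (rule der_of_Der0(1)[OF diagonal_admissible])
  have Ev: "E (arrow e) = (g (left_face e) - g (right_face e)) \<cdot> arrow e" if "e \<in> arcs G" for e
    unfolding E_def by (rule der_of_Der0(2)[OF diagonal_admissible that])
  from E0 Ev have E: "E \<in> F_der" by (rule F_derI)
  obtain a where a: "a \<in> carrier A" "inner_derivation A a \<in> Der0"
    and av: "\<And>e. e \<in> arcs G \<Longrightarrow> inner_derivation A a (arrow e) = (\<phi> (tail G e) - \<phi> (head G e)) \<cdot> arrow e"
    using coboundary_inner[of \<phi>] by blast
  define B where "B = (\<lambda>y\<in>carrier A. (\<lambda>y\<in>carrier A. D y - E y) y - inner_derivation A a y)"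
  have B0: "B \<in> Der0" unfolding B_def by (intro Der0_diff D E0 a)
  have "B (arrow e) (arrow_path G e) = 0" if e: "e \<in> arcs G" for e
  proof -
    have "B (arrow e) = D (arrow e) - E (arrow e) - inner_derivation A a (arrow e)"
      using arrow_closed[OF e] by (simp add: B_def del: minus_apply)
    moreover have "arrow e (arrow_path G e) = 1" by (simp add: path_vec_def)
    ultimately show ?thesis using x[OF e] by (simp add: Ev[OF e] av[OF e] smult_apply x_def)
  qed
  then have B: "B \<in> AL_der" using B0 by (simp add: AL_der_def)
  have BE: "B \<oplus>\<^bsub>Der A\<^esub> E \<in> derivations A" by (intro Der0_derivation Der0_add B0 E0)
  have "(\<lambda>y\<in>carrier A. D y - (B \<oplus>\<^bsub>Der A\<^esub> E) y) = inner_derivation A a"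
    by (auto simp: B_def Der_simps inner_derivation_eq[OF a(1)] intro!: restrict_ext)
  then have "cls D = cls (B \<oplus>\<^bsub>Der A\<^esub> E)"
    using cls_eq_iff[OF Der0_derivation[OF D] BE] a(1) by (simp add: InDer_def)
  then show thesis using B E by (intro that)
qed

lemma direct_sum: "direct_sum_decomposition (HH1 A) (cls ` AL_der) (cls ` F_der)"
  unfolding direct_sum_decomposition_def
proof (intro conjI)
  show "linear_subspace (HH1 A) (cls ` AL_der)" "linear_subspace (HH1 A) (cls ` F_der)"
    by (intro subspace_HH1 AL_der_subspace F_der_subspace)+
  show "cls ` AL_der \<inter> cls ` F_der = {\<zero>\<^bsub>HH1 A\<^esub>}"
  proof
    show "{\<zero>\<^bsub>HH1 A\<^esub>} \<subseteq> cls ` AL_der \<inter> cls ` F_der" using zero_mem by (simp add: zero_HH1)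
    show "cls ` AL_der \<inter> cls ` F_der \<subseteq> {\<zero>\<^bsub>HH1 A\<^esub>}"
    proof
      fix c assume "c \<in> cls ` AL_der \<inter> cls ` F_der"
      then obtain D E where DE: "D \<in> AL_der" "E \<in> F_der" "c = cls D" "cls D = cls E" by auto
      then have "(\<lambda>x\<in>carrier A. D x - E x) \<in> InDer A"
        using cls_eq_iff[OF AL_der_derivation F_der_derivation] by blast
      then have "D = \<zero>\<^bsub>Der A\<^esub>" using AL_F_independent(1) DE by blast
      then show "c \<in> {\<zero>\<^bsub>HH1 A\<^esub>}" using DE by (simp add: zero_HH1)
    qed
  qed
  show "cls ` AL_der <+>\<^bsub>HH1 A\<^esub> cls ` F_der = carrier (HH1 A)"
  proof
    show "cls ` AL_der <+>\<^bsub>HH1 A\<^esub> cls ` F_der \<subseteq> carrier (HH1 A)"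
      by (auto simp: set_add_def' carrier_HH1 add_HH1 AL_der_derivation F_der_derivation)
        (auto simp: Der_simps Der_add_closed AL_der_derivation F_der_derivation)
    show "carrier (HH1 A) \<subseteq> cls ` AL_der <+>\<^bsub>HH1 A\<^esub> cls ` F_der"
    proof
      fix c assume "c \<in> carrier (HH1 A)"
      then obtain D where D: "D \<in> derivations A" "c = cls D" by (auto simp: carrier_HH1)
      obtain D0 where D0: "D0 \<in> Der0" "cls D = cls D0" using D(1) by (rule cls_reduction)
      obtain B E where BE: "B \<in> AL_der" "E \<in> F_der" "cls D0 = cls (B \<oplus>\<^bsub>Der A\<^esub> E)"
        using D0(1) by (rule Der0_decomposition)
      then have "c = cls B \<oplus>\<^bsub>HH1 A\<^esub> cls E"
        using D(2) D0(2) by (simp add: add_HH1 AL_der_derivation F_der_derivation)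
      then show "c \<in> cls ` AL_der <+>\<^bsub>HH1 A\<^esub> cls ` F_der" using BE(1,2) by (auto simp: set_add_def')
    qed
  qed
qed

text \<open>Both derivations are diagonal on the arrows, so they commute there.\<close>

lemma F_der_abelian:
  assumes D: "D \<in> F_der" and E: "E \<in> F_der"
  shows "D \<otimes>\<^bsub>Der A\<^esub> E = \<zero>\<^bsub>Der A\<^esub>"
proof -
  obtain g where g: "D \<in> Der0" "\<forall>e\<in>arcs G. D (arrow e) = (g (left_face e) - g (right_face e)) \<cdot> arrow e"
    using D by (rule F_derE)
  obtain k where k: "E \<in> Der0" "\<forall>e\<in>arcs G. E (arrow e) = (k (left_face e) - k (right_face e)) \<cdot> arrow e"
    using E by (rule F_derE)
  note d = Der0_derivation[OF g(1)] Der0_derivation[OF k(1)]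
  show ?thesis
  proof (rule Der0_eqI[OF Der0_bracket[OF g(1) k(1)] Der0_zero])
    fix e assume e: "e \<in> arcs G"
    note cl = arrow_closed[OF e]
    have "D (E (arrow e)) = E (D (arrow e))"
      using g(2) k(2) e cl by (simp add: der_smult[OF d(1)] der_smult[OF d(2)] smult_assoc[symmetric] mult.commute)
    then show "(D \<otimes>\<^bsub>Der A\<^esub> E) (arrow e) = \<zero>\<^bsub>Der A\<^esub> (arrow e)"
      using cl by (simp add: Der_bracket[OF d] Der_simps(3) del: minus_apply)
  qed
qed

lemma abelian_F: "abelian_lie_subalgebra (HH1 A) (cls ` F_der)"
  unfolding abelian_lie_subalgebra_def lie_subalgebra_def
  using subspace_HH1[OF F_der_subspace] zero_mem
  by (auto simp: bracket_HH1 F_der_derivation F_der_abelian zero_HH1)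

text \<open>\<open>AL_der_ideal\<close> concerns brackets with members of \<open>Der0\<close>; by
  \<open>cls_reduction\<close> every class has such a representative.\<close>

lemma semidirect:
  assumes "nomulti_digraph G"
  shows "lie_semidirect_sum (HH1 A) (cls ` AL_der) (cls ` F_der)"
  unfolding lie_semidirect_sum_def lie_ideal_def
proof (intro conjI ballI lie_algebra_HH1 direct_sum subspace_HH1 AL_der_subspace)
  show "lie_subalgebra (HH1 A) (cls ` F_der)" using abelian_F by (simp add: abelian_lie_subalgebra_def)
  fix c b assume c: "c \<in> carrier (HH1 A)" and b: "b \<in> cls ` AL_der"
  obtain D where D: "D \<in> derivations A" "c = cls D" using c by (auto simp: carrier_HH1)
  obtain D0 where D0: "D0 \<in> Der0" "cls D = cls D0" using D(1) by (rule cls_reduction)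
  obtain E where E: "E \<in> AL_der" "b = cls E" using b by auto
  have "c \<otimes>\<^bsub>HH1 A\<^esub> b = cls (D0 \<otimes>\<^bsub>Der A\<^esub> E)"
    using D D0 E by (simp add: bracket_HH1 Der0_derivation AL_der_derivation)
  then show "c \<otimes>\<^bsub>HH1 A\<^esub> b \<in> cls ` AL_der" using AL_der_ideal[OF assms D0(1) E(1)] by auto
qed

text \<open>Members of \<open>Der0\<close> are compared on arrows, where the partial sum over
  \<open>S\<close> already has the right value at the arrows of \<open>S\<close> and 0 at the
  others.\<close>

lemma face_derivation_finsum:
  "face_derivation G curve f =
    (\<Oplus>\<^bsub>Der A\<^esub>p\<in>arcs G. face_coeff curve f p \<odot>\<^bsub>Der A\<^esub> D_rs G p (arrow_path G p))"
proof -
  interpret DA: abelian_group "Der A" by (rule abelian_group_Der)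
  let ?t = "\<lambda>p. (face_coeff curve f p :: 'k) \<odot>\<^bsub>Der A\<^esub> D_rs G p (arrow_path G p)"
  have diag: "D_rs G p (arrow_path G p) \<in> Der0"
    "\<And>e. e \<in> arcs G \<Longrightarrow> D_rs G p (arrow_path G p) (arrow e) = (if e = p then arrow p else 0)" if "p \<in> arcs G" for p
    using D_rs_Der0[OF that arrow_path(1)[OF that]] by (simp_all add: parallel_def)
  have t: "?t p \<in> Der0" if "p \<in> arcs G" for p using diag[OF that] by (simp add: Der0_smult)
  then have tc: "?t p \<in> carrier (Der A)" if "p \<in> arcs G" for p
    using that by (simp add: Der_simps(1) Der0_derivation)
  have "finsum (Der A) ?t S \<in> Der0 \<and> (\<forall>e\<in>arcs G. finsum (Der A) ?t S (arrow e) =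
      (if e \<in> S then face_coeff curve f e \<cdot> arrow e else 0))" if "finite S" "S \<subseteq> arcs G" for S
    using that
  proof (induction S rule: finite_induct)
    case empty
    then show ?case by (simp add: Der0_zero Der_arrow)
  next
    case (insert p S)
    then have p: "p \<in> arcs G" and S: "S \<subseteq> arcs G" by auto
    note IH = insert.IH[OF S]
    have eq: "finsum (Der A) ?t (insert p S) = ?t p \<oplus>\<^bsub>Der A\<^esub> finsum (Der A) ?t S"
      using insert.hyps p S tc by (intro DA.finsum_insert) auto
    have "finsum (Der A) ?t (insert p S) \<in> Der0" unfolding eq using IH t[OF p] by (intro Der0_add) auto
    moreover have "finsum (Der A) ?t (insert p S) (arrow e) =
        (if e \<in> insert p S then face_coeff curve f e \<cdot> arrow e else 0)" if e: "e \<in> arcs G" for e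
      unfolding eq Der_arrow[OF e] diag(2)[OF p e]
      using IH e insert.hyps(2)
      by (cases "e = p") (simp_all add: smult_zero_right del: zero_fun_apply plus_fun_apply)
    ultimately show ?case by blast
  qed
  from this[OF finite_arcs subset_refl]
  show ?thesis
    by (intro Der0_eqI face_derivation_Der0(1)) (simp_all add: face_derivation_Der0(2))
qed

text \<open>The bracket is evaluated at \<open>r\<close>: one composition produces the weight of the
  path \<open>s\<close>, the other the weight of the arrow \<open>r\<close>. The class is nonzero
  because the class map is injective on \<open>AL_der\<close>.\<close>

lemma face_eigenvector:
  assumes rs: "(r, s) \<in> almost_oriented_cycles G"
  shows "cls (D_rs G r s) \<noteq> \<zero>\<^bsub>HH1 A\<^esub>"
    and "cls (face_derivation G curve f) \<otimes>\<^bsub>HH1 A\<^esub> cls (D_rs G r s) =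
      (- face_coeff curve f r + (\<Sum>q\<leftarrow>snd s. face_coeff curve f q)) \<odot>\<^bsub>HH1 A\<^esub> cls (D_rs G r s)"
proof -
  have r: "r \<in> arcs G" "s \<in> qpaths G" "parallel G s (arrow_path G r)"
    using rs by (auto simp: almost_oriented_cycles_def)
  note R = D_rs_Der0[OF r]
  note F = face_derivation_Der0[where f = f]
  note d = Der0_derivation[OF F(1)] Der0_derivation[OF R(1)]
  show "cls (D_rs G r s) \<noteq> \<zero>\<^bsub>HH1 A\<^esub>"
  proof
    assume "cls (D_rs G r s) = \<zero>\<^bsub>HH1 A\<^esub>"
    then have "D_rs G r s = \<zero>\<^bsub>Der A\<^esub>"
      using inj_onD[OF inj_cls_AL _ D_rs_AL_der[OF rs] zero_mem(1)] by (simp add: zero_HH1)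
    then have "vec s = 0" using R(2)[OF r(1)] by (simp add: Der_arrow(3)[OF r(1)])
    then have "vec s s = 0" by simp
    then show False by (simp add: path_vec_def)
  qed
  let ?c = "- face_coeff curve f r + (\<Sum>q\<leftarrow>snd s. face_coeff curve f q) :: 'k"
  have w: "awalk (fst s) (snd s) (qhead G s)" using qpathsD[of "fst s" "snd s"] r(2) by simp
  have Fs: "face_derivation G curve f (vec s) = (\<Sum>q\<leftarrow>snd s. face_coeff curve f q) \<cdot> vec s"
    using Der0_diagonal_vec[OF F w] by simp
  have "face_derivation G curve f \<otimes>\<^bsub>Der A\<^esub> D_rs G r s = ?c \<odot>\<^bsub>Der A\<^esub> D_rs G r s"
  proof (rule Der0_eqI[OF Der0_bracket[OF F(1) R(1)] Der0_smult[OF R(1)]])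
    fix e assume e: "e \<in> arcs G"
    have "(face_derivation G curve f \<otimes>\<^bsub>Der A\<^esub> D_rs G r s) (arrow e) =
       face_derivation G curve f (D_rs G r s (arrow e)) - face_coeff curve f e \<cdot> D_rs G r s (arrow e)"
      using arrow_closed[OF e] by (simp add: Der_bracket[OF d] F(2)[OF e] der_smult[OF d(2)] del: minus_apply)
    also have "\<dots> = ?c \<cdot> D_rs G r s (arrow e)"
    proof (cases "e = r")
      case True
      then have "D_rs G r s (arrow e) = vec s" using R(2)[OF e] by simp
      then show ?thesis
        unfolding True by (simp only: Fs) (auto simp: fun_eq_iff smult_apply algebra_simps)
    next
      case False
      then show ?thesis by (simp add: R(2)[OF e] der_zero[OF d(1)] smult_zero_right del: zero_fun_apply)
    qed
    finally show "(face_derivation G curve f \<otimes>\<^bsub>Der A\<^esub> D_rs G r s) (arrow e) = (?c \<odot>\<^bsub>Der A\<^esub> D_rs G r s) (arrow e)"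
      by (simp only: Der_arrow[OF e])
  qed
  then show "cls (face_derivation G curve f) \<otimes>\<^bsub>HH1 A\<^esub> cls (D_rs G r s) = ?c \<odot>\<^bsub>HH1 A\<^esub> cls (D_rs G r s)"
    using d by (simp add: bracket_HH1 smult_HH1)
qed

end

theorem theorem5p7:
  fixes G :: "('v, 'e) pre_digraph"
    and pos :: "'v \<Rightarrow> complex" and curve :: "'e \<Rightarrow> real \<Rightarrow> complex"
  assumes "fin_digraph G"
    and "Digraph_Component.connected G"
    and "acyclic_quiver G"
    and "planar_embedding G pos curve"
  shows
    "let A = (path_algebra G :: ('k::field_char_0, ('v, 'e) qpath \<Rightarrow> 'k) module);
         cls = HH1_class A;
         AL = cls ` D_AL G;
         F = cls ` D_F G pos curve
     in
       inj_on cls (D_AL G) \<and> inj_on cls (D_F G pos curve) \<and>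
       lie_algebra (HH1 A) \<and>
       (nomulti_digraph G \<longrightarrow> lie_semidirect_sum (HH1 A) AL F) \<and>
       direct_sum_decomposition (HH1 A) AL F \<and>
       abelian_lie_subalgebra (HH1 A) F \<and>
       (\<forall>f\<in>faces G pos curve.
          face_derivation G curve f =
            (\<Oplus>\<^bsub>Der A\<^esub>p\<in>arcs G. face_coeff curve f p \<odot>\<^bsub>Der A\<^esub> D_rs G p (arrow_path G p)) \<and>
          (\<forall>(r, s)\<in>almost_oriented_cycles G.
             cls (D_rs G r s) \<noteq> \<zero>\<^bsub>HH1 A\<^esub> \<and>
             cls (face_derivation G curve f) \<otimes>\<^bsub>HH1 A\<^esub> cls (D_rs G r s) =
               (- face_coeff curve f r + (\<Sum>q\<leftarrow>snd s. face_coeff curve f q))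
                 \<odot>\<^bsub>HH1 A\<^esub> cls (D_rs G r s)))"
proof -
  interpret fin_digraph G by fact
  interpret acyclic_quiver_algebra G "TYPE('k)" by unfold_locales (rule assms(3))
  \<comment> \<open>Acyclicity excludes loops, so every curve is an arc.\<close>
  interpret planar_quiver_algebra G "TYPE('k)" pos curve
    by unfold_locales (use arrow_not_loop assms(4) in auto)
  show ?thesis
    unfolding Let_def D_AL_eq D_F_eq
    using inj_cls_AL inj_cls_F lie_algebra_HH1 semidirect direct_sum abelian_F face_derivation_finsum face_eigenvector
    by (intro conjI impI ballI) auto
qed

end
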